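(* Let $\alpha\in(0,1)$, $D=(0,1)$, and let $F\in H^1(\mathbb R_+)$ be a deterministic function with $F(0)=0$. Then the stochastic two-point boundary value problem \[ \begin{cases} \partial_{xx}U(x,\omega)-(\mathrm i\omega)^\alpha U(x,\omega)=-\hat F(\omega)\dot W_x, & x\in D,\ \omega\in\mathbb R,\\ \partial_xU(0,\omega)=0,\quad U(1,\omega)=0, & \omega\in\mathbb R, \end{cases} \] admits a unique mild solution, given by \[ U(x,\omega)=-\hat F(\omega)\int_D g_\omega(x,y)\,dW_y . \] Moreover, there is a constant $C>0$ such that \[ \mathbb E\,\|\mathrm i\omega U\|_{L^2(\mathbb R;L^2(D))}^2\le C\|F\|_{H^1(\mathbb R_+)}^2 . \]
   Context: $W$ is a standard one-dimensional (spatial) Brownian motion on $[0,1]$, $\dot W_x$ is its formal derivative in $x$ (white noise), and $\int_D\cdot\,dW_y$ is the Itô (Wiener) integral. $\tilde F$ is the extension of $F$ by zero to $(-\infty,0)$ and $\hat F(\omega)=\int_{\mathbb R}e^{-\mathrm i\omega t}\tilde F(t)\,dt$ (in the $L^2$ sense) is its Fourier transform. Convention for fractional powers: $(\mathrm i\omega)^\beta=|\omega|^\beta\exp\left(\frac{\mathrm i\pi\beta}{2}\operatorname{sgn}(\omega)\right)$ for $\omega\ne0$, and $(\mathrm i\omega)^\beta=0$ for $\omega=0$. $g_\omega(x,y)$ is the Green function of the problem: for $y\in D$, $\partial_{xx}g_\omega(x,y)-(\mathrm i\omega)^\alpha g_\omega(x,y)=\delta(x-y)$, $\partial_xg_\omega(0,y)=0$,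 $g_\omega(1,y)=0$. Explicitly, with $\sqrt s:=(\mathrm i\omega)^{\alpha/2}$, for $\omega\neq0$, \[ g_\omega(x,y)=\frac{e^{\sqrt s(x+y)}+e^{\sqrt s|x-y|}-e^{\sqrt s(2-x-y)}-e^{\sqrt s(2-|x-y|)}}{2\sqrt s\,(1+e^{2\sqrt s})}, \] and $g_0(x,y)=\max\{x,y\}-1$. "Mild solution" is understood in the Green function sense, i.e. the random field obtained by representing the solution of the boundary value problem with right-hand side $-\hat F(\omega)\dot W_x$ by integrating the Green function against the right-hand side as a stochastic integral. The norm is $\|\mathrm i\omega U\|_{L^2(\mathbb R;L^2(D))}^2=\int_{\mathbb R}\int_D|\omega U(x,\omega)|^2\,dx\,d\omega$. The constant $C$ does not depend on $F$. *)

theory Defs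
  imports "HOL-Probability.Probability"
begin

section \<open>Brownian motion and the Wiener integral\<close>

definition brownian_motion_01 :: "'a measure \<Rightarrow> (real \<Rightarrow> 'a \<Rightarrow> real) \<Rightarrow> bool" where
  "brownian_motion_01 M W \<longleftrightarrow>
     prob_space M \<and>
     (\<forall>t\<in>{0..1}. W t \<in> borel_measurable M) \<and>
     (AE s in M. W 0 s = 0) \<and>
     (\<forall>a b. 0 \<le> a \<and> a < b \<and> b \<le> 1 \<longrightarrow>
        distributed M lborel (\<lambda>s. W b s - W a s) (normal_density 0 (sqrt (b - a)))) \<and>
     (\<forall>(n::nat) (\<tau>::nat \<Rightarrow> real). mono \<tau> \<and> range \<tau> \<subseteq> {0..1} \<longrightarrow>
        prob_space.indep_vars M (\<lambda>_. borel) (\<lambda>i s. W (\<tau> (Suc i)) s - W (\<tau> i) s) {..<n}) \<and>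
     (AE s in M. continuous_on {0..1} (\<lambda>t. W t s))"

text \<open>
  A list of triples \<open>(c, a, b)\<close> encodes the step function \<open>\<Sum> c \<cdot> 1\<^bsub>(a,b]\<^esub>\<close>.
\<close>

type_synonym step = "(complex \<times> real \<times> real) list"

definition valid_step :: "step \<Rightarrow> bool" where
  "valid_step p \<longleftrightarrow> (\<forall>(c, a, b)\<in>set p. 0 \<le> a \<and> a \<le> b \<and> b \<le> 1)"

definition step_fun :: "step \<Rightarrow> real \<Rightarrow> complex" where
  "step_fun p y = (\<Sum>(c, a, b)\<leftarrow>p. c * indicator {a<..b} y)"

definition step_integral :: "(real \<Rightarrow> 'a \<Rightarrow> real) \<Rightarrow> step \<Rightarrow> 'a \<Rightarrow> complex" where
  "step_integral W p s = (\<Sum>(c, a, b)\<leftarrow>p. c * of_real (W b s - W a s))"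

text \<open>
  \<open>X\<close> is a version of \<open>\<integral>\<^bsub>(0,1)\<^esub> f dW\<close>: the limit in \<open>L\<^sup>2(M)\<close> of the integrals of step functions
  converging to \<open>f\<close> in \<open>L\<^sup>2(0,1)\<close>.
\<close>

definition is_wiener_integral ::
  "'a measure \<Rightarrow> (real \<Rightarrow> 'a \<Rightarrow> real) \<Rightarrow> (real \<Rightarrow> complex) \<Rightarrow> ('a \<Rightarrow> complex) \<Rightarrow> bool" where
  "is_wiener_integral M W f X \<longleftrightarrow>
     set_borel_measurable lborel {0<..<1} f \<and> X \<in> borel_measurable M \<and>
     (\<exists>P :: nat \<Rightarrow> step. (\<forall>n. valid_step (P n)) \<and>
        (\<lambda>n. \<integral>\<^sup>+y\<in>{0<..<1}. ennreal ((cmod (step_fun (P n) y - f y))\<^sup>2) \<partial>lborel) \<longlonglongrightarrow> 0 \<and>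
        (\<lambda>n. \<integral>\<^sup>+s. ennreal ((cmod (step_integral W (P n) s - X s))\<^sup>2) \<partial>M) \<longlonglongrightarrow> 0)"

text \<open>Determined up to almost sure equality.\<close>

definition wiener_integral ::
  "'a measure \<Rightarrow> (real \<Rightarrow> 'a \<Rightarrow> real) \<Rightarrow> (real \<Rightarrow> complex) \<Rightarrow> 'a \<Rightarrow> complex" where
  "wiener_integral M W f = (SOME X. is_wiener_integral M W f X)"

section \<open>The space \<open>H\<^sup>1\<close> on the half-line\<close>

definition test_function :: "real set \<Rightarrow> (real \<Rightarrow> real) \<Rightarrow> bool" where
  "test_function S \<phi> \<longleftrightarrow>
     (\<forall>n x. (deriv ^^ n) \<phi> differentiable (at x)) \<and>
     compact (closure {x. \<phi> x \<noteq> 0}) \<and> closure {x. \<phi> x \<noteq> 0} \<subseteq> S"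

definition L2_on :: "real set \<Rightarrow> (real \<Rightarrow> complex) \<Rightarrow> bool" where
  "L2_on S f \<longleftrightarrow>
     set_borel_measurable lborel S f \<and> set_integrable lborel S (\<lambda>t. (cmod (f t))\<^sup>2)"

definition is_weak_deriv :: "real set \<Rightarrow> (real \<Rightarrow> complex) \<Rightarrow> (real \<Rightarrow> complex) \<Rightarrow> bool" where
  "is_weak_deriv S f g \<longleftrightarrow>
     (\<forall>\<phi>. test_function S \<phi> \<longrightarrow>
        (LINT t:S|lborel. deriv \<phi> t *\<^sub>R f t) = - (LINT t:S|lborel. \<phi> t *\<^sub>R g t))"

definition H1_half_line :: "(real \<Rightarrow> complex) \<Rightarrow> bool" where
  "H1_half_line F \<longleftrightarrow> L2_on {0<..} F \<and> (\<exists>G. L2_on {0<..} G \<and> is_weak_deriv {0<..} F G)"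

definition weak_deriv_half_line :: "(real \<Rightarrow> complex) \<Rightarrow> real \<Rightarrow> complex" where
  "weak_deriv_half_line F = (SOME G. L2_on {0<..} G \<and> is_weak_deriv {0<..} F G)"

definition H1_norm_half_line :: "(real \<Rightarrow> complex) \<Rightarrow> real" where
  "H1_norm_half_line F =
     sqrt ((LINT t:{0<..}|lborel. (cmod (F t))\<^sup>2) +
           (LINT t:{0<..}|lborel. (cmod (weak_deriv_half_line F t))\<^sup>2))"

text \<open>
  The boundary value at \<open>0\<close> of an \<open>H\<^sup>1\<close> function, i.e. the value of its continuous representative
  (the pointwise value of \<open>F\<close> at \<open>0\<close> is irrelevant).
\<close>

definition value_at_0 :: "(real \<Rightarrow> complex) \<Rightarrow> complex" where
  "value_at_0 F = (THE c. \<exists>G. continuous_on {0..} G \<and> (AE t in lborel. 0 < t \<longrightarrow> F t = G t) \<and> G 0 = c)"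

section \<open>The Fourier transform on \<open>L\<^sup>2\<close>\<close>

definition zero_extension :: "(real \<Rightarrow> complex) \<Rightarrow> real \<Rightarrow> complex" where
  "zero_extension F t = (if t < 0 then 0 else F t)"

text \<open>The transform is the \<open>L\<^sup>2\<close> limit of the transforms of truncations; it is determined
  up to almost everywhere equality.\<close>

definition is_fourier_L2 :: "(real \<Rightarrow> complex) \<Rightarrow> (real \<Rightarrow> complex) \<Rightarrow> bool" where
  "is_fourier_L2 f h \<longleftrightarrow>
     h \<in> borel_measurable borel \<and>
     (\<lambda>n::nat. \<integral>\<^sup>+\<omega>. ennreal ((cmod (h \<omega> -
          (LINT t:{- real n..real n}|lborel. exp (- (\<i> * of_real \<omega> * of_real t)) * f t)))\<^sup>2)
        \<partial>lborel) \<longlonglongrightarrow> 0"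

definition fourier_L2 :: "(real \<Rightarrow> complex) \<Rightarrow> real \<Rightarrow> complex" where
  "fourier_L2 f = (SOME h. is_fourier_L2 f h)"

section \<open>The boundary value problem\<close>

text \<open>The fractional power \<open>(\<i>\<omega>)\<^sup>\<beta>\<close>.\<close>

definition ipow :: "real \<Rightarrow> real \<Rightarrow> complex" where
  "ipow \<omega> \<beta> =
     (if \<omega> = 0 then 0
      else of_real (\<bar>\<omega>\<bar> powr \<beta>) * exp (\<i> * of_real (pi * \<beta> / 2 * sgn \<omega>)))"

text \<open>
  Green function of \<open>u'' - \<mu> u\<close> on \<open>(0,1)\<close> with \<open>u'(0) = 0\<close>, \<open>u(1) = 0\<close>; the equation
  \<open>\<partial>\<^sub>x\<^sub>x g(x,y) - \<mu> g(x,y) = \<delta>(x - y)\<close> is meant in the sense of distributions in \<open>x\<close>.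
\<close>

definition is_green_function :: "complex \<Rightarrow> (real \<Rightarrow> real \<Rightarrow> complex) \<Rightarrow> bool" where
  "is_green_function \<mu> g \<longleftrightarrow>
     (\<forall>y\<in>{0<..<1}.
        continuous_on {0..1} (\<lambda>x. g x y) \<and>
        (\<forall>\<phi>. test_function {0<..<1} \<phi> \<longrightarrow>
           (LINT x:{0<..<1}|lborel. deriv (deriv \<phi>) x *\<^sub>R g x y)
             - \<mu> * (LINT x:{0<..<1}|lborel. \<phi> x *\<^sub>R g x y) = of_real (\<phi> y)) \<and>
        ((\<lambda>x. g x y) has_vector_derivative 0) (at 0 within {0..1}) \<and>
        g 1 y = 0)"

definition green :: "real \<Rightarrow> real \<Rightarrow> real \<Rightarrow> real \<Rightarrow> complex" where
  "green \<alpha> \<omega> x y =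
     (if \<omega> = 0 then of_real (max x y - 1)
      else let r = ipow \<omega> (\<alpha> / 2) in
        (exp (r * of_real (x + y)) + exp (r * of_real \<bar>x - y\<bar>)
          - exp (r * of_real (2 - x - y)) - exp (r * of_real (2 - \<bar>x - y\<bar>)))
        / (2 * r * (1 + exp (2 * r))))"

text \<open>
  A mild solution of
  \<open>\<partial>\<^sub>x\<^sub>x U(x,\<omega>) - (\<i>\<omega>)\<^sup>\<alpha> U(x,\<omega>) = - h(\<omega>) dW\<^sub>x/dx\<close>, \<open>\<partial>\<^sub>x U(0,\<omega>) = 0\<close>, \<open>U(1,\<omega>) = 0\<close>:
  a jointly measurable random field obtained, for every \<open>(x, \<omega>)\<close>, by integrating a Green function
  of the problem against the right-hand side.  Joint measurability is what makes the expected
  \<open>L\<^sup>2\<close> norm of the field meaningful.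
\<close>

definition mild_solution ::
  "'a measure \<Rightarrow> (real \<Rightarrow> 'a \<Rightarrow> real) \<Rightarrow> real \<Rightarrow> (real \<Rightarrow> complex) \<Rightarrow>
     (real \<Rightarrow> real \<Rightarrow> 'a \<Rightarrow> complex) \<Rightarrow> bool" where
  "mild_solution M W \<alpha> h U \<longleftrightarrow>
     (\<lambda>(x, \<omega>, s). U x \<omega> s)
       \<in> borel_measurable (restrict_space borel {0<..<1} \<Otimes>\<^sub>M borel \<Otimes>\<^sub>M M) \<and>
     (\<forall>\<omega>. \<exists>g. is_green_function (ipow \<omega> \<alpha>) g \<and>
        (\<forall>x\<in>{0<..<1}. is_wiener_integral M W (\<lambda>y. g x y * (- h \<omega>)) (U x \<omega>)))"

definition L2_norm_sq :: "(real \<Rightarrow> real \<Rightarrow> complex) \<Rightarrow> ennreal" where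
  "L2_norm_sq V = (\<integral>\<^sup>+\<omega>. (\<integral>\<^sup>+x\<in>{0<..<1}. ennreal ((cmod (V x \<omega>))\<^sup>2) \<partial>lborel) \<partial>lborel)"

end

theory Submission
  imports Defs
begin

text \<open>
  By the energy identity for \<open>u'' = \<mu> u\<close> with \<open>Re \<mu> \<ge> 0\<close> the Green function is unique, so every mild
  solution is a Wiener integral of \<open>- h(\<omega>) g\<^sub>\<omega>(x, \<cdot>)\<close>; Wiener integrals are determined by the
  isometry on step functions, which needs only the variances of the increments.  A jointly
  measurable solution is the pointwise limit of dyadic Riemann sums: \<open>g\<^sub>\<omega>(x, \<cdot>)\<close> is Lipschitz, so the
  sums converge in \<open>L\<^sup>2\<close> at a geometric rate and hence almost surely.

  For the estimate, \<open>g\<^sub>\<omega> = - cosh (r min) sinh (r (1 - max)) / (r cosh r)\<close> with \<open>\<bar>Im r\<bar> \<le> Re r\<close> is bounded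
  uniformly in \<open>\<omega>\<close>, so the expected energy is at most a constant times \<open>\<integral> \<omega>\<^sup>2 \<bar>h\<bar>\<^sup>2\<close>.  By the lemma of
  du Bois-Reymond \<open>F\<close> is the primitive of its weak derivative vanishing at \<open>0\<close>; integrating the truncated
  transforms by parts, the boundary term at \<open>n\<close> tends to \<open>0\<close>, and the Plancherel inequality for \<open>F'\<close>
  with Fatou's lemma concludes.
\<close>

text \<open>Without the condition at 0, integration by parts would leave a boundary term of modulus
  \<open>cmod (value_at_0 F)\<close> for every \<omega>, and no bound on \<omega> times the
  transform in L2 could hold. At the other end \<open>F\<close> need not be integrable on the
  half-line, so the relation between the transforms of \<open>F\<close> and of its derivative is
  available only on [0, n].

  A mild solution is an unspecified version at each (x, \<omega>), and the Green function in its
  definition is unspecified too. So every claim about a solution passes through a uniqueness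
  statement, while existence needs versions chosen coherently in (x, \<omega>); an explicit
  \<open>lim\<close> of Riemann sums achieves this where a choice operator would not.

  The condition \<alpha> < 1 enters twice: (i\<omega>) to the power \<alpha> then has nonnegative
  real part, which drives the energy argument, and its square root r lies in the sector where cosh r
  has modulus at least cosh (Re r) / sqrt 2. Only upper bounds are sought, so constants are not
  optimised.\<close>

section \<open>Completeness of \<open>L\<^sup>2\<close>\<close>

abbreviation L2_sq :: "'a measure \<Rightarrow> ('a \<Rightarrow> complex) \<Rightarrow> ennreal" where
  "L2_sq N f \<equiv> \<integral>\<^sup>+x. ennreal ((cmod (f x))\<^sup>2) \<partial>N"

abbreviation L2_sq_01 :: "(real \<Rightarrow> complex) \<Rightarrow> ennreal" where
  "L2_sq_01 f \<equiv> \<integral>\<^sup>+y\<in>{0<..<1}. ennreal ((cmod (f y))\<^sup>2) \<partial>lborel"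

lemma cmod_add_sq_le: "(cmod (a + b))\<^sup>2 \<le> 2 * (cmod a)\<^sup>2 + 2 * (cmod b)\<^sup>2"
proof -
  have "(cmod (a + b))\<^sup>2 \<le> (cmod a + cmod b)\<^sup>2"
    by (simp add: norm_triangle_ineq)
  also have "\<dots> \<le> 2 * (cmod a)\<^sup>2 + 2 * (cmod b)\<^sup>2"
    using zero_le_power2[of "cmod a - cmod b"] unfolding power2_eq_square by (simp add: algebra_simps)
  finally show ?thesis .
qed

lemma cmod_add3_sq_le: "(cmod (a + b + c))\<^sup>2 \<le> 3 * ((cmod a)\<^sup>2 + (cmod b)\<^sup>2 + (cmod c)\<^sup>2)"
proof -
  have "(cmod (a + b + c))\<^sup>2 \<le> (cmod a + cmod b + cmod c)\<^sup>2"
    by (intro power_mono order_trans[OF norm_triangle_ineq] add_mono) auto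
  also have "\<dots> \<le> 3 * ((cmod a)\<^sup>2 + (cmod b)\<^sup>2 + (cmod c)\<^sup>2)"
    using zero_le_power2[of "cmod a - cmod b"] zero_le_power2[of "cmod b - cmod c"]
      zero_le_power2[of "cmod a - cmod c"] unfolding power2_eq_square by (simp add: algebra_simps)
  finally show ?thesis .
qed

lemma nn_integral_cmod_add3_le:
  fixes f g h :: "'a \<Rightarrow> complex"
  assumes [measurable]: "f \<in> borel_measurable N" "g \<in> borel_measurable N" "h \<in> borel_measurable N"
  shows "L2_sq N (\<lambda>x. f x + g x + h x) \<le>
    3 * (L2_sq N f + L2_sq N g +
         (L2_sq N h))"
proof -
  have "L2_sq N (\<lambda>x. f x + g x + h x) \<le>
     (\<integral>\<^sup>+x. ennreal 3 * (ennreal ((cmod (f x))\<^sup>2) + ennreal ((cmod (g x))\<^sup>2) + ennreal ((cmod (h x))\<^sup>2)) \<partial>N)"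
    by (intro nn_integral_mono)
       (use cmod_add3_sq_le in \<open>simp add: algebra_simps flip: ennreal_plus ennreal_mult del: ennreal_numeral\<close>)
  also have "\<dots> = 3 * (L2_sq N f + L2_sq N g +
         (L2_sq N h))"
    by (simp add: nn_integral_cmult nn_integral_add)
  finally show ?thesis .
qed

text \<open>The weight 2^m still leaves the summable bound 2^m * 4^(-m) = 2^(-m), so the weighted
  sum of squared increments is finite almost everywhere. The measure may be infinite, hence the
  pointwise comparison below in place of an L1 estimate.\<close>

lemma geometric_L2_Cauchy_AE:
  fixes f :: "nat \<Rightarrow> 'a \<Rightarrow> complex"
  assumes [measurable]: "\<And>m. f m \<in> borel_measurable N"
    and C: "\<And>m n. m \<le> n \<Longrightarrow> (L2_sq N (\<lambda>x. f n x - f m x)) \<le> ennreal (K * (1/4)^m)"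
    and K: "0 \<le> K"
  shows "AE x in N. (\<lambda>m. f m x) \<longlonglongrightarrow> lim (\<lambda>m. f m x)"
proof -
  have "(\<integral>\<^sup>+x. (\<Sum>m. ennreal (2^m * (cmod (f (Suc m) x - f m x))\<^sup>2)) \<partial>N)
      = (\<Sum>m. \<integral>\<^sup>+x. ennreal (2^m * (cmod (f (Suc m) x - f m x))\<^sup>2) \<partial>N)"
    by (rule nn_integral_suminf) measurable
  also have "\<dots> \<le> (\<Sum>m. ennreal (K * (1/2)^m))"
  proof (rule suminf_le)
    fix m
    have "(\<integral>\<^sup>+x. ennreal (2^m * (cmod (f (Suc m) x - f m x))\<^sup>2) \<partial>N)
        = ennreal (2^m) * L2_sq N (\<lambda>x. f (Suc m) x - f m x)"
      by (subst nn_integral_cmult[symmetric]) (auto simp: ennreal_mult)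
    also have "\<dots> \<le> ennreal (2^m) * ennreal (K * (1/4)^m)"
      by (intro mult_left_mono C) auto
    also have "\<dots> = ennreal (K * (1/2)^m)"
      using K by (simp add: ennreal_mult[symmetric] power_mult_distrib[symmetric] mult.left_commute)
    finally show "(\<integral>\<^sup>+x. ennreal (2^m * (cmod (f (Suc m) x - f m x))\<^sup>2) \<partial>N) \<le> ennreal (K * (1/2)^m)" .
  qed auto
  also have "\<dots> < \<infinity>"
    using K by (subst suminf_ennreal_eq[where x="K * 2"]) 
      (auto intro!: sums_mult geometric_sums[of "1/2::real", simplified])
  finally have "AE x in N. (\<Sum>m. ennreal (2^m * (cmod (f (Suc m) x - f m x))\<^sup>2)) \<noteq> \<infinity>"
    by (intro nn_integral_PInf_AE) auto
  then show ?thesis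
  proof eventually_elim
    case (elim x)
    let ?d = "\<lambda>m. f (Suc m) x - f m x"
    have s: "summable (\<lambda>m. 2^m * (cmod (?d m))\<^sup>2)"
      using elim by (intro summable_suminf_not_top) auto
    have "summable (\<lambda>m. (1/2)^m + 2^m * (cmod (?d m))\<^sup>2)"
      by (intro summable_add s) (simp add: summable_geometric_iff)
    \<comment> \<open>Either the increment is at most 2^(-m), or 2^m times its modulus is at least 1
      and multiplying by the modulus gives the quadratic term.\<close>
    moreover have "cmod (?d m) \<le> (1/2)^m + 2^m * (cmod (?d m))\<^sup>2" for m
    proof -
      have "1 \<le> 2^m * cmod (?d m)" if "\<not> cmod (?d m) \<le> (1/2)^m"
        using that by (simp add: power_one_over field_simps)
      then show ?thesis
        using mult_right_mono[of 1 "2^m * cmod (?d m)" "cmod (?d m)"]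
        by (cases "cmod (?d m) \<le> (1/2)^m") (simp_all add: power2_eq_square mult.assoc add_increasing add_increasing2)
    qed
    ultimately have "summable ?d"
      by (intro summable_comparison_test[of ?d]) (auto simp: )
    then have "convergent (\<lambda>n. \<Sum>m<n. ?d m)" by (simp add: summable_iff_convergent)
    then have "convergent (\<lambda>n. f n x - f 0 x)" by (simp only: sum_lessThan_telescope[of "\<lambda>n. f n x"])
    then have "convergent (\<lambda>n. (f n x - f 0 x) + f 0 x)" by (intro convergent_add convergent_const)
    then show ?case by (simp add: convergent_LIMSEQ_iff)
  qed
qed

text \<open>Fatou's lemma in n for fixed m. The limit is written as \<open>lim\<close>, an explicit
  function of the values \<open>f m x\<close>; this is what later gives measurability in
  parameters.\<close>

lemma geometric_L2_Cauchy_limit: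
  fixes f :: "nat \<Rightarrow> 'a \<Rightarrow> complex"
  assumes [measurable]: "\<And>m. f m \<in> borel_measurable N"
    and C: "\<And>m n. m \<le> n \<Longrightarrow> (L2_sq N (\<lambda>x. f n x - f m x)) \<le> ennreal (K * (1/4)^m)"
    and K: "0 \<le> K"
  shows "L2_sq N (\<lambda>x. f m x - lim (\<lambda>m. f m x)) \<le> ennreal (K * (1/4)^m)"
proof -
  have conv: "AE x in N. (\<lambda>m. f m x) \<longlonglongrightarrow> lim (\<lambda>m. f m x)"
    by (rule geometric_L2_Cauchy_AE[OF _ C K]) auto
  have "L2_sq N (\<lambda>x. f m x - lim (\<lambda>m. f m x))
      = (\<integral>\<^sup>+x. liminf (\<lambda>n. ennreal ((cmod (f n x - f m x))\<^sup>2)) \<partial>N)"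
  proof (rule nn_integral_cong_AE)
    show "AE x in N. ennreal ((cmod (f m x - lim (\<lambda>m. f m x)))\<^sup>2) = liminf (\<lambda>n. ennreal ((cmod (f n x - f m x))\<^sup>2))"
      using conv
    proof eventually_elim
      case (elim x)
      have "(\<lambda>n. ennreal ((cmod (f n x - f m x))\<^sup>2)) \<longlonglongrightarrow> ennreal ((cmod (lim (\<lambda>m. f m x) - f m x))\<^sup>2)"
        by (intro tendsto_intros elim)
      from lim_imp_Liminf[OF _ this] show ?case by (simp add: norm_minus_commute)
    qed
  qed
  also have "\<dots> \<le> liminf (\<lambda>n. L2_sq N (\<lambda>x. f n x - f m x))"
    by (rule nn_integral_liminf) auto
  also have "\<dots> \<le> ennreal (K * (1/4)^m)"
  proof (rule Liminf_le)
    show "\<forall>\<^sub>F n in sequentially. (L2_sq N (\<lambda>x. f n x - f m x)) \<le> ennreal (K * (1/4)^m)"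
      using eventually_ge_at_top[of m] by eventually_elim (rule C)
  qed auto
  finally show ?thesis .
qed

text \<open>Riesz-Fischer: a subsequence with geometric rate converges, and the Cauchy property
  carries the convergence over to the full sequence.\<close>

lemma L2_complete:
  fixes f :: "nat \<Rightarrow> 'a \<Rightarrow> complex"
  assumes [measurable]: "\<And>m. f m \<in> borel_measurable N"
    and C: "\<And>e. 0 < e \<Longrightarrow> \<exists>k. \<forall>m\<ge>k. \<forall>n\<ge>k. (L2_sq N (\<lambda>x. f n x - f m x)) \<le> ennreal e"
  shows "\<exists>h\<in>borel_measurable N. (\<lambda>n. L2_sq N (\<lambda>x. h x - f n x)) \<longlonglongrightarrow> 0"
proof -
  have "\<exists>k. \<forall>j. \<forall>m\<ge>k j. \<forall>n\<ge>k j. (L2_sq N (\<lambda>x. f n x - f m x)) \<le> ennreal ((1/4)^j)"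
    using C by (intro choice) auto
  then obtain k where k: "\<And>j m n. m \<ge> k j \<Longrightarrow> n \<ge> k j \<Longrightarrow>
      (L2_sq N (\<lambda>x. f n x - f m x)) \<le> ennreal ((1/4)^j)" by blast
  define r where "r j = (\<Sum>i\<le>j. k i)" for j
  have r_mono: "r i \<le> r j" if "i \<le> j" for i j unfolding r_def by (rule sum_mono2) (use that in auto)
  have rk: "k j \<le> r j" for j unfolding r_def by (rule member_le_sum) auto
  define h where "h x = lim (\<lambda>j. f (r j) x)" for x
  have hm[measurable]: "h \<in> borel_measurable N" unfolding h_def[abs_def] by measurable
  have B: "L2_sq N (\<lambda>x. f (r j) x - h x) \<le> ennreal (1 * (1/4)^j)" for j
    unfolding h_def
  proof (rule geometric_L2_Cauchy_limit)
    fix m n :: nat assume "m \<le> n"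
    then show "L2_sq N (\<lambda>x. f (r n) x - f (r m) x) \<le> ennreal (1 * (1/4)^m)"
      using k[of m "r m" "r n"] rk[of m] r_mono[of m n] by simp
  qed auto
  \<comment> \<open>The factor 6 is 3 * (1 + 1): the three-term inequality with third term
    0.\<close>
  have bd: "L2_sq N (\<lambda>x. h x - f n x) \<le> ennreal (6 * (1/4)^j)" if n: "n \<ge> r j" for n j
  proof -
    have "L2_sq N (\<lambda>x. h x - f n x) =
        (L2_sq N (\<lambda>x. (h x - f (r j) x) + (f (r j) x - f n x) + 0))" by simp
    also have "\<dots> \<le> 3 * (L2_sq N (\<lambda>x. h x - f (r j) x) + L2_sq N (\<lambda>x. f (r j) x - f n x)
        + (\<integral>\<^sup>+x. ennreal ((cmod 0)\<^sup>2) \<partial>N))"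
      by (rule nn_integral_cmod_add3_le) auto
    also have "\<dots> \<le> ennreal 3 * (ennreal ((1/4)^j) + ennreal ((1/4)^j))"
      using B[of j] k[of j n "r j"] rk[of j] n by (auto intro!: mult_left_mono add_mono simp: norm_minus_commute)
    also have "\<dots> = ennreal (6 * (1/4)^j)"
      by (simp del: ennreal_numeral flip: ennreal_plus ennreal_mult)
    finally show ?thesis .
  qed
  have "(\<lambda>n. L2_sq N (\<lambda>x. h x - f n x)) \<longlonglongrightarrow> 0"
  proof (rule order_tendstoI)
    fix a :: ennreal assume a: "0 < a"
    have "(\<lambda>j. ennreal (6 * (1/4)^j)) \<longlonglongrightarrow> ennreal (6 * 0)"
      by (intro tendsto_intros LIMSEQ_power_zero) auto
    then have "\<forall>\<^sub>F j in sequentially. ennreal (6 * (1/4)^j) < a"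
      using a by (intro order_tendstoD(2)) auto
    then obtain j where j: "ennreal (6 * (1/4)^j) < a" by (auto simp: eventually_sequentially)
    show "\<forall>\<^sub>F n in sequentially. (L2_sq N (\<lambda>x. h x - f n x)) < a"
      using eventually_ge_at_top[of "r j"] by eventually_elim (use bd j in \<open>auto intro: le_less_trans\<close>)
  qed auto
  then show ?thesis using hm by blast
qed

lemma L2_convergent_AE_subseq:
  fixes f :: "nat \<Rightarrow> 'a \<Rightarrow> complex"
  assumes [measurable]: "\<And>m. f m \<in> borel_measurable N" "h \<in> borel_measurable N"
    and lim: "(\<lambda>n. L2_sq N (\<lambda>x. h x - f n x)) \<longlonglongrightarrow> 0"
  shows "\<exists>r::nat \<Rightarrow> nat. strict_mono r \<and> (AE x in N. (\<lambda>n. f (r n) x) \<longlonglongrightarrow> h x)"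
proof -
  \<comment> \<open>The first distances may be infinite. Shifting the index past them makes the
    squared differences integrable, as convergence in L1 requires.\<close>
  have "\<forall>\<^sub>F n in sequentially. (L2_sq N (\<lambda>x. h x - f n x)) < 1"
    by (rule order_tendstoD(2)[OF lim]) auto
  then obtain k where "\<forall>n\<ge>k. (L2_sq N (\<lambda>x. h x - f n x)) < 1"
    unfolding eventually_sequentially by blast
  then have k: "L2_sq N (\<lambda>x. h x - f (n + k) x) < 1" for n
    by simp
  have int: "integrable N (\<lambda>x. (cmod (h x - f (n + k) x))\<^sup>2)" for n
    using k[of n] by (intro integrableI_bounded) (auto intro: less_trans)
  have "(\<lambda>n. ennreal (\<integral>x. norm ((cmod (h x - f (n + k) x))\<^sup>2) \<partial>N)) \<longlonglongrightarrow> ennreal 0"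
    using LIMSEQ_ignore_initial_segment[OF lim, of k] int
    by (simp add: nn_integral_eq_integral)
  then have "(\<lambda>n. \<integral>x. norm ((cmod (h x - f (n + k) x))\<^sup>2) \<partial>N) \<longlonglongrightarrow> 0"
    by (subst (asm) tendsto_ennreal_iff) auto
  from tendsto_L1_AE_subseq[OF int this] obtain r :: "nat \<Rightarrow> nat" where r: "strict_mono r"
    and *: "AE x in N. (\<lambda>n. (cmod (h x - f (r n + k) x))\<^sup>2) \<longlonglongrightarrow> 0" by blast
  have "AE x in N. (\<lambda>n. f (r n + k) x) \<longlonglongrightarrow> h x"
    using *
  proof eventually_elim
    case (elim x)
    then have "(\<lambda>n. sqrt ((cmod (h x - f (r n + k) x))\<^sup>2)) \<longlonglongrightarrow> sqrt 0" by (intro tendsto_intros)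
    then have "(\<lambda>n. h x - f (r n + k) x) \<longlonglongrightarrow> 0" by (simp add: tendsto_norm_zero_iff)
    from tendsto_diff[OF tendsto_const[of "h x"] this] show ?case by simp
  qed
  moreover have "strict_mono (\<lambda>n. r n + k)" using r by (simp add: strict_mono_def)
  ultimately show ?thesis by blast
qed

section \<open>The Wiener integral\<close>

lemma brownian_prob_space: "brownian_motion_01 M W \<Longrightarrow> prob_space M"
  and brownian_measurable: "brownian_motion_01 M W \<Longrightarrow> 0 \<le> t \<Longrightarrow> t \<le> 1 \<Longrightarrow> W t \<in> borel_measurable M"
  by (auto simp: brownian_motion_01_def)

text \<open>Polarization uses increments between endpoints in arbitrary order, hence the absolute
  value; equal times are a separate case because the Gaussian density is only given for a <
  b.\<close>

lemma brownian_increment_sq: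
  assumes bm: "brownian_motion_01 M W" and st: "s \<in> {0..1}" "t \<in> {0..1}"
  shows "has_bochner_integral M (\<lambda>z. (W t z - W s z)\<^sup>2) \<bar>t - s\<bar>"
proof -
  interpret prob_space M by (rule brownian_prob_space[OF bm])
  have *: "has_bochner_integral M (\<lambda>z. (W b z - W a z)\<^sup>2) (b - a)"
    if ab: "0 \<le> a" "a < b" "b \<le> 1" for a b
  proof -
    let ?N = "normal_density 0 (sqrt (b - a))"
    have D: "distributed M lborel (\<lambda>s. W b s - W a s) ?N"
      using bm ab by (auto simp: brownian_motion_01_def)
    have "has_bochner_integral lborel (\<lambda>x. ?N x * x\<^sup>2) (b - a)"
      using normal_moment_even[of "sqrt (b - a)" 0 1] ab by (simp add: eval_nat_numeral diff_divide_distrib)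
    then have i: "integrable lborel (\<lambda>x. ?N x * x\<^sup>2)" and e: "(\<integral>x. ?N x * x\<^sup>2 \<partial>lborel) = b - a"
      by (auto simp: has_bochner_integral_iff)
    show ?thesis
      unfolding has_bochner_integral_iff
      using distributed_integrable[OF D, of "\<lambda>x. x\<^sup>2"] distributed_integral[OF D, of "\<lambda>x. x\<^sup>2"] i e
      by auto
  qed
  consider "s < t" | "s = t" | "t < s" by linarith
  then show ?thesis
  proof cases
    case 1 then show ?thesis using *[of s t] st by simp
  next
    case 2 then show ?thesis by (simp add: has_bochner_integral_zero)
  next
    case 3 then show ?thesis using *[of t s] st by (simp add: power2_commute)
  qed
qed

text \<open>Polarization: the covariance of increments is determined by their variances.\<close>

lemma brownian_increment_prod:
  assumes bm: "brownian_motion_01 M W"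
    and ab: "0 \<le> a" "a \<le> b" "b \<le> 1" and cd: "0 \<le> c" "c \<le> d" "d \<le> 1"
  shows "has_bochner_integral M (\<lambda>z. (W b z - W a z) * (W d z - W c z))
    (\<integral>y. indicator {a<..b} y * indicator {c<..d} y \<partial>lborel)"
proof -
  have e: "(\<integral>y. indicator {a<..b} y * indicator {c<..d} y \<partial>lborel)
      = (\<bar>b - c\<bar> + \<bar>a - d\<bar> - \<bar>b - d\<bar> - \<bar>a - c\<bar>) / 2"
  proof -
    have "(\<integral>y. indicator {a<..b} y * indicator {c<..d} y \<partial>lborel)
        = (\<integral>y. indicator {max a c<..min b d} y \<partial>lborel :: real)"
      by (intro Bochner_Integration.integral_cong) (auto simp: indicator_def)
    also have "\<dots> = (if max a c \<le> min b d then min b d - max a c else 0)"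
      by (cases "max a c \<le> min b d") (simp_all del: max.bounded_iff min.bounded_iff)
    also have "\<dots> = (\<bar>b - c\<bar> + \<bar>a - d\<bar> - \<bar>b - d\<bar> - \<bar>a - c\<bar>) / 2"
      using ab cd by (auto simp: min_def max_def abs_if)
    finally show ?thesis .
  qed
  have "has_bochner_integral M (\<lambda>z. ((W b z - W c z)\<^sup>2 + (W a z - W d z)\<^sup>2 - (W b z - W d z)\<^sup>2 - (W a z - W c z)\<^sup>2) / 2)
      ((\<bar>b - c\<bar> + \<bar>a - d\<bar> - \<bar>b - d\<bar> - \<bar>a - c\<bar>) / 2)"
    by (intro has_bochner_integral_divide has_bochner_integral_add has_bochner_integral_diff
        brownian_increment_sq[OF bm]) (use ab cd in auto)
  also have "(\<lambda>z. ((W b z - W c z)\<^sup>2 + (W a z - W d z)\<^sup>2 - (W b z - W d z)\<^sup>2 - (W a z - W c z)\<^sup>2) / 2)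
      = (\<lambda>z. (W b z - W a z) * (W d z - W c z))"
    by (auto simp: power2_eq_square field_simps)
  finally show ?thesis unfolding e .
qed

lemma cmod_sum_of_real_sq:
  "(cmod (\<Sum>i<n. c i * of_real (x i)))\<^sup>2 = (\<Sum>i<n. \<Sum>j<n. Re (c i * cnj (c j)) * (x i * x j))"
proof -
  have "complex_of_real ((cmod (\<Sum>i<n. c i * of_real (x i)))\<^sup>2)
     = (\<Sum>i<n. \<Sum>j<n. (c i * of_real (x i)) * (cnj (c j) * of_real (x j)))"
    unfolding complex_norm_square by (simp add: sum_product)
  then have "(cmod (\<Sum>i<n. c i * of_real (x i)))\<^sup>2
     = Re (\<Sum>i<n. \<Sum>j<n. (c i * of_real (x i)) * (cnj (c j) * of_real (x j)))"
    by (metis Re_complex_of_real)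
  also have "\<dots> = (\<Sum>i<n. \<Sum>j<n. Re (c i * cnj (c j)) * (x i * x j))"
    by (simp add: algebra_simps)
  finally show ?thesis .
qed

text \<open>The squared L2 norm of a linear combination depends only on the Gram matrix, so families
  on two different measure spaces can be compared through \<open>A\<close>.\<close>

lemma nn_integral_cmod_sum_eq:
  fixes X :: "nat \<Rightarrow> 'a \<Rightarrow> real" and Y :: "nat \<Rightarrow> 'b \<Rightarrow> real"
  assumes X: "\<And>i j. i < n \<Longrightarrow> j < n \<Longrightarrow> has_bochner_integral M (\<lambda>s. X i s * X j s) (A i j)"
    and Y: "\<And>i j. i < n \<Longrightarrow> j < n \<Longrightarrow> has_bochner_integral N (\<lambda>s. Y i s * Y j s) (A i j)"
  shows "L2_sq M (\<lambda>s. \<Sum>i<n. c i * of_real (X i s))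
    = L2_sq N (\<lambda>s. \<Sum>i<n. c i * of_real (Y i s))"
proof -
  let ?A = "\<Sum>i<n. \<Sum>j<n. Re (c i * cnj (c j)) * A i j"
  have "has_bochner_integral M (\<lambda>s. (cmod (\<Sum>i<n. c i * of_real (X i s)))\<^sup>2) ?A"
    unfolding cmod_sum_of_real_sq
    by (intro has_bochner_integral_sum has_bochner_integral_mult_right X) auto
  moreover have "has_bochner_integral N (\<lambda>s. (cmod (\<Sum>i<n. c i * of_real (Y i s)))\<^sup>2) ?A"
    unfolding cmod_sum_of_real_sq
    by (intro has_bochner_integral_sum has_bochner_integral_mult_right Y) auto
  ultimately show ?thesis
    by (simp add: has_bochner_integral_iff nn_integral_eq_integral)
qed

abbreviation step_left :: "step \<Rightarrow> nat \<Rightarrow> real" where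
  "step_left p i \<equiv> fst (snd (p ! i))"

abbreviation step_right :: "step \<Rightarrow> nat \<Rightarrow> real" where
  "step_right p i \<equiv> snd (snd (p ! i))"

lemma step_fun_nth: "step_fun p y = (\<Sum>i<length p. fst (p ! i) * of_real (indicator {step_left p i<..step_right p i} y))"
  unfolding step_fun_def sum_list_sum_nth
  by (intro sum.cong) (auto simp: case_prod_unfold indicator_def)

lemma step_integral_nth: "step_integral W p s =
    (\<Sum>i<length p. fst (p ! i) * of_real (W (step_right p i) s - W (step_left p i) s))"
  unfolding step_integral_def sum_list_sum_nth
  by (intro sum.cong) (auto simp: case_prod_unfold)

lemma valid_step_nth: "valid_step p \<Longrightarrow> i < length p \<Longrightarrow>
    0 \<le> step_left p i \<and> step_left p i \<le> step_right p i \<and> step_right p i \<le> 1"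
  unfolding valid_step_def by (metis (mono_tags, lifting) case_prod_unfold nth_mem)

lemma step_fun_measurable [measurable]: "step_fun p \<in> borel_measurable borel"
  unfolding step_fun_nth[abs_def] by measurable

lemma step_integral_measurable:
  assumes "brownian_motion_01 M W" "valid_step p"
  shows "step_integral W p \<in> borel_measurable M"
proof -
  have "(\<lambda>s. W (step_right p i) s - W (step_left p i) s) \<in> borel_measurable M" if "i < length p" for i
    using valid_step_nth[OF assms(2) that] by (intro borel_measurable_diff brownian_measurable[OF assms(1)]) auto
  then show ?thesis unfolding step_integral_nth[abs_def]
    by (intro borel_measurable_sum borel_measurable_times borel_measurable_of_real) (auto simp del: of_real_diff)
qed

text \<open>The intervals of a step may overlap. Comparing the Gram matrix of the increments with
  that of the indicators avoids a common refinement.\<close>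

lemma step_isometry:
  assumes bm: "brownian_motion_01 M W" and p: "valid_step p"
  shows "L2_sq M (step_integral W p)
    = L2_sq_01 (step_fun p)"
proof -
  define A where "A i j = (\<integral>y. indicator {step_left p i<..step_right p i} y *
      indicator {step_left p j<..step_right p j} y \<partial>lborel :: real)" for i j
  have "L2_sq M (step_integral W p)
      = L2_sq lborel (step_fun p)"
    unfolding step_fun_nth step_integral_nth
  proof (rule nn_integral_cmod_sum_eq[where A=A])
    fix i j assume ij: "i < length p" "j < length p"
    note v = valid_step_nth[OF p ij(1)] valid_step_nth[OF p ij(2)]
    show "has_bochner_integral M (\<lambda>s. (W (step_right p i) s - W (step_left p i) s) *
          (W (step_right p j) s - W (step_left p j) s)) (A i j)"
      unfolding A_def using v by (intro brownian_increment_prod[OF bm]) auto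
    have "integrable lborel (\<lambda>y. indicator {step_left p i<..step_right p i} y *
      (indicator {step_left p j<..step_right p j} y :: real))"
      by (rule integrable_real_mult_indicator) (use v in auto)
    then show "has_bochner_integral lborel (\<lambda>y. indicator {step_left p i<..step_right p i} y *
      (indicator {step_left p j<..step_right p j} y :: real)) (A i j)"
      unfolding A_def by (simp add: has_bochner_integral_iff)
  qed
  also have "\<dots> = L2_sq_01 (step_fun p)"
  \<comment> \<open>An interval (a, 1] contains the point 1, which the domain (0, 1) omits; it is a
    null set.\<close>
  proof (rule nn_integral_cong_AE)
    show "AE y in lborel. ennreal ((cmod (step_fun p y))\<^sup>2) = ennreal ((cmod (step_fun p y))\<^sup>2) * indicator {0<..<1} y"
      using AE_lborel_singleton[of "1::real"]
    proof eventually_elim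
      case (elim y)
      show ?case
      proof (cases "y \<in> {0<..<1}")
        case False
        have "step_fun p y = 0"
          unfolding step_fun_nth
        proof (intro sum.neutral ballI)
          fix i assume "i \<in> {..<length p}"
          then show "fst (p ! i) * complex_of_real (indicator {step_left p i<..step_right p i} y) = 0"
            using valid_step_nth[OF p, of i] False elim by (auto simp: indicator_def)
        qed
        then show ?thesis by simp
      qed auto
    qed
  qed
  finally show ?thesis .
qed

definition step_scale :: "complex \<Rightarrow> step \<Rightarrow> step" where
  "step_scale k p = map (\<lambda>(c, a, b). (c * k, a, b)) p"

lemma step_scale:
  shows "valid_step p \<Longrightarrow> valid_step (step_scale k p)"
    and "step_fun (step_scale k p) y = step_fun p y * k"
    and "step_integral W (step_scale k p) s = k * step_integral W p s"
proof -
  show "valid_step p \<Longrightarrow> valid_step (step_scale k p)"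
    by (auto simp: valid_step_def step_scale_def)
  show "step_fun (step_scale k p) y = step_fun p y * k"
    unfolding step_fun_def step_scale_def by (induction p) (auto simp: algebra_simps)
  show "step_integral W (step_scale k p) s = k * step_integral W p s"
    unfolding step_integral_def step_scale_def by (induction p) (auto simp: algebra_simps)
qed

text \<open>Since overlapping intervals are allowed, subtraction is mere concatenation after a sign
  change.\<close>

definition step_diff :: "step \<Rightarrow> step \<Rightarrow> step" where
  "step_diff p q = p @ step_scale (- 1) q"

lemma step_diff:
  shows "valid_step p \<Longrightarrow> valid_step q \<Longrightarrow> valid_step (step_diff p q)"
    and "step_fun (step_diff p q) y = step_fun p y - step_fun q y"
    and "step_integral W (step_diff p q) s = step_integral W p s - step_integral W q s"
proof -
  show "valid_step p \<Longrightarrow> valid_step q \<Longrightarrow> valid_step (step_diff p q)"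
    using step_scale(1)[of q "- 1"] by (auto simp: valid_step_def step_diff_def)
  have "step_fun (p @ r) y = step_fun p y + step_fun r y" for r by (simp add: step_fun_def)
  then show "step_fun (step_diff p q) y = step_fun p y - step_fun q y"
    by (simp add: step_diff_def step_scale)
  have "step_integral W (p @ r) s = step_integral W p s + step_integral W r s" for r by (simp add: step_integral_def)
  then show "step_integral W (step_diff p q) s = step_integral W p s - step_integral W q s"
    by (simp add: step_diff_def step_scale)
qed

section \<open>Stability, scaling and uniqueness of the Wiener integral\<close>

lemma set_nn_integral_restrict:
  assumes [measurable]: "A \<in> sets N"
  shows "(\<integral>\<^sup>+y\<in>A. f y \<partial>N) = (\<integral>\<^sup>+y. f y \<partial>restrict_space N A)"
  by (simp add: nn_integral_restrict_space)

lemma set_borel_measurable_restrict: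
  fixes f :: "real \<Rightarrow> complex"
  assumes "A \<in> sets borel"
  shows "set_borel_measurable lborel A f \<longleftrightarrow> f \<in> borel_measurable (restrict_space lborel A)"
  using assms unfolding set_borel_measurable_def by (simp add: borel_measurable_restrict_space_iff)

text \<open>Insert approximating steps for both integrals, apply the isometry to their difference,
  then insert the integrands. Each of the two three-term inequalities costs a factor 3, whence 9.
  With equal integrands this is uniqueness; with g = 0 it is the second-moment bound.\<close>

lemma is_wiener_integral_L2_dist:
  assumes bm: "brownian_motion_01 M W"
    and X: "is_wiener_integral M W f X" and Y: "is_wiener_integral M W g Y"
  shows "L2_sq M (\<lambda>s. X s - Y s)
    \<le> 9 * L2_sq_01 (\<lambda>y. f y - g y)"
proof -
  let ?L = "restrict_space lborel {0<..<1::real}"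
  obtain P where P: "\<And>n. valid_step (P n)"
      "(\<lambda>n. L2_sq ?L (\<lambda>y. step_fun (P n) y - f y)) \<longlonglongrightarrow> 0"
      "(\<lambda>n. L2_sq M (\<lambda>s. step_integral W (P n) s - X s)) \<longlonglongrightarrow> 0"
    using X unfolding is_wiener_integral_def by (auto simp: set_nn_integral_restrict)
  obtain Q where Q: "\<And>n. valid_step (Q n)"
      "(\<lambda>n. L2_sq ?L (\<lambda>y. step_fun (Q n) y - g y)) \<longlonglongrightarrow> 0"
      "(\<lambda>n. L2_sq M (\<lambda>s. step_integral W (Q n) s - Y s)) \<longlonglongrightarrow> 0"
    using Y unfolding is_wiener_integral_def by (auto simp: set_nn_integral_restrict)
  have [measurable]: "f \<in> borel_measurable ?L" "g \<in> borel_measurable ?L"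
    "X \<in> borel_measurable M" "Y \<in> borel_measurable M"
    using X Y unfolding is_wiener_integral_def by (auto simp: set_borel_measurable_restrict)
  note [measurable] = step_integral_measurable[OF bm P(1)] step_integral_measurable[OF bm Q(1)]
  have [measurable]: "step_fun p \<in> borel_measurable ?L" for p
    by (intro measurable_restrict_space1) simp
  define a where "a n = L2_sq ?L (\<lambda>y. step_fun (P n) y - f y)" for n
  define a' where "a' n = L2_sq ?L (\<lambda>y. step_fun (Q n) y - g y)" for n
  define b where "b n = L2_sq M (\<lambda>s. step_integral W (P n) s - X s)" for n
  define b' where "b' n = L2_sq M (\<lambda>s. step_integral W (Q n) s - Y s)" for n
  define D where "D = L2_sq ?L (\<lambda>y. f y - g y)"
  have "L2_sq M (\<lambda>s. X s - Y s) \<le> 3 * (b n + 3 * (a n + D + a' n) + b' n)" for n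
  proof -
    let ?d = "step_diff (P n) (Q n)"
    have "L2_sq M (\<lambda>s. X s - Y s) =
      (L2_sq M (\<lambda>s. (X s - step_integral W (P n) s) + (step_integral W (P n) s - step_integral W (Q n) s)
         + (step_integral W (Q n) s - Y s)))" by simp
    also have "\<dots> \<le> 3 * (b n + L2_sq M (\<lambda>s. step_integral W (P n) s - step_integral W (Q n) s) + b' n)"
      unfolding b_def b'_def norm_minus_commute[of "step_integral W (P n) _" "X _"]
      by (rule nn_integral_cmod_add3_le) auto
    \<comment> \<open>The passage from the probability space to (0, 1).\<close>
    also have "L2_sq M (\<lambda>s. step_integral W (P n) s - step_integral W (Q n) s) =
       (L2_sq ?L (\<lambda>y. step_fun (P n) y - step_fun (Q n) y))"
      using step_isometry[OF bm step_diff(1)[OF P(1) Q(1)], of n n]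
      unfolding step_diff(2,3) by (simp add: set_nn_integral_restrict)
    also have "\<dots> = L2_sq ?L (\<lambda>y. (step_fun (P n) y - f y) + (f y - g y) + (g y - step_fun (Q n) y))"
      by simp
    also have "\<dots> \<le> 3 * (a n + D + a' n)"
      unfolding a_def a'_def D_def norm_minus_commute[of "step_fun (Q n) _" "g _"]
      by (rule nn_integral_cmod_add3_le) auto
    finally show ?thesis by (simp add: mult_left_mono add_mono)
  qed
  moreover have "(\<lambda>n. 3 * (b n + 3 * (a n + D + a' n) + b' n)) \<longlonglongrightarrow> 3 * (0 + 3 * (0 + D + 0) + 0)"
    using P(2,3) Q(2,3) unfolding a_def[symmetric] a'_def[symmetric] b_def[symmetric] b'_def[symmetric]
    by (intro tendsto_intros ennreal_tendsto_cmult tendsto_add) auto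
  ultimately have "L2_sq M (\<lambda>s. X s - Y s) \<le> 3 * (0 + 3 * (0 + D + 0) + 0)"
    by (intro LIMSEQ_le_const) auto
  also have "\<dots> = 9 * D" by (simp add: mult.assoc[symmetric])
  finally show ?thesis by (simp add: D_def set_nn_integral_restrict)
qed

lemma is_wiener_integral_zero: 
  assumes "prob_space M" shows "is_wiener_integral M W (\<lambda>_. 0) (\<lambda>_. 0)"
  unfolding is_wiener_integral_def
  by (auto intro!: exI[of _ "\<lambda>_. []"] simp: valid_step_def step_fun_def step_integral_def set_borel_measurable_def)

lemma is_wiener_integral_scale:
  assumes bm: "brownian_motion_01 M W" and X: "is_wiener_integral M W f X"
  shows "is_wiener_integral M W (\<lambda>y. f y * k) (\<lambda>s. k * X s)"
proof -
  have [measurable]: "X \<in> borel_measurable M" and f: "set_borel_measurable lborel {0<..<1} f"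
    using X unfolding is_wiener_integral_def by auto
  let ?L = "restrict_space lborel {0<..<1::real}"
  have [measurable]: "f \<in> borel_measurable ?L" using f by (simp add: set_borel_measurable_restrict)
  obtain P where P: "\<And>n. valid_step (P n)"
      "(\<lambda>n. L2_sq_01 (\<lambda>y. step_fun (P n) y - f y)) \<longlonglongrightarrow> 0"
      "(\<lambda>n. L2_sq M (\<lambda>s. step_integral W (P n) s - X s)) \<longlonglongrightarrow> 0"
    using X unfolding is_wiener_integral_def by auto
  have sc: "L2_sq N (\<lambda>y. k * g y) = ennreal ((cmod k)\<^sup>2) * L2_sq N g"
    if [measurable]: "g \<in> borel_measurable N" for N :: "'c measure" and g
    by (subst nn_integral_cmult[symmetric]) (auto simp: norm_mult power_mult_distrib ennreal_mult)
  have [measurable]: "step_fun p \<in> borel_measurable ?L" for p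
    by (intro measurable_restrict_space1) simp
  have sc1: "step_fun (step_scale k p) y - f y * k = k * (step_fun p y - f y)" for p y
    by (simp add: step_scale algebra_simps)
  have "L2_sq_01 (\<lambda>y. step_fun (step_scale k (P n)) y - f y * k)
      = ennreal ((cmod k)\<^sup>2) * L2_sq_01 (\<lambda>y. step_fun (P n) y - f y)" for n
    using sc[of "\<lambda>y. step_fun (P n) y - f y" ?L]
    by (simp only: set_nn_integral_restrict[of "{0<..<1}" lborel] sc1 greaterThanLessThan_borel sets_lborel) auto
  moreover have "L2_sq M (\<lambda>s. step_integral W (step_scale k (P n)) s - k * X s)
      = ennreal ((cmod k)\<^sup>2) * L2_sq M (\<lambda>s. step_integral W (P n) s - X s)" for n
    using sc[of "\<lambda>s. step_integral W (P n) s - X s" M] step_integral_measurable[OF bm P(1)]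
    by (simp add: step_scale algebra_simps)
  moreover have "(\<lambda>n. ennreal ((cmod k)\<^sup>2) * L2_sq_01 (\<lambda>y. step_fun (P n) y - f y)) \<longlonglongrightarrow> ennreal ((cmod k)\<^sup>2) * 0"
    by (intro ennreal_tendsto_cmult P) auto
  moreover have "(\<lambda>n. ennreal ((cmod k)\<^sup>2) * L2_sq M (\<lambda>s. step_integral W (P n) s - X s)) \<longlonglongrightarrow> ennreal ((cmod k)\<^sup>2) * 0"
    by (intro ennreal_tendsto_cmult P) auto
  moreover have "set_borel_measurable lborel {0<..<1} (\<lambda>y. f y * k)"
    by (simp add: set_borel_measurable_restrict)
  ultimately show ?thesis
    unfolding is_wiener_integral_def
    by (intro conjI exI[of _ "\<lambda>n. step_scale k (P n)"]) (auto simp: step_scale(1) P(1))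
qed

lemma is_wiener_integral_unique:
  assumes bm: "brownian_motion_01 M W"
    and X: "is_wiener_integral M W f X" and Y: "is_wiener_integral M W g Y"
    and fg: "\<And>y. y \<in> {0<..<1} \<Longrightarrow> f y = g y"
  shows "AE s in M. X s = Y s"
proof -
  have [measurable]: "X \<in> borel_measurable M" "Y \<in> borel_measurable M"
    using X Y unfolding is_wiener_integral_def by auto
  have "L2_sq_01 (\<lambda>y. f y - g y) = (\<integral>\<^sup>+y. 0 \<partial>(lborel :: real measure))"
    by (intro nn_integral_cong) (auto simp: indicator_def fg)
  then have "L2_sq M (\<lambda>s. X s - Y s) = 0"
    using is_wiener_integral_L2_dist[OF bm X Y] by simp
  then show ?thesis by (subst (asm) nn_integral_0_iff_AE) auto
qed

lemma is_wiener_integral_bound: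
  assumes bm: "brownian_motion_01 M W" and X: "is_wiener_integral M W f X"
  shows "L2_sq M X \<le> 9 * L2_sq_01 f"
  using is_wiener_integral_L2_dist[OF bm X is_wiener_integral_zero[OF brownian_prob_space[OF bm]]] by simp

text \<open>Values are taken at left endpoints, including 0; this is why Lipschitz continuity is
  later asked on the closed interval.\<close>

definition dyadic_step :: "nat \<Rightarrow> (real \<Rightarrow> complex) \<Rightarrow> step" where
  "dyadic_step m f = map (\<lambda>k. (f (real k / 2 ^ m), real k / 2 ^ m, real (Suc k) / 2 ^ m)) [0..<2 ^ m]"

lemma valid_dyadic_step: "valid_step (dyadic_step m f)"
proof -
  have "real (Suc k) / 2 ^ m \<le> 1" if "k < 2 ^ m" for k
  proof -
    have "real (Suc k) \<le> real (2 ^ m)" using that by (intro of_nat_mono) simp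
    then show ?thesis by simp
  qed
  then show ?thesis unfolding valid_step_def dyadic_step_def by (auto simp: divide_right_mono)
qed

lemma step_integral_dyadic: "step_integral W (dyadic_step m f) s =
    (\<Sum>k<2 ^ m. f (real k / 2 ^ m) * of_real (W (real (Suc k) / 2 ^ m) s - W (real k / 2 ^ m) s))"
  unfolding step_integral_def dyadic_step_def
  by (simp add: interv_sum_list_conv_sum_set_nat o_def atLeast0LessThan)

lemma step_fun_dyadic_approx:
  assumes L: "L-lipschitz_on {0..1} f" and y: "y \<in> {0<..<1}"
  shows "cmod (step_fun (dyadic_step m f) y - f y) \<le> L / 2 ^ m"
proof -
  \<comment> \<open>The cells are open on the left and closed on the right, so y lies in the cell
    with index ceiling (y * 2^m) - 1.\<close>
  define j where "j = nat (\<lceil>y * 2 ^ m\<rceil> - 1)"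
  have pos: "0 < \<lceil>y * 2 ^ m\<rceil>" using y by simp
  have j: "real j < y * 2 ^ m" "y * 2 ^ m \<le> real (Suc j)"
    unfolding j_def using pos by (simp_all add: of_nat_diff) linarith+
  have "y * 2 ^ m < 1 * 2 ^ m" using y by (intro mult_strict_right_mono) auto
  from order_less_trans[OF j(1) this] have "real j < real (2 ^ m)" by simp
  then have jm: "j < 2 ^ m" by (simp only: of_nat_less_iff)
  have ind: "indicator {real k / 2 ^ m<..real (Suc k) / 2 ^ m} y = (if k = j then 1 else (0::complex))" for k
  proof -
    have "y \<in> {real k / 2 ^ m<..real (Suc k) / 2 ^ m} \<longleftrightarrow> real k < y * 2 ^ m \<and> y * 2 ^ m \<le> real (Suc k)"
      by (simp add: field_simps)
    also have "\<dots> \<longleftrightarrow> k = j"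
    proof
      assume "real k < y * 2 ^ m \<and> y * 2 ^ m \<le> real (Suc k)"
      then have "real k < real (Suc j)" "real j < real (Suc k)" using j by linarith+
      then show "k = j" by linarith
    qed (use j in auto)
    finally show ?thesis by (simp add: indicator_def)
  qed
  have "step_fun (dyadic_step m f) y = (\<Sum>k<2 ^ m. f (real k / 2 ^ m) * indicator {real k / 2 ^ m<..real (Suc k) / 2 ^ m} y)"
    unfolding step_fun_def dyadic_step_def
    by (simp add: interv_sum_list_conv_sum_set_nat o_def atLeast0LessThan)
  also have "\<dots> = (\<Sum>k<2 ^ m. if k = j then f (real j / 2 ^ m) else 0)"
    unfolding ind by (rule sum.cong) auto
  also have "\<dots> = f (real j / 2 ^ m)" using jm by simp
  finally have e: "step_fun (dyadic_step m f) y = f (real j / 2 ^ m)" .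
  have "cmod (step_fun (dyadic_step m f) y - f y) \<le> L * \<bar>real j / 2 ^ m - y\<bar>"
    using lipschitz_onD[OF L, of "real j / 2 ^ m" y] y jm j(1)
    by (simp add: e dist_norm field_simps)
  also have "\<bar>real j / 2 ^ m - y\<bar> = (y * 2 ^ m - real j) / 2 ^ m"
    using j(1) by (simp add: abs_if field_simps)
  also have "L * \<dots> \<le> L * (1 / 2 ^ m)"
    using lipschitz_on_nonneg[OF L] j by (intro mult_left_mono divide_right_mono) auto
  finally show ?thesis by simp
qed

text \<open>The Lipschitz error L / 2^m has square L^2 * 4^(-m), exactly the geometric rate that
  yields almost sure convergence without a subsequence. The same formula therefore serves for all
  parameters at once.\<close>

lemma is_wiener_integral_dyadic_lim:
  assumes bm: "brownian_motion_01 M W"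
    and L: "L-lipschitz_on {0..1} f"
  shows "is_wiener_integral M W f (\<lambda>s. lim (\<lambda>m. step_integral W (dyadic_step m f) s))"
proof -
  have L0: "0 \<le> L" by (rule lipschitz_on_nonneg[OF L])
  let ?P = "\<lambda>m. dyadic_step m f" let ?I = "\<lambda>m. step_integral W (dyadic_step m f)"
  have K0: "0 \<le> 4 * L\<^sup>2" by simp
  have m[measurable]: "?I m \<in> borel_measurable M" for m
    by (rule step_integral_measurable[OF bm valid_dyadic_step])
  have bd: "L2_sq_01 g \<le> ennreal (c\<^sup>2)"
    if g: "\<And>y. y \<in> {0<..<1} \<Longrightarrow> cmod (g y) \<le> c" for g :: "real \<Rightarrow> complex" and c
  proof -
    have "L2_sq_01 g \<le> (\<integral>\<^sup>+y. ennreal (c\<^sup>2) * indicator {0<..<1} y \<partial>(lborel :: real measure))"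
      by (intro nn_integral_mono) (auto simp: indicator_def g power_mono)
    also have "\<dots> = ennreal (c\<^sup>2)" by (subst nn_integral_cmult_indicator) auto
    finally show ?thesis .
  qed
  have sq: "(r / 2 ^ m)\<^sup>2 = r\<^sup>2 * (1/4)^m" for r :: real and m
    by (simp add: power_divide power2_eq_square power_mult_distrib[symmetric])
  \<comment> \<open>Two levels m \<le> n differ from f by at most L / 2^m each; squaring 2 * L / 2^m
    gives the factor 4.\<close>
  have C: "L2_sq M (\<lambda>s. ?I n s - ?I m s) \<le> ennreal (4 * L\<^sup>2 * (1/4)^m)" if "m \<le> n" for m n
  proof -
    have "L2_sq M (\<lambda>s. ?I n s - ?I m s)
        = L2_sq_01 (\<lambda>y. step_fun (?P n) y - step_fun (?P m) y)"
      using step_isometry[OF bm step_diff(1)[OF valid_dyadic_step valid_dyadic_step, of n f m f]]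
      unfolding step_diff(2,3) .
    also have "\<dots> \<le> ennreal ((2 * L / 2 ^ m)\<^sup>2)"
    proof (rule bd)
      fix y :: real assume y: "y \<in> {0<..<1}"
      have "cmod (step_fun (?P n) y - step_fun (?P m) y) \<le> cmod (step_fun (?P n) y - f y) + cmod (step_fun (?P m) y - f y)"
        by (metis norm_triangle_ineq4 diff_diff_eq2 diff_add_cancel add_diff_cancel_right' diff_add_eq)
      also have "\<dots> \<le> L / 2 ^ n + L / 2 ^ m"
        by (intro add_mono step_fun_dyadic_approx[OF L y])
      also have "L / 2 ^ n \<le> L / 2 ^ m"
        using that L0 by (intro divide_left_mono) (auto simp: power_increasing)
      finally show "cmod (step_fun (?P n) y - step_fun (?P m) y) \<le> 2 * L / 2 ^ m" by simp
    qed
    finally show ?thesis unfolding sq by (simp add: power_mult_distrib)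
  qed
  have l2: "L2_sq M (\<lambda>s. ?I m s - lim (\<lambda>m. ?I m s)) \<le> ennreal (4 * L\<^sup>2 * (1/4)^m)" for m
    by (rule geometric_L2_Cauchy_limit[OF m C K0])
  have z: "(\<lambda>m. ennreal (r * (1/4)^m)) \<longlonglongrightarrow> 0" for r :: real
  proof -
    have "(\<lambda>m. ennreal (r * (1/4)^m)) \<longlonglongrightarrow> ennreal (r * 0)"
      by (intro tendsto_intros LIMSEQ_power_zero) auto
    then show ?thesis by simp
  qed
  have "continuous_on {0..1} f" by (rule lipschitz_on_continuous_on[OF L])
  then have "continuous_on {0<..<1} f" by (rule continuous_on_subset) auto
  then have "set_borel_measurable lborel {0<..<1} f"
    unfolding set_borel_measurable_def
    using borel_measurable_continuous_on_indicator[of "{0<..<1}" f] by simp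
  moreover have "(\<lambda>s. lim (\<lambda>m. ?I m s)) \<in> borel_measurable M" by measurable
  moreover have "(\<lambda>m. L2_sq_01 (\<lambda>y. step_fun (?P m) y - f y)) \<longlonglongrightarrow> 0"
  proof (rule tendsto_sandwich[OF _ _ tendsto_const z[of "L\<^sup>2"]])
    show "\<forall>\<^sub>F m in sequentially. (L2_sq_01 (\<lambda>y. step_fun (?P m) y - f y)) \<le> ennreal (L\<^sup>2 * (1/4)^m)"
      unfolding sq[symmetric] by (intro always_eventually allI bd step_fun_dyadic_approx[OF L])
  qed auto
  moreover have "(\<lambda>m. L2_sq M (\<lambda>s. ?I m s - lim (\<lambda>m. ?I m s))) \<longlonglongrightarrow> 0"
    by (rule tendsto_sandwich[OF _ _ tendsto_const z[of "4 * L\<^sup>2"]]) (use l2 in auto)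
  ultimately show ?thesis
    unfolding is_wiener_integral_def by (intro conjI exI[of _ ?P] allI valid_dyadic_step)
qed

section \<open>The Fourier transform on \<open>L\<^sup>2\<close>\<close>

lemma integrable_fourier_gaussian:
  "integrable lborel (\<lambda>\<omega>. of_real (exp (- \<omega>\<^sup>2 / (2 * r\<^sup>2))) * exp (\<i> * of_real (\<omega> * \<tau>)))"
  if "0 < r"
proof -
  have "integrable lborel (\<lambda>\<omega>. sqrt (2 * pi * r\<^sup>2) * normal_density 0 r \<omega>)"
    using that by (intro integrable_mult_right) simp
  then have "integrable lborel (\<lambda>\<omega>. exp (- \<omega>\<^sup>2 / (2 * r\<^sup>2)))"
    using that by (simp add: normal_density_def)
  then show ?thesis
    by (rule Bochner_Integration.integrable_bound) (auto simp: norm_mult)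
qed

text \<open>Substituting \<omega> = r * x reduces the integral to the characteristic function of the
  standard normal law. The result is 2 * pi times a probability density, which is the origin of
  every 2 * pi below.\<close>

lemma integral_fourier_gaussian:
  assumes r: "0 < r"
  shows "(\<integral>\<omega>. of_real (exp (- \<omega>\<^sup>2 / (2 * r\<^sup>2))) * exp (\<i> * of_real (\<omega> * \<tau>)) \<partial>lborel)
    = complex_of_real (2 * pi * normal_density 0 (1 / r) \<tau>)"
proof -
  have "(\<integral>\<omega>. of_real (exp (- \<omega>\<^sup>2 / (2 * r\<^sup>2))) * exp (\<i> * of_real (\<omega> * \<tau>)) \<partial>lborel)
    = \<bar>r\<bar> *\<^sub>R (\<integral>x. of_real (exp (- (0 + r * x)\<^sup>2 / (2 * r\<^sup>2))) * exp (\<i> * of_real ((0 + r * x) * \<tau>)) \<partial>lborel)"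
    using r by (intro lborel_integral_real_affine) auto
  also have "(\<lambda>x. of_real (exp (- (0 + r * x)\<^sup>2 / (2 * r\<^sup>2))) * exp (\<i> * of_real ((0 + r * x) * \<tau>)))
    = (\<lambda>x. of_real (sqrt (2 * pi)) * (std_normal_density x *\<^sub>R iexp ((r * \<tau>) * x)))"
    using r by (auto simp: fun_eq_iff std_normal_density_def scaleR_conv_of_real power_mult_distrib algebra_simps
        simp flip: of_real_mult)
  also have "(\<integral>x. of_real (sqrt (2 * pi)) * (std_normal_density x *\<^sub>R iexp ((r * \<tau>) * x)) \<partial>lborel)
     = of_real (sqrt (2 * pi)) * char std_normal_distribution (r * \<tau>)"
  proof -
    have "char std_normal_distribution (r * \<tau>) = (\<integral>x. std_normal_density x *\<^sub>R iexp ((r * \<tau>) * x) \<partial>lborel)"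
      unfolding char_def by (subst integral_density) auto
    then show ?thesis by (simp only: integral_mult_right_zero)
  qed
  also have "char std_normal_distribution (r * \<tau>) = of_real (exp (- (r * \<tau>)\<^sup>2 / 2))"
    unfolding char_std_normal_distribution by simp
  also have "\<bar>r\<bar> *\<^sub>R (of_real (sqrt (2 * pi)) * of_real (exp (- (r * \<tau>)\<^sup>2 / 2)))
      = complex_of_real (2 * pi * normal_density 0 (1 / r) \<tau>)"
  proof -
    have s: "sqrt (2 * pi * (1 / r)\<^sup>2) = sqrt (2 * pi) / r" using r by (simp add: real_sqrt_mult real_sqrt_divide)
    have "2 * pi * normal_density 0 (1 / r) \<tau> = r * ((2 * pi) / sqrt (2 * pi)) * exp (- (r * \<tau>)\<^sup>2 / 2)"
      unfolding normal_density_def s using r by (simp add: field_simps power_mult_distrib)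
    also have "(2 * pi) / sqrt (2 * pi) = sqrt (2 * pi)" by (simp add: real_div_sqrt)
    finally show ?thesis using r by (simp add: scaleR_conv_of_real)
  qed
  finally show ?thesis .
qed

lemma (in pair_sigma_finite) integrable_mult_pair:
  fixes f :: "'a \<Rightarrow> complex" and g :: "'b \<Rightarrow> complex"
  assumes f: "integrable M1 f" and g: "integrable M2 g"
  shows "integrable (M1 \<Otimes>\<^sub>M M2) (\<lambda>(x, y). f x * g y)"
proof (rule Fubini_integrable)
  have [measurable]: "f \<in> borel_measurable M1" "g \<in> borel_measurable M2" using f g by auto
  show "(\<lambda>(x, y). f x * g y) \<in> borel_measurable (M1 \<Otimes>\<^sub>M M2)" by measurable
  show "integrable M1 (\<lambda>x. \<integral>y. norm (case (x, y) of (x, y) \<Rightarrow> f x * g y) \<partial>M2)"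
    using f by (simp add: norm_mult)
  show "AE x in M1. integrable M2 (\<lambda>y. case (x, y) of (x, y) \<Rightarrow> f x * g y)"
    using g by simp
qed

lemma (in pair_sigma_finite) integral_mult_pair:
  fixes f :: "'a \<Rightarrow> complex" and g :: "'b \<Rightarrow> complex"
  assumes f: "integrable M1 f" and g: "integrable M2 g"
  shows "(\<integral>p. f (fst p) * g (snd p) \<partial>(M1 \<Otimes>\<^sub>M M2)) = (\<integral>x. f x \<partial>M1) * (\<integral>y. g y \<partial>M2)"
  using integral_fst[of "\<lambda>x y. f x * g y"] integrable_mult_pair[OF f g] by (simp add: case_prod_unfold)

abbreviation fourier_kernel :: "real \<Rightarrow> real \<Rightarrow> complex" where
  "fourier_kernel \<omega> t \<equiv> exp (- (\<i> * of_real \<omega> * of_real t))"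

definition fourier_L1 :: "(real \<Rightarrow> complex) \<Rightarrow> real \<Rightarrow> complex" where
  "fourier_L1 f \<omega> = (\<integral>t. fourier_kernel \<omega> t * f t \<partial>lborel)"

lemma fourier_L1_measurable [measurable]:
  assumes [measurable]: "f \<in> borel_measurable borel"
  shows "fourier_L1 f \<in> borel_measurable borel"
  unfolding fourier_L1_def[abs_def] by measurable

lemma integrable_fourier_kernel:
  assumes "integrable lborel f"
  shows "integrable lborel (\<lambda>t. fourier_kernel \<omega> t * f t)"
  using assms by (rule Bochner_Integration.integrable_bound) (use assms in \<open>auto simp: norm_mult\<close>)

lemma fourier_L1_diff:
  assumes "integrable lborel f" "integrable lborel g"
  shows "fourier_L1 (\<lambda>t. f t - g t) \<omega> = fourier_L1 f \<omega> - fourier_L1 g \<omega>"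
  unfolding fourier_L1_def using assms
  by (simp add: right_diff_distrib Bochner_Integration.integral_diff integrable_fourier_kernel)

text \<open>The Gaussian weight makes the triple integral over \<omega>, s, t absolutely convergent.
  Integrating over \<omega> first leaves a convolution kernel of mass 2 * pi, and splitting 2 *
  |f(s) f(t)| into the sum of squares bounds the quadratic form as in Schur's test.\<close>

lemma plancherel_gaussian_le:
  fixes f :: "real \<Rightarrow> complex"
  assumes f: "integrable lborel f" and r: "0 < r"
  shows "(\<integral>\<^sup>+\<omega>. ennreal (exp (- \<omega>\<^sup>2 / (2 * r\<^sup>2)) * (cmod (fourier_L1 f \<omega>))\<^sup>2) \<partial>lborel)
    \<le> ennreal (2 * pi) * L2_sq lborel f"
proof -
  let ?w = "\<lambda>\<omega>. exp (- \<omega>\<^sup>2 / (2 * r\<^sup>2))"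
  let ?LL = "lborel \<Otimes>\<^sub>M (lborel :: real measure) :: (real \<times> real) measure"
  have [measurable]: "f \<in> borel_measurable borel" using f by auto
  interpret Q: pair_sigma_finite "lborel :: real measure" ?LL
    by (intro pair_sigma_finite.intro sigma_finite_pair_measure lborel.sigma_finite_measure_axioms)
  let ?k = "normal_density 0 (1 / r)"
  define H where "H \<omega> p = of_real (?w \<omega>) * (fourier_kernel \<omega> (fst p) * f (fst p) *
      cnj (fourier_kernel \<omega> (snd p) * f (snd p)))" for \<omega> and p :: "real \<times> real"
  have ffi: "integrable ?LL (\<lambda>(s, t). f s * cnj (f t))"
    by (rule lborel_pair.integrable_mult_pair) (use f in auto)
  have iw: "integrable lborel (\<lambda>\<omega>. complex_of_real (?w \<omega>))"
    using integrable_fourier_gaussian[OF r, of 0] by simp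
  have "integrable (lborel \<Otimes>\<^sub>M ?LL) (\<lambda>(\<omega>, p). of_real (?w \<omega>) * (case p of (s, t) \<Rightarrow> f s * cnj (f t)))"
    by (rule Q.integrable_mult_pair[OF iw ffi])
  moreover have [measurable]: "cnj \<in> borel_measurable borel"
    by (intro borel_measurable_continuous_onI continuous_intros)
  have "case_prod H \<in> borel_measurable (lborel \<Otimes>\<^sub>M ?LL)"
    unfolding H_def case_prod_unfold by measurable
  ultimately have Hi: "integrable (lborel \<Otimes>\<^sub>M ?LL) (case_prod H)"
    by (rule Bochner_Integration.integrable_bound) (auto simp: H_def norm_mult case_prod_unfold)
  have inner: "(\<integral>p. H \<omega> p \<partial>?LL) = of_real (?w \<omega> * (cmod (fourier_L1 f \<omega>))\<^sup>2)" for \<omega>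
  proof -
    let ?g = "\<lambda>t. fourier_kernel \<omega> t * f t"
    have gi: "integrable lborel ?g" by (rule integrable_fourier_kernel[OF f])
    have gi': "integrable lborel (\<lambda>t. cnj (?g t))" using gi by (simp only: complex_integrable_cnj)
    have "(\<integral>p. ?g (fst p) * cnj (?g (snd p)) \<partial>?LL) = fourier_L1 f \<omega> * cnj (fourier_L1 f \<omega>)"
      using lborel_pair.integral_mult_pair[OF gi gi'] unfolding fourier_L1_def Bochner_Integration.integral_cnj .
    also have "\<dots> = of_real ((cmod (fourier_L1 f \<omega>))\<^sup>2)" by (rule complex_norm_square[symmetric])
    finally show ?thesis unfolding H_def by simp
  qed
  have outer: "(\<integral>\<omega>. H \<omega> p \<partial>lborel) = of_real (2 * pi * ?k (snd p - fst p)) * (f (fst p) * cnj (f (snd p)))" for p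
  proof -
    have "H \<omega> p = of_real (?w \<omega>) * exp (\<i> * of_real (\<omega> * (snd p - fst p))) * (f (fst p) * cnj (f (snd p)))" for \<omega>
      unfolding H_def by (simp add: exp_cnj exp_add[symmetric] algebra_simps exp_diff exp_minus field_simps)
    then show ?thesis by (simp only: Bochner_Integration.integral_mult_left_zero integral_fourier_gaussian[OF r])
  qed
  \<comment> \<open>The cases c = 1 and c = -1 serve for integrating t - s over t and over s. Each
    square carries half of the mass 2 * pi.\<close>
  have mass: "(\<integral>\<^sup>+t. ennreal (pi * ?k (a + c * t)) * b \<partial>lborel) = ennreal pi * b" if "\<bar>c\<bar> = 1" for a b c
  proof -
    have "(\<integral>\<^sup>+t. ennreal (?k (a + c * t)) \<partial>lborel) = (\<integral>\<^sup>+t. ennreal (?k t) \<partial>lborel)"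
      using nn_integral_real_affine[of "\<lambda>t. ennreal (?k t)" c a] that by (auto simp: abs_if split: if_splits)
    also have "\<dots> = 1" using r by (subst nn_integral_eq_integral) auto
    finally show ?thesis by (simp add: nn_integral_multc nn_integral_cmult ennreal_mult')
  qed
  have wi: "integrable lborel (\<lambda>\<omega>. ?w \<omega> * (cmod (fourier_L1 f \<omega>))\<^sup>2)"
    using Q.integrable_fst[OF Hi] unfolding inner by (simp add: complex_of_real_integrable_eq del: of_real_mult)
  have swap: "of_real (\<integral>\<omega>. ?w \<omega> * (cmod (fourier_L1 f \<omega>))\<^sup>2 \<partial>lborel) =
      (\<integral>p. of_real (2 * pi * ?k (snd p - fst p)) * (f (fst p) * cnj (f (snd p))) \<partial>?LL)"
    using Q.Fubini_integral[OF Hi] unfolding inner outer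
    by (simp add: integral_complex_of_real del: of_real_mult)
  have oi: "integrable ?LL (\<lambda>p. of_real (2 * pi * ?k (snd p - fst p)) * (f (fst p) * cnj (f (snd p))))"
    using Q.integrable_snd[OF Hi] unfolding outer .
  have "(\<integral>\<^sup>+\<omega>. ennreal (?w \<omega> * (cmod (fourier_L1 f \<omega>))\<^sup>2) \<partial>lborel)
      = ennreal (\<integral>\<omega>. ?w \<omega> * (cmod (fourier_L1 f \<omega>))\<^sup>2 \<partial>lborel)"
    by (rule nn_integral_eq_integral[OF wi]) auto
  \<comment> \<open>Passing to the modulus embeds the real integral in the complex ones, where the
    norm bound for the double integral applies.\<close>
  also have "\<dots> \<le> ennreal (cmod (of_real (\<integral>\<omega>. ?w \<omega> * (cmod (fourier_L1 f \<omega>))\<^sup>2 \<partial>lborel)))"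
    by (intro ennreal_leI) simp
  also have "\<dots> \<le> (\<integral>\<^sup>+p. norm (of_real (2 * pi * ?k (snd p - fst p)) * (f (fst p) * cnj (f (snd p)))) \<partial>?LL)"
    unfolding swap by (rule integral_norm_bound_ennreal[OF oi])
  also have "\<dots> \<le> (\<integral>\<^sup>+p. ennreal (pi * ?k (snd p - fst p)) * ennreal ((cmod (f (fst p)))\<^sup>2)
      + ennreal (pi * ?k (snd p - fst p)) * ennreal ((cmod (f (snd p)))\<^sup>2) \<partial>?LL)"
  proof (rule nn_integral_mono)
    fix p :: "real \<times> real"
    have k0: "0 \<le> ?k (snd p - fst p)" by simp
    have "2 * (cmod (f (fst p)) * cmod (f (snd p))) \<le> (cmod (f (fst p)))\<^sup>2 + (cmod (f (snd p)))\<^sup>2"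
      using sum_squares_bound[of "cmod (f (fst p))" "cmod (f (snd p))"] by simp
    from mult_left_mono[OF this, of "pi * ?k (snd p - fst p)"]
    have "norm (of_real (2 * pi * ?k (snd p - fst p)) * (f (fst p) * cnj (f (snd p)))) \<le>
       pi * ?k (snd p - fst p) * (cmod (f (fst p)))\<^sup>2 + pi * ?k (snd p - fst p) * (cmod (f (snd p)))\<^sup>2"
      using k0 by (simp add: norm_mult algebra_simps)
    then show "ennreal (norm (of_real (2 * pi * ?k (snd p - fst p)) * (f (fst p) * cnj (f (snd p))))) \<le>
       ennreal (pi * ?k (snd p - fst p)) * ennreal ((cmod (f (fst p)))\<^sup>2)
      + ennreal (pi * ?k (snd p - fst p)) * ennreal ((cmod (f (snd p)))\<^sup>2)"
      using k0 by (simp add: ennreal_mult[symmetric] ennreal_plus[symmetric] del: ennreal_plus)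
  qed
  also have "\<dots> = (\<integral>\<^sup>+p. ennreal (pi * ?k (snd p - fst p)) * ennreal ((cmod (f (fst p)))\<^sup>2) \<partial>?LL)
      + (\<integral>\<^sup>+p. ennreal (pi * ?k (snd p - fst p)) * ennreal ((cmod (f (snd p)))\<^sup>2) \<partial>?LL)"
    by (rule nn_integral_add) measurable
  also have "(\<integral>\<^sup>+p. ennreal (pi * ?k (snd p - fst p)) * ennreal ((cmod (f (fst p)))\<^sup>2) \<partial>?LL)
     = (\<integral>\<^sup>+s. (\<integral>\<^sup>+t. ennreal (pi * ?k (t - s)) * ennreal ((cmod (f s))\<^sup>2) \<partial>lborel) \<partial>lborel)"
    by (subst lborel.nn_integral_fst[symmetric]) auto
  also have "\<dots> = (\<integral>\<^sup>+s. ennreal pi * ennreal ((cmod (f s))\<^sup>2) \<partial>lborel)"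
    using mass[of 1 "- _"] by (intro nn_integral_cong) simp
  also have "(\<integral>\<^sup>+p. ennreal (pi * ?k (snd p - fst p)) * ennreal ((cmod (f (snd p)))\<^sup>2) \<partial>?LL)
     = (\<integral>\<^sup>+t. (\<integral>\<^sup>+s. ennreal (pi * ?k (t - s)) * ennreal ((cmod (f t))\<^sup>2) \<partial>lborel) \<partial>lborel)"
    by (subst lborel_pair.nn_integral_snd[symmetric]) auto
  also have "\<dots> = (\<integral>\<^sup>+t. ennreal pi * ennreal ((cmod (f t))\<^sup>2) \<partial>lborel)"
    using mass[of "- 1"] by (intro nn_integral_cong) simp
  also have "(\<integral>\<^sup>+t. ennreal pi * ennreal ((cmod (f t))\<^sup>2) \<partial>lborel) = ennreal pi * L2_sq lborel f"
    by (rule nn_integral_cmult) measurable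
  also have "\<dots> + \<dots> = ennreal (2 * pi) * L2_sq lborel f"
    by (simp add: distrib_right[symmetric] ennreal_plus[symmetric] del: ennreal_plus)
  finally show ?thesis .
qed

text \<open>The weights tend to 1 pointwise and the bound is uniform in them, so Fatou's lemma
  removes them.\<close>

lemma plancherel_le:
  fixes f :: "real \<Rightarrow> complex"
  assumes f: "integrable lborel f"
  shows "L2_sq lborel (fourier_L1 f)
    \<le> ennreal (2 * pi) * L2_sq lborel f"
proof -
  let ?w = "\<lambda>n \<omega>. exp (- \<omega>\<^sup>2 / (2 * (real (Suc n))\<^sup>2))"
  have [measurable]: "f \<in> borel_measurable borel" using f by auto
  have "L2_sq lborel (fourier_L1 f) =
     (\<integral>\<^sup>+\<omega>. liminf (\<lambda>n. ennreal (?w n \<omega> * (cmod (fourier_L1 f \<omega>))\<^sup>2)) \<partial>lborel)"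
  proof (rule nn_integral_cong)
    fix \<omega> :: real
    have "(\<lambda>n. exp (- \<omega>\<^sup>2 / 2 * (inverse (real (Suc n)))\<^sup>2)) \<longlonglongrightarrow> exp (- \<omega>\<^sup>2 / 2 * 0\<^sup>2)"
      by (intro tendsto_intros LIMSEQ_inverse_real_of_nat)
    then have "(\<lambda>n. ?w n \<omega>) \<longlonglongrightarrow> 1"
      by (simp add: field_simps)
    then have "(\<lambda>n. ennreal (?w n \<omega> * (cmod (fourier_L1 f \<omega>))\<^sup>2)) \<longlonglongrightarrow> ennreal (1 * (cmod (fourier_L1 f \<omega>))\<^sup>2)"
      by (intro tendsto_intros)
    from lim_imp_Liminf[OF _ this] show "ennreal ((cmod (fourier_L1 f \<omega>))\<^sup>2) =
      liminf (\<lambda>n. ennreal (?w n \<omega> * (cmod (fourier_L1 f \<omega>))\<^sup>2))" by simp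
  qed
  also have "\<dots> \<le> liminf (\<lambda>n. \<integral>\<^sup>+\<omega>. ennreal (?w n \<omega> * (cmod (fourier_L1 f \<omega>))\<^sup>2) \<partial>lborel)"
    by (rule nn_integral_liminf) measurable
  also have "\<dots> \<le> ennreal (2 * pi) * L2_sq lborel f"
    by (intro Liminf_le always_eventually allI plancherel_gaussian_le[OF f]) auto
  finally show ?thesis .
qed

section \<open>Existence of the Fourier transform on L2\<close>

lemma integrable_L2_interval:
  fixes f :: "real \<Rightarrow> complex"
  assumes [measurable]: "f \<in> borel_measurable borel"
    and f2: "integrable lborel (\<lambda>t. (cmod (f t))\<^sup>2)"
  shows "integrable lborel (\<lambda>t. indicator {a..b} t *\<^sub>R f t)"
proof (rule Bochner_Integration.integrable_bound)
  show "integrable lborel (\<lambda>t. indicator {a..b} t + (cmod (f t))\<^sup>2)"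
    by (intro Bochner_Integration.integrable_add f2 integrable_real_indicator) (auto simp: emeasure_lborel_Icc_eq)
  \<comment> \<open>The modulus is dominated by 1 plus its square on a set of finite
    measure.\<close>
  have "x \<le> 1 + x\<^sup>2" if "0 \<le> x" for x :: real using zero_le_power2[of "x - 1"] that by (simp add: power2_diff)
  then show "AE t in lborel. norm (indicator {a..b} t *\<^sub>R f t) \<le> norm (indicator {a..b} t + (cmod (f t))\<^sup>2)"
    by (auto simp: indicator_def)
qed measurable

text \<open>Truncations are integrable, and so are their differences, to which the Plancherel
  inequality applies. Vanishing of the tail \<open>R\<close> then makes the truncated transforms
  Cauchy.\<close>

lemma is_fourier_L2_exists:
  fixes f :: "real \<Rightarrow> complex"
  assumes [measurable]: "f \<in> borel_measurable borel"
    and f2: "integrable lborel (\<lambda>t. (cmod (f t))\<^sup>2)"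
  shows "\<exists>h. is_fourier_L2 f h"
proof -
  define T where "T n t = indicator {- real n..real n} t *\<^sub>R f t" for n t
  have Ti: "integrable lborel (T n)" for n
    unfolding T_def[abs_def] by (rule integrable_L2_interval) fact+
  have [measurable]: "T n \<in> borel_measurable borel" for n using Ti[of n] by auto
  have T: "(LINT t:{- real n..real n}|lborel. fourier_kernel \<omega> t * f t) = fourier_L1 (T n) \<omega>" for n \<omega>
    unfolding set_lebesgue_integral_def fourier_L1_def T_def by simp
  define R where "R k = L2_sq lborel (\<lambda>t. f t - T k t)" for k
  have R: "R \<longlonglongrightarrow> (\<integral>\<^sup>+t. 0 \<partial>(lborel :: real measure))"
    unfolding R_def[abs_def]
  proof (rule nn_integral_dominated_convergence[where w="\<lambda>t. ennreal ((cmod (f t))\<^sup>2)"])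
    show "AE t in lborel. (\<lambda>k. ennreal ((cmod (f t - T k t))\<^sup>2)) \<longlonglongrightarrow> 0"
    proof (rule AE_I2)
      fix t :: real
      obtain k0 where k0: "\<bar>t\<bar> \<le> real k0" using real_arch_simple by blast
      have "\<forall>\<^sub>F k in sequentially. ennreal ((cmod (f t - T k t))\<^sup>2) = 0"
        using eventually_ge_at_top[of k0]
      proof eventually_elim
        case (elim k)
        then have "t \<in> {- real k..real k}" using k0 by (auto simp: abs_le_iff intro: order_trans)
        then show ?case by (simp add: T_def)
      qed
      then show "(\<lambda>k. ennreal ((cmod (f t - T k t))\<^sup>2)) \<longlonglongrightarrow> 0" by (rule tendsto_eventually)
    qed
    show "L2_sq lborel f < \<infinity>"
      using f2 by (simp add: integrable_iff_bounded)
  qed (auto simp: T_def indicator_def)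
  have bd: "L2_sq lborel (\<lambda>\<omega>. fourier_L1 (T n) \<omega> - fourier_L1 (T m) \<omega>) \<le> ennreal (2 * pi) * R k"
    if "k \<le> m" "k \<le> n" for k m n
  proof -
    have "L2_sq lborel (\<lambda>\<omega>. fourier_L1 (T n) \<omega> - fourier_L1 (T m) \<omega>)
      \<le> ennreal (2 * pi) * L2_sq lborel (\<lambda>t. T n t - T m t)"
      using plancherel_le[of "\<lambda>t. T n t - T m t"] by (simp add: fourier_L1_diff Ti)
    also have "\<dots> \<le> ennreal (2 * pi) * R k"
      unfolding R_def by (intro mult_left_mono nn_integral_mono)
        (use that in \<open>auto simp: T_def indicator_def\<close>)
    finally show ?thesis .
  qed
  have "\<exists>h\<in>borel_measurable lborel. (\<lambda>n. L2_sq lborel (\<lambda>\<omega>. h \<omega> - fourier_L1 (T n) \<omega>)) \<longlonglongrightarrow> 0"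
  proof (rule L2_complete)
    fix e :: real assume e: "0 < e"
    have "(\<lambda>k. ennreal (2 * pi) * R k) \<longlonglongrightarrow> ennreal (2 * pi) * 0"
      using R by (intro ennreal_tendsto_cmult) auto
    then have "\<forall>\<^sub>F k in sequentially. ennreal (2 * pi) * R k < ennreal e"
      using e by (intro order_tendstoD(2)) auto
    then obtain k where k: "ennreal (2 * pi) * R k < ennreal e" by (auto simp: eventually_sequentially)
    show "\<exists>k. \<forall>m\<ge>k. \<forall>n\<ge>k. (L2_sq lborel (\<lambda>\<omega>. fourier_L1 (T n) \<omega> - fourier_L1 (T m) \<omega>)) \<le> ennreal e"
      by (intro exI[of _ k] allI impI order_trans[OF bd less_imp_le[OF k]])
  qed measurable
  then show ?thesis unfolding is_fourier_L2_def T by auto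
qed

section \<open>Test functions\<close>

definition smooth :: "(real \<Rightarrow> real) \<Rightarrow> bool" where
  "smooth f \<longleftrightarrow> (\<forall>n x. (deriv ^^ n) f differentiable (at x))"

text \<open>If differentiation keeps a class inside itself, all iterated derivatives stay there.
  Smoothness of the bump then needs just one derivative computation for a whole family.\<close>

lemma smooth_coinduct:
  assumes f: "f \<in> S" and S: "\<And>f. f \<in> S \<Longrightarrow> \<exists>f'\<in>S. \<forall>x. (f has_real_derivative f' x) (at x)"
  shows "smooth f"
proof -
  have "(deriv ^^ n) f \<in> S" for n
  proof (induction n)
    case (Suc n)
    obtain f' where f': "f' \<in> S" "\<And>x. ((deriv ^^ n) f has_real_derivative f' x) (at x)"
      using S[OF Suc] by blast
    then have "deriv ((deriv ^^ n) f) = f'" by (auto intro!: ext DERIV_imp_deriv)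
    then show ?case using f'(1) by simp
  qed (simp add: f)
  then show ?thesis unfolding smooth_def using S real_differentiable_def by blast
qed

lemma smooth_DERIV: "smooth f \<Longrightarrow> (f has_real_derivative deriv f x) (at x)"
  unfolding smooth_def by (metis DERIV_deriv_iff_real_differentiable funpow_0)

lemma smooth_deriv: "smooth f \<Longrightarrow> smooth (deriv f)"
  unfolding smooth_def by (metis funpow_Suc_right comp_apply)

lemma smooth_antiderivative:
  assumes F: "\<And>x. (F has_real_derivative f x) (at x)" and f: "smooth f"
  shows "smooth F"
proof (rule smooth_coinduct[of _ "insert F {f. smooth f}"])
  fix g assume "g \<in> insert F {f. smooth f}"
  then show "\<exists>g'\<in>insert F {f. smooth f}. \<forall>x. (g has_real_derivative g' x) (at x)"
    using F f smooth_DERIV smooth_deriv by blast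
qed simp

lemma smooth_diff_mult:
  assumes "smooth f" "smooth g" shows "smooth (\<lambda>x. f x - c * g x)"
proof (rule smooth_coinduct[of _ "{\<lambda>x. f x - c * g x | f g. smooth f \<and> smooth g}"])
  fix h assume "h \<in> {\<lambda>x. f x - c * g x | f g. smooth f \<and> smooth g}"
  then obtain f g where h: "h = (\<lambda>x. f x - c * g x)" and fg: "smooth f" "smooth g" by blast
  show "\<exists>h'\<in>{\<lambda>x. f x - c * g x | f g. smooth f \<and> smooth g}. \<forall>x. (h has_real_derivative h' x) (at x)"
  proof (intro bexI allI)
    fix x show "(h has_real_derivative (deriv f x - c * deriv g x)) (at x)"
      unfolding h by (intro derivative_intros DERIV_cmult smooth_DERIV fg)
  qed (use fg smooth_deriv in blast)
qed (use assms in blast)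

lemma smooth_continuous: "smooth f \<Longrightarrow> continuous_on A f"
  using smooth_DERIV DERIV_isCont continuous_at_imp_continuous_on by blast

section \<open>Bump functions\<close>

lemma quadratic_bound_DERIV_zero:
  fixes f :: "real \<Rightarrow> real"
  assumes "\<And>t. \<bar>f t\<bar> \<le> K * (t - c)\<^sup>2"
  shows "(f has_real_derivative 0) (at c)"
proof -
  have "f c = 0" using assms[of c] by simp
  have "((\<lambda>t. (f t - f c) / (t - c)) \<longlongrightarrow> 0) (at c)"
  proof (rule Lim_null_comparison)
    show "\<forall>\<^sub>F t in at c. norm ((f t - f c) / (t - c)) \<le> K * \<bar>t - c\<bar>"
      unfolding eventually_at_filter
    proof (intro always_eventually allI impI)
      fix t assume "t \<noteq> c"
      then show "norm ((f t - f c) / (t - c)) \<le> K * \<bar>t - c\<bar>"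
        using assms[of t] \<open>f c = 0\<close>
        by (simp add: abs_divide divide_le_eq power2_eq_square mult.assoc abs_mult[symmetric])
    qed
    have "((\<lambda>t. K * \<bar>t - c\<bar>) \<longlongrightarrow> K * \<bar>c - c\<bar>) (at c)" by (intro tendsto_intros)
    then show "((\<lambda>t. K * \<bar>t - c\<bar>) \<longlongrightarrow> 0) (at c)" by simp
  qed
  then show ?thesis by (simp add: has_field_derivative_iff)
qed

text \<open>The derivatives of \<open>exp (- 1 / (N (t - a) (b - t)))\<close> stay in this family; the factor
  \<open>exp\<close> beats every power of \<open>1 / ((t - a) (b - t))\<close> at the end points.\<close>

definition bump_family :: "real \<Rightarrow> real \<Rightarrow> real \<Rightarrow> real poly \<Rightarrow> nat \<Rightarrow> real \<Rightarrow> real" where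
  "bump_family a b N r k t = (if a < t \<and> t < b then
     poly r t * (inverse ((t - a) * (b - t))) ^ k * exp (- (inverse ((t - a) * (b - t)) / N)) else 0)"

text \<open>Take reciprocals in exp x \<ge> (1 + x/m)^m \<ge> (x/m)^m with x = 1 / (q * N).\<close>

lemma exp_minus_inverse_le:
  fixes q N :: real
  assumes "0 < q" "0 < N" "0 < m"
  shows "exp (- (inverse q / N)) \<le> (real m * N) ^ m * q ^ m"
proof -
  have "(inverse q / N / real m) ^ m \<le> (1 + inverse q / N / real m) ^ m"
    using assms by (intro power_mono) auto
  also have "\<dots> \<le> exp (inverse q / N)"
    using assms by (intro exp_ge_one_plus_x_over_n_power_n) (auto intro: order_trans[of _ 0])
  finally have "inverse (exp (inverse q / N)) \<le> inverse ((inverse q / N / real m) ^ m)"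
    using assms by (intro le_imp_inverse_le) auto
  also have "\<dots> = (inverse (inverse q / N / real m)) ^ m" by (rule power_inverse[symmetric])
  also have "inverse (inverse q / N / real m) = real m * N * q" using assms by (simp add: field_simps)
  also have "(real m * N * q) ^ m = (real m * N) ^ m * q ^ m" by (rule power_mult_distrib)
  finally show ?thesis by (simp add: exp_minus)
qed

text \<open>The previous estimate is used with m = k + 2: k powers cancel the singular factor and
  two are left for a zero of second order at the end points.\<close>

lemma bump_family_bound:
  assumes N: "0 < N"
  shows "\<exists>K. \<forall>t. \<bar>bump_family a b N r k t\<bar> \<le> K * ((t - a) * (b - t))\<^sup>2 \<and> 0 \<le> K"
proof -
  have "compact (poly r ` {a..b})" by (intro compact_continuous_image continuous_intros) auto
  then obtain B where B: "\<And>t. t \<in> {a..b} \<Longrightarrow> \<bar>poly r t\<bar> \<le> B"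
    by (metis (no_types, lifting) bounded_iff compact_imp_bounded image_eqI real_norm_def)
  let ?K = "\<bar>B\<bar> * (real (k + 2) * N) ^ (k + 2)"
  have K0: "0 \<le> ?K" using N by simp
  show ?thesis
  proof (intro exI[of _ ?K] allI conjI K0)
    fix t
    show "\<bar>bump_family a b N r k t\<bar> \<le> ?K * ((t - a) * (b - t))\<^sup>2"
    proof (cases "a < t \<and> t < b")
      case True
      define q where "q = (t - a) * (b - t)"
      have q: "0 < q" unfolding q_def using True by simp
      have "\<bar>bump_family a b N r k t\<bar> = \<bar>poly r t\<bar> * (inverse q ^ k * exp (- (inverse q / N)))"
        using True q by (simp add: bump_family_def q_def[symmetric] abs_mult)
      also have "\<dots> \<le> \<bar>B\<bar> * (inverse q ^ k * ((real (k + 2) * N) ^ (k + 2) * q ^ (k + 2)))"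
        using True q N B[of t] by (intro mult_mono exp_minus_inverse_le) auto
      also have "\<dots> = ?K * q\<^sup>2"
        using q by (simp add: power_add field_simps power_inverse power2_eq_square)
      finally show ?thesis unfolding q_def .
    next
      case False
      then have "bump_family a b N r k t = 0" by (auto simp: bump_family_def)
      then show ?thesis using mult_nonneg_nonneg[OF K0 zero_le_power2] by simp
    qed
  qed
qed

lemma bump_family_DERIV:
  fixes a b N :: real
  defines "Q \<equiv> [:- a, 1:] * [:b, - 1:]"
  assumes N: "0 < N"
  shows "(bump_family a b N r k has_real_derivative
    bump_family a b N (pderiv r * Q\<^sup>2 - smult (real k) (r * pderiv Q * Q) + smult (1 / N) (r * pderiv Q)) (k + 2) t) (at t)"
proof (cases "a < t \<and> t < b")
  case True
  let ?e = "\<lambda>t. poly r t * (inverse (poly Q t)) ^ k * exp (- (inverse (poly Q t) / N))"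
  let ?g = "bump_family a b N (pderiv r * Q\<^sup>2 - smult (real k) (r * pderiv Q * Q) + smult (1 / N) (r * pderiv Q)) (k + 2)"
  have Qt: "poly Q t = (t - a) * (b - t)" for t unfolding Q_def by (simp add: algebra_simps)
  have q0: "poly Q t \<noteq> 0" unfolding Qt using True by simp
  define u where "u = inverse (poly Q t)"
  \<comment> \<open>The product rule produces the powers k, k + 1 and k + 2 of u. Factors u * Q = 1
    are inserted to bring all three terms to exponent k + 2, which explains the powers of
    \<open>Q\<close> in the new polynomial.\<close>
  have uq: "u * poly Q t = 1" using q0 unfolding u_def by simp
  have dq: "(poly Q has_real_derivative poly (pderiv Q) t) (at t)" by (rule poly_DERIV)
  have du: "((\<lambda>t. inverse (poly Q t)) has_real_derivative (- (poly (pderiv Q) t * u\<^sup>2))) (at t)"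
    using DERIV_inverse'[OF dq q0] by (simp add: u_def power2_eq_square algebra_simps)
  have duk: "((\<lambda>t. inverse (poly Q t) ^ k) has_real_derivative (- (real k * poly (pderiv Q) t * u ^ (k + 1)))) (at t)"
  proof (cases k)
    case (Suc j)
    then show ?thesis
      using DERIV_power[OF du, of k] by (simp add: u_def[symmetric] power2_eq_square algebra_simps)
  qed simp
  have de: "((\<lambda>t. exp (- (inverse (poly Q t) / N))) has_real_derivative
      (exp (- (u / N)) * (poly (pderiv Q) t * u\<^sup>2 / N))) (at t)"
    by (rule DERIV_cong[OF DERIV_fun_exp[OF DERIV_minus[OF DERIV_cdivide[OF du]]]])
       (simp add: u_def[symmetric])
  have "(?e has_real_derivative ((poly (pderiv r) t * u ^ k + poly r t * (- (real k * poly (pderiv Q) t * u ^ (k + 1)))) * exp (- (u / N))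
      + poly r t * u ^ k * (exp (- (u / N)) * (poly (pderiv Q) t * u\<^sup>2 / N)))) (at t)"
    by (rule DERIV_cong[OF DERIV_mult[OF DERIV_mult[OF poly_DERIV duk] de]])
       (simp add: u_def[symmetric] algebra_simps)
  also have "(poly (pderiv r) t * u ^ k + poly r t * (- (real k * poly (pderiv Q) t * u ^ (k + 1)))) * exp (- (u / N))
      + poly r t * u ^ k * (exp (- (u / N)) * (poly (pderiv Q) t * u\<^sup>2 / N))
     = (poly (pderiv r) t * (u * poly Q t)\<^sup>2 - real k * (poly r t * poly (pderiv Q) t * (u * poly Q t) * u)
       + 1 / N * (poly r t * poly (pderiv Q) t) * u\<^sup>2) * u ^ k * exp (- (u / N))"
    unfolding uq by (simp add: algebra_simps)
  also have "\<dots> = poly (pderiv r * Q\<^sup>2 - smult (real k) (r * pderiv Q * Q) + smult (1 / N) (r * pderiv Q)) t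
      * u ^ (k + 2) * exp (- (u / N))"
    by (simp add: power_add algebra_simps power2_eq_square)
  also have "\<dots> = ?g t"
    using True unfolding bump_family_def u_def Qt by (simp only: if_True simp_thms)
  finally have "(?e has_real_derivative ?g t) (at t)" .
  then show ?thesis
    by (rule has_field_derivative_transform_within_open[of _ _ _ "{a<..<b}"])
       (use True Qt in \<open>auto simp: bump_family_def\<close>)
next
  \<comment> \<open>One argument covers the end points and the exterior: the family is bounded by a
    multiple of the squared distance to t.\<close>
  case False
  obtain K where K: "\<And>t. \<bar>bump_family a b N r k t\<bar> \<le> K * ((t - a) * (b - t))\<^sup>2" "0 \<le> K"
    using bump_family_bound[OF N] by blast
  have "(bump_family a b N r k has_real_derivative 0) (at t)"
  proof (rule quadratic_bound_DERIV_zero)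
    fix s
    show "\<bar>bump_family a b N r k s\<bar> \<le> (K * (b - a)\<^sup>2) * (s - t)\<^sup>2"
    proof (cases "a < s \<and> s < b")
      case True
      have "((s - a) * (b - s))\<^sup>2 \<le> ((b - a) * \<bar>s - t\<bar>)\<^sup>2"
      proof (rule power_mono)
        \<comment> \<open>Since t lies to one side of the interval, the factor vanishing on that
          side is at most the distance from s to t, and the other factor is at most b - a.\<close>
        consider "t \<le> a" | "b \<le> t" using False by linarith
        then show "(s - a) * (b - s) \<le> (b - a) * \<bar>s - t\<bar>"
        proof cases
          case 1
          have "(b - s) * (s - a) \<le> (b - a) * \<bar>s - t\<bar>" using 1 True by (intro mult_mono) auto
          then show ?thesis by (simp add: mult.commute)
        next
          case 2 then show ?thesis using True by (intro mult_mono) auto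
        qed
      qed (use True in auto)
      then have "K * ((s - a) * (b - s))\<^sup>2 \<le> K * ((b - a) * \<bar>s - t\<bar>)\<^sup>2" using K(2) by (rule mult_left_mono)
      then show ?thesis using K(1)[of s] by (simp add: power_mult_distrib mult.assoc)
    next
      case False
      then show ?thesis using K(2) by (auto simp: bump_family_def)
    qed
  qed
  then show ?thesis using False by (auto simp: bump_family_def)
qed

definition bump :: "real \<Rightarrow> real \<Rightarrow> real \<Rightarrow> real \<Rightarrow> real" where
  "bump a b N = bump_family a b N 1 0"

lemma bump_simps: "bump a b N t = (if a < t \<and> t < b then exp (- (inverse ((t - a) * (b - t)) / N)) else 0)"
  by (simp add: bump_def bump_family_def)

lemma smooth_bump: "0 < N \<Longrightarrow> smooth (bump a b N)"
  unfolding bump_def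
  by (rule smooth_coinduct[of _ "{bump_family a b N r k | r k. True}"]) (use bump_family_DERIV in blast)+

lemma bump_bounds: "0 < N \<Longrightarrow> 0 \<le> bump a b N t" "0 < N \<Longrightarrow> bump a b N t \<le> 1"
  by (auto simp: bump_simps)

lemma bump_tendsto: "(\<lambda>n. bump a b (real (Suc n)) t) \<longlonglongrightarrow> indicator {a<..<b} t"
proof (cases "a < t \<and> t < b")
  case True
  have "(\<lambda>n. exp (- (inverse ((t - a) * (b - t)) * inverse (real (Suc n))))) \<longlonglongrightarrow> exp (- (inverse ((t - a) * (b - t)) * 0))"
    by (intro tendsto_intros LIMSEQ_inverse_real_of_nat)
  then show ?thesis using True by (simp add: bump_simps divide_inverse)
qed (auto simp: bump_simps)

section \<open>Supports, derivatives and primitives of test functions\<close>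

lemma test_functionI:
  assumes "smooth \<phi>" "\<And>x. x \<notin> {c..d} \<Longrightarrow> \<phi> x = 0" "{c..d} \<subseteq> S"
  shows "test_function S \<phi>"
proof -
  have "closure {x. \<phi> x \<noteq> 0} \<subseteq> {c..d}" by (rule closure_minimal) (use assms(2) in blast, simp)
  moreover from this have "compact (closure {x. \<phi> x \<noteq> 0})"
    by (metis closed_closure compact_Icc compact_Int_closed inf.absorb_iff2)
  ultimately show ?thesis using assms unfolding test_function_def smooth_def by blast
qed

lemma test_function_smooth: "test_function S \<phi> \<Longrightarrow> smooth \<phi>"
  by (simp add: test_function_def smooth_def)

lemma test_function_zero: "test_function S \<phi> \<Longrightarrow> x \<notin> S \<Longrightarrow> \<phi> x = 0"
  using closure_subset[of "{x. \<phi> x \<noteq> 0}"] unfolding test_function_def by blast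

text \<open>The hull of a compact subset of an order-convex set stays inside that set.\<close>

lemma test_function_support:
  assumes "test_function S \<phi>" and S: "\<And>x y. x \<in> S \<Longrightarrow> y \<in> S \<Longrightarrow> {x..y} \<subseteq> S" and x0: "x0 \<in> S"
  obtains c d where "c \<le> d" "{c..d} \<subseteq> S" "\<And>x. x \<notin> {c..d} \<Longrightarrow> \<phi> x = 0"
proof -
  \<comment> \<open>The extra point keeps the set nonempty when the function is identically
    zero.\<close>
  let ?K = "insert x0 (closure {x. \<phi> x \<noteq> 0})"
  have K: "compact ?K" "?K \<subseteq> S" using assms by (auto simp: test_function_def)
  have b: "bdd_below ?K" "bdd_above ?K" "closed ?K"
    using compact_imp_bounded[OF K(1)] compact_imp_closed[OF K(1)]
    by (auto intro: bounded_imp_bdd_below bounded_imp_bdd_above)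
  have i: "Inf ?K \<in> ?K" "Sup ?K \<in> ?K"
    using closed_contains_Inf[OF _ b(1,3)] closed_contains_Sup[OF _ b(2,3)] by blast+
  show thesis
  proof (rule that[of "Inf ?K" "Sup ?K"])
    show "Inf ?K \<le> Sup ?K" using b i by (meson cInf_lower cSup_upper order_trans)
    show "{Inf ?K..Sup ?K} \<subseteq> S" using S i K(2) by blast
    fix x assume "x \<notin> {Inf ?K..Sup ?K}"
    then have "x \<notin> ?K" using b by (meson atLeastAtMost_iff cInf_lower cSup_upper)
    then show "\<phi> x = 0" using closure_subset[of "{x. \<phi> x \<noteq> 0}"] by blast
  qed
qed

lemma deriv_zero_outside:
  fixes \<phi> :: "real \<Rightarrow> real"
  assumes "\<And>x. x \<notin> {c..d} \<Longrightarrow> \<phi> x = 0" "x \<notin> {c..d}"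
  shows "deriv \<phi> x = 0"
proof -
  have "open (- {c..d})" by (intro open_Compl closed_atLeastAtMost)
  then have "(\<phi> has_real_derivative 0) (at x)"
    by (rule has_field_derivative_transform_within_open[OF DERIV_const[of 0]])
       (use assms in \<open>auto simp del: atLeastAtMost_iff\<close>)
  then show ?thesis by (simp add: DERIV_imp_deriv)
qed

lemma test_function_deriv: 
  assumes "test_function S \<phi>"
  shows "test_function S (deriv \<phi>)"
proof -
  have "{x. deriv \<phi> x \<noteq> 0} \<subseteq> closure {x. \<phi> x \<noteq> 0}"
  proof (rule ccontr)
    assume "\<not> ?thesis"
    then obtain x where x: "deriv \<phi> x \<noteq> 0" "x \<in> - closure {x. \<phi> x \<noteq> 0}" by blast
    have "(\<phi> has_real_derivative 0) (at x)"
    proof (rule has_field_derivative_transform_within_open[OF DERIV_const[of 0]])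
      show "open (- closure {x. \<phi> x \<noteq> 0})" by (intro open_Compl closed_closure)
      show "x \<in> - closure {x. \<phi> x \<noteq> 0}" by (rule x(2))
      show "0 = \<phi> y" if "y \<in> - closure {x. \<phi> x \<noteq> 0}" for y
      proof -
        have "y \<notin> {x. \<phi> x \<noteq> 0}" using that closure_subset[of "{x. \<phi> x \<noteq> 0}"] by blast
        then show ?thesis by simp
      qed
    qed
    then show False using x(1) by (simp add: DERIV_imp_deriv)
  qed
  then have "closure {x. deriv \<phi> x \<noteq> 0} \<subseteq> closure {x. \<phi> x \<noteq> 0}" by (simp add: closure_minimal)
  moreover from this have "compact (closure {x. deriv \<phi> x \<noteq> 0})"
    using assms by (metis closed_closure compact_Int_closed inf.absorb_iff2 test_function_def)
  ultimately show ?thesis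
    using assms smooth_deriv[OF test_function_smooth[OF assms]] unfolding test_function_def smooth_def by blast
qed

text \<open>The primitive started to the left of the support is zero there, and the vanishing
  integral makes it zero to the right of the support as well.\<close>

lemma test_function_antiderivative:
  assumes \<psi>: "smooth \<psi>" and z: "\<And>x. x \<notin> {c..d} \<Longrightarrow> \<psi> x = 0" and cd: "{c..d} \<subseteq> S" "c \<le> d"
    and i0: "integral {c..d} \<psi> = 0"
  obtains \<Phi> where "test_function S \<Phi>" "deriv \<Phi> = \<psi>"
proof -
  \<comment> \<open>Starting at c - 1 makes every t \<ge> c an interior point of [c - 1, t + 1], so
    the one-sided derivative is two-sided.\<close>
  define \<Phi> where "\<Phi> t = integral {c - 1..t} \<psi>" for t
  have cont: "continuous_on A \<psi>" for A by (rule smooth_continuous[OF \<psi>])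
  have zl: "\<Phi> t = 0" if "t < c" for t
    unfolding \<Phi>_def by (subst integral_cong[of _ _ "\<lambda>_. 0"]) (use z that in auto)
  have zr: "\<Phi> t = 0" if "d < t" for t
  proof -
    have "\<Phi> t = integral {c - 1..c} \<psi> + (integral {c..d} \<psi> + integral {d..t} \<psi>)"
      unfolding \<Phi>_def using cd that
      by (subst Henstock_Kurzweil_Integration.integral_combine[symmetric, of "c - 1" c t])
         (auto intro!: integrable_continuous_real cont Henstock_Kurzweil_Integration.integral_combine[symmetric])
    also have "integral {c - 1..c} \<psi> = integral {c - 1..c} (\<lambda>_. 0)"
      by (rule integral_spike[of "{c}"]) (use z in auto)
    also have "integral {d..t} \<psi> = integral {d..t} (\<lambda>_. 0)"
      by (rule integral_spike[of "{d}"]) (use z in auto)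
    finally show ?thesis using i0 by simp
  qed
  have D: "(\<Phi> has_real_derivative \<psi> t) (at t)" for t
  proof (cases "t < c")
    case True
    have "(\<Phi> has_real_derivative 0) (at t)"
      by (rule has_field_derivative_transform_within_open[OF DERIV_const[of 0], of "{..<c}"]) (use True zl in auto)
    then show ?thesis using z[of t] True by simp
  next
    case False
    have "(\<Phi> has_real_derivative \<psi> t) (at t within {c - 1..t + 1})"
      unfolding \<Phi>_def[abs_def] by (rule integral_has_real_derivative[OF cont]) (use False in auto)
    moreover have "at t within {c - 1..t + 1} = at t"
      using False by (intro at_within_interior) auto
    ultimately show ?thesis by simp
  qed
  show thesis
  proof (rule that)
    show "deriv \<Phi> = \<psi>" using D by (auto intro: DERIV_imp_deriv)
    have "\<Phi> x = 0" if "x \<notin> {c..d}" for x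
      using that by (cases "x < c") (auto simp: zl zr)
    then show "test_function S \<Phi>"
      by (rule test_functionI[OF smooth_antiderivative[OF D \<psi>] _ cd(1)])
  qed
qed

section \<open>The lemma of du Bois-Reymond\<close>

text \<open>The sets over which V integrates to 0 contain the open intervals, a generator stable
  under intersection, and are closed under disjoint unions; the total integral provides complements.
  All Borel sets follow.\<close>

lemma AE_zero_of_interval_integrals:
  fixes V :: "real \<Rightarrow> complex"
  assumes V: "integrable lborel V" and V0: "(\<integral>t. V t \<partial>lborel) = 0"
    and I: "\<And>c d. (LINT t:{c<..<d}|lborel. V t) = 0"
  shows "AE t in lborel. V t = 0"
proof (rule sigma_finite_measure.density_zero[OF lborel.sigma_finite_measure_axioms V])
  fix A :: "real set" assume "A \<in> sets lborel"
  then have A: "A \<in> sigma_sets UNIV (range (\<lambda>(a, b). box a b))"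
    by (simp add: borel_eq_box)
  have S: "sigma_sets UNIV (range (\<lambda>(a, b). box a b)) = sets (borel :: real measure)"
    by (simp add: borel_eq_box)
  have si: "set_integrable lborel B V" if "B \<in> sets borel" for B
    unfolding set_integrable_def using that V by (intro integrable_mult_indicator) auto
  have st: "Int_stable (range (\<lambda>(a, b). box a b :: real set))"
  proof (rule Int_stableI_image)
    fix i j :: "real \<times> real"
    show "\<exists>k\<in>UNIV. (case i of (a, b) \<Rightarrow> box a b) \<inter> (case j of (a, b) \<Rightarrow> box a b) = (case k of (a, b) \<Rightarrow> box a b)"
      by (intro bexI[of _ "(max (fst i) (fst j), min (snd i) (snd j))"]) (auto simp: box_real split: prod.splits)
  qed
  have "range (\<lambda>(a, b). box a b :: real set) \<subseteq> Pow UNIV" by simp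
  from st this A show "(LINT t:A|lborel. V t) = 0"
  proof (induction A rule: sigma_sets_induct_disjoint)
    case (basic A)
    then show ?case using I by (auto simp: box_real)
  next
    case empty
    then show ?case by (simp add: set_lebesgue_integral_def)
  next
    case (compl A)
    then have m: "A \<in> sets borel" unfolding S by simp
    then have "(LINT t:A \<union> - A|lborel. V t) = (LINT t:A|lborel. V t) + (LINT t:- A|lborel. V t)"
      by (intro set_integral_Un si) auto
    then show ?case using compl V0 by (simp add: set_lebesgue_integral_def Compl_eq_Diff_UNIV)
  next
    case (union A)
    then have m: "A i \<in> sets borel" for i unfolding S by auto
    have "(LINT t:(\<Union>i. A i)|lborel. V t) = (\<Sum>i. (LINT t:(A i)|lborel. V t))"
      by (rule lebesgue_integral_countable_add)
         (use union(1) m in \<open>auto intro!: si simp: disjoint_family_on_def\<close>)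
    then show ?case using union by simp
  qed
qed

lemma bump_integral_tendsto:
  fixes V :: "real \<Rightarrow> 'b::{banach, second_countable_topology}"
  assumes V: "integrable lborel V"
  shows "(\<lambda>n. \<integral>t. bump a b (real (Suc n)) t *\<^sub>R V t \<partial>lborel) \<longlonglongrightarrow> (LINT t:{a<..<b}|lborel. V t)"
  unfolding set_lebesgue_integral_def
proof (rule integral_dominated_convergence)
  have [measurable]: "V \<in> borel_measurable borel" using V by auto
  have [measurable]: "bump a b (real (Suc n)) \<in> borel_measurable borel" for n
    by (intro borel_measurable_continuous_onI smooth_continuous smooth_bump) simp
  show "(\<lambda>t. indicat_real {a<..<b} t *\<^sub>R V t) \<in> borel_measurable lborel" by measurable
  show "(\<lambda>t. bump a b (real (Suc n)) t *\<^sub>R V t) \<in> borel_measurable lborel" for n by measurable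
  show "integrable lborel (\<lambda>t. norm (V t))" using V by simp
  show "AE t in lborel. (\<lambda>n. bump a b (real (Suc n)) t *\<^sub>R V t) \<longlonglongrightarrow> indicat_real {a<..<b} t *\<^sub>R V t"
    by (intro AE_I2 tendsto_scaleR bump_tendsto tendsto_const)
  show "AE t in lborel. norm (bump a b (real (Suc n)) t *\<^sub>R V t) \<le> norm (V t)" for n
    by (intro AE_I2) (use bump_bounds[of "real (Suc n)" a b] in \<open>simp add: mult_left_le_one_le\<close>)
qed

lemma smooth_compact_integral:
  assumes \<psi>: "smooth \<psi>" and z: "\<And>x. x \<notin> {c..d} \<Longrightarrow> \<psi> x = 0"
  shows "integrable lborel \<psi>" "(\<integral>t. \<psi> t \<partial>lborel) = integral {c..d} \<psi>"
proof -
  have s: "set_integrable lborel {c..d} \<psi>"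
    by (intro borel_integrable_atLeastAtMost' smooth_continuous[OF \<psi>])
  have e: "indicator {c..d} t *\<^sub>R \<psi> t = \<psi> t" for t using z[of t] by (auto simp: indicator_def)
  show "integrable lborel \<psi>" using s unfolding set_integrable_def e .
  show "(\<integral>t. \<psi> t \<partial>lborel) = integral {c..d} \<psi>"
    using set_borel_integral_eq_integral(2)[OF s] unfolding set_lebesgue_integral_def e .
qed

lemma test_function_integral:
  fixes w :: "real \<Rightarrow> complex"
  assumes z: "\<And>x. x \<notin> {a..b} \<Longrightarrow> \<psi> x = 0" and ab: "{a..b} \<subseteq> S"
  shows "(LINT t:S|lborel. \<psi> t *\<^sub>R w t) = (\<integral>t. \<psi> t *\<^sub>R (indicator {a..b} t *\<^sub>R w t) \<partial>lborel)"
  unfolding set_lebesgue_integral_def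
proof (rule Bochner_Integration.integral_cong)
  fix t show "indicat_real S t *\<^sub>R \<psi> t *\<^sub>R w t = \<psi> t *\<^sub>R indicat_real {a..b} t *\<^sub>R w t"
    using z[of t] ab by (cases "t \<in> {a..b}") (auto simp: indicator_def)
qed simp

lemma bump_integral_nonzero:
  assumes "a < b" "0 < N"
  shows "(\<integral>t. bump a b N t \<partial>lborel) \<noteq> 0"
proof
  note s = smooth_bump[OF assms(2), of a b]
  have z: "bump a b N x = 0" if "x \<notin> {a..b}" for x using that by (auto simp: bump_simps)
  assume "(\<integral>t. bump a b N t \<partial>lborel) = 0"
  then have "integral {a..b} (bump a b N) = 0"
    using smooth_compact_integral(2)[where c=a and d=b, OF s z] by simp
  then have "\<forall>x\<in>{a..b}. bump a b N x = 0"
    using assms by (subst (asm) integral_eq_0_iff) (auto intro: smooth_continuous[OF s] bump_bounds)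
  then have "bump a b N ((a + b) / 2) = 0" using assms by simp
  then show False using assms by (simp add: bump_simps)
qed

lemma test_function_integrable:
  assumes S: "\<And>x y. x \<in> S \<Longrightarrow> y \<in> S \<Longrightarrow> {x..y} \<subseteq> S" "x0 \<in> S" and \<psi>: "test_function S \<psi>"
  shows "integrable lborel \<psi>"
  using test_function_support[OF \<psi> S] smooth_compact_integral(1)[OF test_function_smooth[OF \<psi>]] by metis

lemma test_function_set_integrable:
  fixes w :: "real \<Rightarrow> complex"
  assumes S: "\<And>x y. x \<in> S \<Longrightarrow> y \<in> S \<Longrightarrow> {x..y} \<subseteq> S" "x0 \<in> S"
    and w: "\<And>a b. {a..b} \<subseteq> S \<Longrightarrow> set_integrable lborel {a..b} w" and \<psi>: "test_function S \<psi>"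
  shows "set_integrable lborel S (\<lambda>t. \<psi> t *\<^sub>R w t)"
proof -
  obtain a b where ab: "a \<le> b" "{a..b} \<subseteq> S" and z: "\<And>x. x \<notin> {a..b} \<Longrightarrow> \<psi> x = 0"
    using test_function_support[OF \<psi> S] by metis
  have V: "integrable lborel (\<lambda>t. indicator {a..b} t *\<^sub>R w t)"
    using w[OF ab(2)] unfolding set_integrable_def .
  then have [measurable]: "(\<lambda>t. indicator {a..b} t *\<^sub>R w t) \<in> borel_measurable lborel" by auto
  note c = smooth_continuous[OF test_function_smooth[OF \<psi>]]
  have "compact (\<psi> ` {a..b})" by (intro compact_continuous_image c) auto
  then obtain B where B: "\<And>t. t \<in> {a..b} \<Longrightarrow> \<bar>\<psi> t\<bar> \<le> B"
    by (metis (no_types, lifting) bounded_iff compact_imp_bounded image_eqI real_norm_def)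
  have [measurable]: "\<psi> \<in> borel_measurable borel" by (intro borel_measurable_continuous_onI c)
  have e: "indicat_real S t *\<^sub>R \<psi> t *\<^sub>R w t = \<psi> t *\<^sub>R (indicator {a..b} t *\<^sub>R w t)" for t
    using z[of t] ab(2) by (cases "t \<in> {a..b}") (auto simp: indicator_def)
  show ?thesis
    unfolding set_integrable_def e
    by (rule Bochner_Integration.integrable_bound[OF integrable_scaleR_right[of "\<bar>B\<bar>", OF V]])
       (measurable, use B in \<open>force simp: indicator_def intro!: AE_I2 mult_right_mono\<close>)
qed

lemma test_function_integral_const:
  fixes c :: complex
  assumes S: "\<And>x y. x \<in> S \<Longrightarrow> y \<in> S \<Longrightarrow> {x..y} \<subseteq> S" "x0 \<in> S" and \<psi>: "test_function S \<psi>"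
  shows "(LINT t:S|lborel. \<psi> t *\<^sub>R c) = of_real (\<integral>t. \<psi> t \<partial>lborel) * c"
proof -
  have e: "indicat_real S t *\<^sub>R \<psi> t *\<^sub>R c = \<psi> t *\<^sub>R c" for t
    using test_function_zero[OF \<psi>, of t] by (cases "t \<in> S") auto
  show ?thesis
    unfolding set_lebesgue_integral_def e using test_function_integrable[OF S \<psi>] by (simp add: scaleR_conv_of_real)
qed

text \<open>Subtracting the right multiple of a fixed function of nonzero mass removes the mean, the
  sole obstruction to having a primitive with compact support.\<close>

lemma test_function_mean_zero_part:
  assumes S: "\<And>x y. x \<in> S \<Longrightarrow> y \<in> S \<Longrightarrow> {x..y} \<subseteq> S" "x0 \<in> S"
    and \<psi>: "test_function S \<psi>" and \<psi>0: "test_function S \<psi>0" and I0: "(\<integral>t. \<psi>0 t \<partial>lborel) \<noteq> 0"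
  obtains \<Phi> where "test_function S \<Phi>" "deriv \<Phi> = (\<lambda>x. \<psi> x - (\<integral>t. \<psi> t \<partial>lborel) / (\<integral>t. \<psi>0 t \<partial>lborel) * \<psi>0 x)"
proof -
  obtain c d where cd: "c \<le> d" "{c..d} \<subseteq> S" and z: "\<And>x. x \<notin> {c..d} \<Longrightarrow> \<psi> x = 0"
    using test_function_support[OF \<psi> S] by metis
  obtain c0 d0 where cd0: "c0 \<le> d0" "{c0..d0} \<subseteq> S" and z0: "\<And>x. x \<notin> {c0..d0} \<Longrightarrow> \<psi>0 x = 0"
    using test_function_support[OF \<psi>0 S] by metis
  define l where "l = min c c0" define r where "r = max d d0"
  have lr: "{l..r} \<subseteq> S" "l \<le> r" "{c..d} \<subseteq> {l..r}" "{c0..d0} \<subseteq> {l..r}"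
  proof -
    have "c \<in> S" "d \<in> S" "c0 \<in> S" "d0 \<in> S" using cd cd0 by auto
    then have "l \<in> S" "r \<in> S" unfolding l_def r_def min_def max_def by auto
    then show "{l..r} \<subseteq> S" by (rule S(1))
  qed (use cd cd0 in \<open>auto simp: l_def r_def\<close>)
  define k where "k = (\<integral>t. \<psi> t \<partial>lborel) / (\<integral>t. \<psi>0 t \<partial>lborel)"
  define \<eta> where "\<eta> x = \<psi> x - k * \<psi>0 x" for x
  have \<eta>: "smooth \<eta>" unfolding \<eta>_def by (intro smooth_diff_mult test_function_smooth[OF \<psi>] test_function_smooth[OF \<psi>0])
  have zz: "\<eta> x = 0" if "x \<notin> {l..r}" for x
    using that lr z[of x] z0[of x] unfolding \<eta>_def by auto
  have "integral {l..r} \<eta> = (\<integral>t. \<eta> t \<partial>lborel)"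
    by (rule smooth_compact_integral(2)[symmetric, OF \<eta> zz])
  also have "\<dots> = 0"
    unfolding \<eta>_def using test_function_integrable[OF S \<psi>] test_function_integrable[OF S \<psi>0] I0 by (simp add: k_def)
  finally obtain \<Phi> where "test_function S \<Phi>" "deriv \<Phi> = \<eta>"
    using test_function_antiderivative[OF \<eta> zz lr(1,2)] by blast
  then show thesis unfolding \<eta>_def[abs_def] k_def by (rule that)
qed

text \<open>Derivatives of test functions are the test functions of mean zero. Testing with the
  mean-zero part of an arbitrary one shows that w - c is orthogonal to all of them, and bumps
  approximating indicators turn this into vanishing integrals over intervals.\<close>

lemma du_Bois_Reymond:
  fixes w :: "real \<Rightarrow> complex"
  assumes S: "open S" "\<And>x y. x \<in> S \<Longrightarrow> y \<in> S \<Longrightarrow> {x..y} \<subseteq> S" "x0 \<in> S"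
    and w: "\<And>a b. {a..b} \<subseteq> S \<Longrightarrow> set_integrable lborel {a..b} w"
    and weak: "\<And>\<phi>. test_function S \<phi> \<Longrightarrow> (LINT t:S|lborel. deriv \<phi> t *\<^sub>R w t) = 0"
  shows "\<exists>c. AE t in lborel. t \<in> S \<longrightarrow> w t = c"
proof -
  obtain e where e: "0 < e" "{x0 - e..x0 + e} \<subseteq> S"
    using S(1,3) by (metis cball_eq_atLeastAtMost open_contains_cball)
  have V: "integrable lborel (\<lambda>t. indicator {a..b} t *\<^sub>R w t)" if "{a..b} \<subseteq> S" for a b
    using w[OF that] unfolding set_integrable_def .
  have ci: "set_integrable lborel {a..b} (\<lambda>t. c)" for a b :: real and c :: complex
    unfolding set_integrable_def by (cases "a \<le> b") auto
  have tb: "test_function S (bump a b N)" if "{a..b} \<subseteq> S" "0 < N" for a b N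
    by (rule test_functionI[OF smooth_bump _ that(1)]) (use that in \<open>auto simp: bump_simps\<close>)
  define \<psi>0 where "\<psi>0 = bump (x0 - e) (x0 + e) 1"
  have t0: "test_function S \<psi>0" and I0: "(\<integral>t. \<psi>0 t \<partial>lborel) \<noteq> 0"
    unfolding \<psi>0_def by (rule tb[OF e(2)], simp) (rule bump_integral_nonzero, use e(1) in auto)
  \<comment> \<open>The only constant compatible with the single test function
    \<open>\<psi>0\<close>.\<close>
  define c where "c = (LINT t:S|lborel. \<psi>0 t *\<^sub>R w t) / of_real (\<integral>t. \<psi>0 t \<partial>lborel)"
  have key: "(LINT t:S|lborel. \<psi> t *\<^sub>R (w t - c)) = 0" if \<psi>: "test_function S \<psi>" for \<psi>
  proof -
    define k where "k = (\<integral>t. \<psi> t \<partial>lborel) / (\<integral>t. \<psi>0 t \<partial>lborel)"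
    obtain \<Phi> where \<Phi>: "test_function S \<Phi>" "deriv \<Phi> = (\<lambda>x. \<psi> x - k * \<psi>0 x)"
      unfolding k_def by (rule test_function_mean_zero_part[OF S(2,3) \<psi> t0 I0])
    have "0 = (LINT t:S|lborel. \<psi> t *\<^sub>R w t - k *\<^sub>R (\<psi>0 t *\<^sub>R w t))"
      using weak[OF \<Phi>(1)] unfolding \<Phi>(2) by (simp add: scaleR_diff_left)
    also have "\<dots> = (LINT t:S|lborel. \<psi> t *\<^sub>R w t) - k *\<^sub>R (LINT t:S|lborel. \<psi>0 t *\<^sub>R w t)"
      using set_integral_diff(2)[OF test_function_set_integrable[OF S(2,3) w \<psi>]
          set_integrable_scaleR_right[OF test_function_set_integrable[OF S(2,3) w t0], of k]]
      by (simp only: set_integral_scaleR_right)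
    finally have "(LINT t:S|lborel. \<psi> t *\<^sub>R w t) = of_real (\<integral>t. \<psi> t \<partial>lborel) * c"
      using I0 by (simp add: c_def k_def scaleR_conv_of_real)
    then show ?thesis
      using set_integral_diff(2)[OF test_function_set_integrable[OF S(2,3) w \<psi>] test_function_set_integrable[OF S(2,3) ci \<psi>]]
        test_function_integral_const[OF S(2,3) \<psi>]
      by (simp add: scaleR_diff_right)
  qed
  have zero: "(LINT t:{a<..<b}|lborel. w t - c) = 0" if ab: "{a..b} \<subseteq> S" for a b
  proof -
    let ?v = "\<lambda>t. indicator {a..b} t *\<^sub>R (w t - c)"
    let ?\<psi> = "\<lambda>n. bump a b (real (Suc n))"
    have "integrable lborel ?v"
      using set_integral_diff(1)[OF w[OF ab] ci] unfolding set_integrable_def .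
    from bump_integral_tendsto[OF this, of a b]
    have "(\<lambda>n. \<integral>t. ?\<psi> n t *\<^sub>R ?v t \<partial>lborel) \<longlonglongrightarrow> (LINT t:{a<..<b}|lborel. w t - c)"
      unfolding set_lebesgue_integral_def
      by (rule back_subst[where P="\<lambda>z. _ \<longlonglongrightarrow> z"]) (intro Bochner_Integration.integral_cong, auto simp: indicator_def)
    moreover have "(\<integral>t. ?\<psi> n t *\<^sub>R ?v t \<partial>lborel) = 0" for n
      by (rule trans[OF test_function_integral[OF _ ab, symmetric] key[OF tb[OF ab]]]) (auto simp: bump_simps)
    ultimately show ?thesis by (simp add: LIMSEQ_const_iff)
  qed
  have ae: "AE t in lborel. t \<in> {a<..<b} \<longrightarrow> w t = c" if ab: "{a..b} \<subseteq> S" "a \<le> b" for a b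
  proof -
    let ?V = "\<lambda>t. indicator {a<..<b} t *\<^sub>R (w t - c)"
    have "AE t in lborel. ?V t = 0"
    proof (rule AE_zero_of_interval_integrals)
      show "integrable lborel ?V"
        using set_integrable_subset[OF set_integral_diff(1)[OF w[OF ab(1)] ci], of "{a<..<b}"]
        by (simp add: set_integrable_def less_imp_le subset_eq)
      show "(\<integral>t. ?V t \<partial>lborel) = 0" using zero[OF ab(1)] unfolding set_lebesgue_integral_def .
      show "(LINT t:{p<..<q}|lborel. ?V t) = 0" for p q
      proof -
        have "(LINT t:{p<..<q}|lborel. ?V t) = (LINT t:{max a p<..<min b q}|lborel. w t - c)"
          unfolding set_lebesgue_integral_def by (intro Bochner_Integration.integral_cong) (auto simp: indicator_def)
        also have "\<dots> = 0"
        proof (cases "max a p \<le> min b q")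
          case True
          have "{max a p..min b q} \<subseteq> S" using ab by auto
          then show ?thesis by (rule zero)
        next
          case False
          then have "{max a p<..<min b q} = {}" by auto
          then show ?thesis by (simp add: set_lebesgue_integral_def)
        qed
        finally show ?thesis .
      qed
    qed
    then show ?thesis by eventually_elim (auto simp: indicator_def)
  qed
  \<comment> \<open>Rational compact subintervals are countable and cover the open set, so their
    exceptional null sets can be united.\<close>
  have "AE t in lborel. \<forall>q\<in>{(p, q). p \<in> \<rat> \<and> q \<in> \<rat> \<and> {p..q} \<subseteq> S \<and> p \<le> q}. t \<in> {fst q<..<snd q} \<longrightarrow> w t = c"
  proof (subst AE_ball_countable)
    have "countable (\<rat> \<times> \<rat> :: (real \<times> real) set)" by (intro countable_SIGMA countable_rat)
    then show "countable {(p, q :: real). p \<in> \<rat> \<and> q \<in> \<rat> \<and> {p..q} \<subseteq> S \<and> p \<le> q}"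
      by (rule countable_subset[rotated]) auto
  qed (use ae in auto)
  then have "AE t in lborel. t \<in> S \<longrightarrow> w t = c"
  proof eventually_elim
    case (elim t)
    show ?case
    proof
      assume "t \<in> S"
      then obtain d where d: "0 < d" "{t - d..t + d} \<subseteq> S"
        using S(1) by (metis cball_eq_atLeastAtMost open_contains_cball)
      obtain p where p: "p \<in> \<rat>" "t - d < p" "p < t" using Rats_dense_in_real[of "t - d" t] d by auto
      obtain q where q: "q \<in> \<rat>" "t < q" "q < t + d" using Rats_dense_in_real[of t "t + d"] d by auto
      have "{p..q} \<subseteq> S" using d p q by (auto intro!: subsetD[OF d(2)])
      then show "w t = c" using elim p q by force
    qed
  qed
  then show ?thesis by blast
qed

text \<open>If f differed from k at x, it would differ on a relatively open set, which meets the
  dense open part B in a nonempty open set, hence one of positive measure. Density is what reaches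
  end points such as 0 and 1.\<close>

lemma continuous_AE_const:
  fixes f :: "real \<Rightarrow> 'b::t1_space"
  assumes c: "continuous_on A f" and B: "open B" "B \<subseteq> A" "A \<subseteq> closure B"
    and ae: "AE t in lborel. t \<in> B \<longrightarrow> f t = k" and x: "x \<in> A"
  shows "f x = k"
proof (rule ccontr)
  assume "f x \<noteq> k"
  have "open (- {k})" by (intro open_Compl closed_singleton)
  then obtain U where U: "open U" "U \<inter> A = f -` (- {k}) \<inter> A"
    using c unfolding continuous_on_open_invariant by blast
  have "x \<in> U" using U(2) x \<open>f x \<noteq> k\<close> by blast
  then have ne: "U \<inter> B \<noteq> {}" using U(1) B(3) x open_Int_closure_eq_empty[of U B] by blast
  obtain N where N: "\<And>t. t \<in> space lborel - N \<Longrightarrow> t \<in> B \<longrightarrow> f t = k" "N \<in> null_sets lborel"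
    by (rule AE_E3[OF ae]) (rule that)
  have sub: "U \<inter> B \<subseteq> N"
  proof
    fix t assume t: "t \<in> U \<inter> B"
    then have "f t \<noteq> k" using U(2) B(2) by blast
    then show "t \<in> N" using N(1)[of t] t by auto
  qed
  have "negligible N" using N(2) by (simp add: negligible_iff_null_sets null_sets_completionI)
  from this sub have "negligible (U \<inter> B)" by (rule negligible_subset)
  then show False using open_not_negligible[of "U \<inter> B"] U(1) B(1) ne by (simp add: open_Int)
qed

section \<open>Fourier transforms of \<open>H\<^sup>1\<close> functions\<close>

text \<open>Integration by parts against the indefinite integral of a merely integrable function is
  Fubini's theorem on the triangle.\<close>

lemma integral_mult_indefinite_integral:
  fixes G k K :: "real \<Rightarrow> complex"
  assumes G: "set_integrable lborel {a..b} G" and ab: "a \<le> b"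
    and K: "\<And>t. a \<le> t \<Longrightarrow> t \<le> b \<Longrightarrow> (K has_vector_derivative k t) (at t within {a..b})"
    and k: "continuous_on {a..b} k"
  shows "(LINT t:{a..b}|lborel. k t * (LINT s:{a..t}|lborel. G s))
    = (LINT s:{a..b}|lborel. G s * (K b - K s))"
proof -
  define G0 where "G0 s = indicator {a..b} s *\<^sub>R G s" for s
  define k0 where "k0 t = indicator {a..b} t *\<^sub>R k t" for t
  have G0: "integrable lborel G0" using G unfolding set_integrable_def G0_def .
  have k0: "integrable lborel k0"
    using borel_integrable_atLeastAtMost'[OF k] unfolding set_integrable_def k0_def .
  have [measurable]: "G0 \<in> borel_measurable borel" "k0 \<in> borel_measurable borel" using G0 k0 by auto
  define H where "H t s = (if s \<le> t then k0 t * G0 s else 0)" for t s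
  have H: "integrable (lborel \<Otimes>\<^sub>M lborel) (\<lambda>(t, s). H t s)"
    by (rule Bochner_Integration.integrable_bound[OF lborel_pair.integrable_mult_pair[OF k0 G0]])
       (auto simp: H_def)
  have 1: "(\<integral>s. H t s \<partial>lborel) = indicator {a..b} t *\<^sub>R (k t * (LINT s:{a..t}|lborel. G s))" for t
  proof -
    have "(\<integral>s. H t s \<partial>lborel) = (\<integral>s. k0 t * (indicator {a..t} s *\<^sub>R G s) \<partial>lborel)"
      by (intro Bochner_Integration.integral_cong) (auto simp: H_def k0_def G0_def indicator_def)
    also have "\<dots> = k0 t * (LINT s:{a..t}|lborel. G s)"
      unfolding set_lebesgue_integral_def by (rule Bochner_Integration.integral_mult_right_zero)
    finally show ?thesis by (simp add: k0_def)
  qed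
  have 2: "(\<integral>t. H t s \<partial>lborel) = indicator {a..b} s *\<^sub>R (G s * (K b - K s))" for s
  proof (cases "s \<in> {a..b}")
    case True
    have "(\<integral>t. H t s \<partial>lborel) = (\<integral>t. (indicator {s..b} t *\<^sub>R k t) * G s \<partial>lborel)"
      using True by (intro Bochner_Integration.integral_cong) (auto simp: H_def k0_def G0_def indicator_def)
    also have "\<dots> = (\<integral>t. indicator {s..b} t *\<^sub>R k t \<partial>lborel) * G s"
      by (rule Bochner_Integration.integral_mult_left_zero)
    also have "(\<integral>t. indicator {s..b} t *\<^sub>R k t \<partial>lborel) = K b - K s"
    proof (rule integral_FTC_atLeastAtMost)
      show "continuous_on {s..b} k" by (rule continuous_on_subset[OF k]) (use True in auto)
      show "(K has_vector_derivative k x) (at x within {s..b})" if "s \<le> x" "x \<le> b" for x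
        by (rule has_vector_derivative_within_subset[OF K]) (use True that in auto)
    qed (use True in auto)
    finally show ?thesis using True by simp
  next
    case False
    then have "G0 s = 0" by (simp add: G0_def)
    then have "H t s = 0" for t by (simp add: H_def)
    then show ?thesis using False by simp
  qed
  show ?thesis
    using lborel_pair.Fubini_integral[OF H] unfolding 1 2 set_lebesgue_integral_def by simp
qed

section \<open>Functions with a square integrable weak derivative, and their boundary value\<close>

lemma continuous_on_indefinite_integral:
  fixes G :: "real \<Rightarrow> complex"
  assumes "set_integrable lborel {a..b} G"
  shows "continuous_on {a..b} (\<lambda>t. LINT s:{a..t}|lborel. G s)"
proof -
  have "(LINT s:{a..t}|lborel. G s) = integral {a..t} G" if "t \<in> {a..b}" for t
    by (rule set_borel_integral_eq_integral, rule set_integrable_subset[OF assms]) (use that in auto)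
  then show ?thesis
    by (intro continuous_on_eq[OF indefinite_integral_continuous_1[OF set_borel_integral_eq_integral(1)[OF assms]]]) simp
qed

lemma L2_on_iff:
  assumes "S \<in> sets borel"
  shows "L2_on S f \<longleftrightarrow> (\<lambda>t. indicator S t *\<^sub>R f t) \<in> borel_measurable borel \<and>
    integrable lborel (\<lambda>t. (cmod (indicator S t *\<^sub>R f t))\<^sup>2)"
proof -
  have "(cmod (indicator S t *\<^sub>R f t))\<^sup>2 = indicator S t *\<^sub>R (cmod (f t))\<^sup>2" for t
    by (simp add: indicator_def)
  then show ?thesis unfolding L2_on_def set_borel_measurable_def set_integrable_def by simp
qed

lemma L2_on_half_line_set_integrable:
  assumes "L2_on {0<..} f"
  shows "set_integrable lborel {a..b} (\<lambda>t. indicator {0<..} t *\<^sub>R f t)"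
  unfolding set_integrable_def
  by (rule integrable_L2_interval) (use assms in \<open>auto simp: L2_on_iff\<close>)

text \<open>Integration by parts shows that the primitive u has the same weak derivative G, so F - u
  has weak derivative zero.\<close>

lemma weak_deriv_half_line_primitive:
  fixes F G :: "real \<Rightarrow> complex"
  assumes F: "L2_on {0<..} F" and G: "L2_on {0<..} G" and wd: "is_weak_deriv {0<..} F G"
  defines "G0 \<equiv> \<lambda>t. indicator {0<..} t *\<^sub>R G t"
  shows "\<exists>c. AE t in lborel. t \<in> {0<..} \<longrightarrow> F t = c + (LINT s:{0..t}|lborel. G0 s)"
proof -
  define u where "u t = (LINT s:{0..t}|lborel. G0 s)" for t
  have Gi: "set_integrable lborel {a..b} G0" for a b
    unfolding G0_def by (rule L2_on_half_line_set_integrable[OF G])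
  have uc: "continuous_on {0..b} u" for b
    unfolding u_def by (rule continuous_on_indefinite_integral[OF Gi])
  have ui: "set_integrable lborel {a..b} u" if "{a..b} \<subseteq> {0<..}" for a b
  proof (cases "a \<le> b")
    case True
    show ?thesis by (rule borel_integrable_atLeastAtMost', rule continuous_on_subset[OF uc[of b]])
       (use that True in auto)
  qed simp
  have Fi: "set_integrable lborel {a..b} F" if "{a..b} \<subseteq> {0<..}" for a b
  proof -
    have e: "indicat_real {a..b} t *\<^sub>R indicat_real {0<..} t *\<^sub>R F t = indicat_real {a..b} t *\<^sub>R F t" for t
      using that by (auto simp: indicator_def)
    show ?thesis
      using L2_on_half_line_set_integrable[OF F, of a b] unfolding set_integrable_def e .
  qed
  have "\<exists>c. AE t in lborel. t \<in> {0<..} \<longrightarrow> F t - u t = c"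
  proof (rule du_Bois_Reymond[of "{0<..}" 1])
    show "set_integrable lborel {a..b} (\<lambda>t. F t - u t)" if "{a..b} \<subseteq> {0<..}" for a b
      by (intro set_integral_diff Fi ui that)
    fix \<phi> assume \<phi>: "test_function {0<..} \<phi>"
    note sm = test_function_smooth[OF \<phi>]
    obtain c d where cd: "c \<le> d" "{c..d} \<subseteq> {0<..}" and z: "\<And>x. x \<notin> {c..d} \<Longrightarrow> \<phi> x = 0"
      by (rule test_function_support[OF \<phi>, of 1]) auto
    have z': "deriv \<phi> x = 0" if "x \<notin> {c..d}" for x by (rule deriv_zero_outside[OF z that])
    \<comment> \<open>The test function may be nonzero at d, but it vanishes at d + 1; the upper
      boundary term thereby disappears.\<close>
    define e where "e = d + 1"
    have e: "{c..d} \<subseteq> {0..e}" "0 \<le> e" "\<phi> e = 0" using cd z unfolding e_def by auto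
    have "(LINT t:{0..e}|lborel. of_real (deriv \<phi> t) * u t) = (LINT s:{0..e}|lborel. G0 s * (of_real (\<phi> e) - of_real (\<phi> s)))"
      unfolding u_def
    proof (rule integral_mult_indefinite_integral[OF Gi e(2)])
      show "continuous_on {0..e} (\<lambda>t. complex_of_real (deriv \<phi> t))"
        by (intro continuous_intros smooth_continuous smooth_deriv sm)
      fix t
      have "(\<phi> has_real_derivative deriv \<phi> t) (at t)" by (rule smooth_DERIV[OF sm])
      then show "((\<lambda>t. complex_of_real (\<phi> t)) has_vector_derivative of_real (deriv \<phi> t)) (at t within {0..e})"
        by (intro has_vector_derivative_of_real has_vector_derivative_at_within)
           (simp add: has_real_derivative_iff_has_vector_derivative)
    qed
    also have "\<dots> = - (LINT t:{0<..}|lborel. \<phi> t *\<^sub>R G t)"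
      unfolding set_lebesgue_integral_def e(3)
      by (subst Bochner_Integration.integral_minus[symmetric], intro Bochner_Integration.integral_cong)
         (use z e in \<open>auto simp: G0_def indicator_def scaleR_conv_of_real\<close>)
    also have "(LINT t:{0..e}|lborel. of_real (deriv \<phi> t) * u t) = (LINT t:{0<..}|lborel. deriv \<phi> t *\<^sub>R u t)"
      unfolding set_lebesgue_integral_def
    proof (rule Bochner_Integration.integral_cong)
      fix t show "indicat_real {0..e} t *\<^sub>R (complex_of_real (deriv \<phi> t) * u t) = indicat_real {0<..} t *\<^sub>R deriv \<phi> t *\<^sub>R u t"
        using z'[of t] cd e by (cases "t \<in> {c..d}") (auto simp: indicator_def scaleR_conv_of_real)
    qed simp
    finally have u: "(LINT t:{0<..}|lborel. deriv \<phi> t *\<^sub>R u t) = - (LINT t:{0<..}|lborel. \<phi> t *\<^sub>R G t)" .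
    have F: "(LINT t:{0<..}|lborel. deriv \<phi> t *\<^sub>R F t) = - (LINT t:{0<..}|lborel. \<phi> t *\<^sub>R G t)"
      using wd \<phi> unfolding is_weak_deriv_def by blast
    have bi: "set_integrable lborel {0<..} (\<lambda>t. deriv \<phi> t *\<^sub>R w t)"
      if "\<And>a b. {a..b} \<subseteq> {0<..} \<Longrightarrow> set_integrable lborel {a..b} w" for w :: "real \<Rightarrow> complex"
      by (rule test_function_set_integrable[OF _ _ that test_function_deriv[OF \<phi>], of 1]) auto
    have "(LINT t:{0<..}|lborel. deriv \<phi> t *\<^sub>R (F t - u t)) =
        (LINT t:{0<..}|lborel. deriv \<phi> t *\<^sub>R F t) - (LINT t:{0<..}|lborel. deriv \<phi> t *\<^sub>R u t)"
      unfolding scaleR_diff_right by (rule set_integral_diff(2)[OF bi[OF Fi] bi[OF ui]])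
    then show "(LINT t:{0<..}|lborel. deriv \<phi> t *\<^sub>R (F t - u t)) = 0" using u F by simp
  qed auto
  then obtain c where "AE t in lborel. t \<in> {0<..} \<longrightarrow> F t - u t = c" by blast
  then have "AE t in lborel. t \<in> {0<..} \<longrightarrow> F t = c + u t"
    by eventually_elim (auto simp: algebra_simps)
  then show ?thesis unfolding u_def by blast
qed

text \<open>The definite description is legitimate because two continuous representatives agree
  almost everywhere to the right of 0, hence at 0 by continuity.\<close>

lemma value_at_0_eq:
  assumes G: "continuous_on {0..} G" and ae: "AE t in lborel. 0 < t \<longrightarrow> F t = G t"
  shows "value_at_0 F = G 0"
  unfolding value_at_0_def
proof (rule the_equality)
  show "\<exists>G'. continuous_on {0..} G' \<and> (AE t in lborel. 0 < t \<longrightarrow> F t = G' t) \<and> G' 0 = G 0"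
    using assms by blast
  fix c assume "\<exists>G'. continuous_on {0..} G' \<and> (AE t in lborel. 0 < t \<longrightarrow> F t = G' t) \<and> G' 0 = c"
  then obtain G' where G': "continuous_on {0..} G'" "AE t in lborel. 0 < t \<longrightarrow> F t = G' t" "G' 0 = c" by blast
  have "G' 0 - G 0 = 0"
  proof (rule continuous_AE_const[of "{0..}" "\<lambda>t. G' t - G t" "{0<..}"])
    show "AE t in lborel. t \<in> {0<..} \<longrightarrow> G' t - G t = 0"
      using ae G'(2) by eventually_elim auto
  qed (use G G' in \<open>auto intro: continuous_intros\<close>)
  then show "c = G 0" using G'(3) by simp
qed

text \<open>The primitive is continuous up to 0 and vanishes there, so the integration constant is
  the boundary value, namely 0.\<close>

lemma H1_value_0_primitive:
  assumes F: "H1_half_line F" and v: "value_at_0 F = 0"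
  defines "G \<equiv> \<lambda>t. indicator {0<..} t *\<^sub>R weak_deriv_half_line F t"
  shows "L2_on {0<..} (weak_deriv_half_line F)"
    and "AE t in lborel. 0 < t \<longrightarrow> F t = (LINT s:{0..t}|lborel. G s)"
proof -
  have "L2_on {0<..} (weak_deriv_half_line F) \<and> is_weak_deriv {0<..} F (weak_deriv_half_line F)"
    using F unfolding H1_half_line_def weak_deriv_half_line_def
    by (intro someI_ex[of "\<lambda>G. L2_on {0<..} G \<and> is_weak_deriv {0<..} F G"]) blast
  then have L: "L2_on {0<..} (weak_deriv_half_line F)" and wd: "is_weak_deriv {0<..} F (weak_deriv_half_line F)"
    by auto
  from L show "L2_on {0<..} (weak_deriv_half_line F)" .
  have LF: "L2_on {0<..} F" using F unfolding H1_half_line_def by blast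
  let ?u = "\<lambda>t. LINT s:{0..t}|lborel. G s"
  obtain c where c: "AE t in lborel. t \<in> {0<..} \<longrightarrow> F t = c + ?u t"
    using weak_deriv_half_line_primitive[OF LF L wd] unfolding G_def by blast
  have "continuous_on {0..} (\<lambda>t. c + ?u t)"
  proof (intro continuous_intros)
    show "continuous_on {0..} ?u"
      unfolding continuous_on_eq_continuous_within
    proof
      fix t :: real assume t: "t \<in> {0..}"
      have "continuous_on {0..t + 1} ?u"
        by (rule continuous_on_indefinite_integral) (unfold G_def, rule L2_on_half_line_set_integrable[OF L])
      then have "continuous (at t within {0..t + 1}) ?u"
        using t by (simp add: continuous_on_eq_continuous_within)
      also have "at t within {0..t + 1} = at t within {0..}"
        by (rule at_within_nhd[of t "{..<t + 1}"]) auto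
      finally show "continuous (at t within {0..}) ?u" .
    qed
  qed
  then have "value_at_0 F = c + ?u 0"
    by (rule value_at_0_eq) (use c in auto)
  also have "?u 0 = (\<integral>s. 0 \<partial>(lborel :: real measure))"
    unfolding G_def set_lebesgue_integral_def
    by (intro Bochner_Integration.integral_cong) (auto simp: indicator_def)
  finally have "c = 0" using v by simp
  then show "AE t in lborel. 0 < t \<longrightarrow> F t = ?u t" using c by simp
qed

text \<open>On an interval of length 1 the squared mean is at most the mean square, and the latter
  is a piece of a convergent integral moving off to infinity.\<close>

lemma integral_unit_interval_tendsto_0:
  fixes v :: "real \<Rightarrow> complex"
  assumes [measurable]: "v \<in> borel_measurable borel" and v2: "integrable lborel (\<lambda>t. (cmod (v t))\<^sup>2)"
  shows "(\<lambda>n::nat. \<integral>t. indicator {real n..real n + 1} t * cmod (v t) \<partial>lborel) \<longlonglongrightarrow> 0"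
proof -
  let ?i = "\<lambda>n t. indicator {real n..real n + 1} t :: real"
  define m where "m n = (\<integral>t. ?i n t * cmod (v t) \<partial>lborel)" for n
  define q where "q n = (\<integral>t. ?i n t * (cmod (v t))\<^sup>2 \<partial>lborel)" for n
  have "q \<longlonglongrightarrow> (\<integral>t. 0 \<partial>(lborel :: real measure))"
    unfolding q_def
  proof (rule integral_dominated_convergence[OF _ _ v2])
    show "AE t in lborel. (\<lambda>n. ?i n t * (cmod (v t))\<^sup>2) \<longlonglongrightarrow> 0"
    proof (rule AE_I2)
      fix t :: real
      obtain k :: nat where k: "t < real k" using reals_Archimedean2 by blast
      have "\<forall>\<^sub>F n in sequentially. ?i n t * (cmod (v t))\<^sup>2 = 0"
        using eventually_ge_at_top[of k] by eventually_elim (use k in \<open>auto simp: indicator_def\<close>)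
      then show "(\<lambda>n. ?i n t * (cmod (v t))\<^sup>2) \<longlonglongrightarrow> 0" by (rule tendsto_eventually)
    qed
    show "AE t in lborel. norm (?i n t * (cmod (v t))\<^sup>2) \<le> (cmod (v t))\<^sup>2" for n
      by (intro AE_I2) (auto simp: indicator_def)
  qed measurable
  then have q0: "q \<longlonglongrightarrow> 0" by simp
  have iq: "integrable lborel (\<lambda>t. ?i n t * (cmod (v t))\<^sup>2)" for n
    by (rule Bochner_Integration.integrable_bound[OF v2]) (auto simp: indicator_def)
  have im: "integrable lborel (\<lambda>t. ?i n t * cmod (v t))" for n
    using integrable_norm[OF integrable_L2_interval[OF assms, of "real n" "real n + 1"]] by simp
  have ii: "integrable lborel (?i n)" and i1: "(\<integral>t. ?i n t \<partial>lborel) = 1" for n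
    by (auto intro: integrable_real_indicator)
  \<comment> \<open>Nonnegativity of the variance of |v| on the unit interval.\<close>
  have mq: "(m n)\<^sup>2 \<le> q n" for n
  proof -
    have "0 \<le> (\<integral>t. ?i n t * (cmod (v t) - m n)\<^sup>2 \<partial>lborel)"
      by (intro Bochner_Integration.integral_nonneg) simp
    also have "\<dots> = (\<integral>t. ?i n t * (cmod (v t))\<^sup>2 - 2 * m n * (?i n t * cmod (v t)) + (m n)\<^sup>2 * ?i n t \<partial>lborel)"
      by (intro Bochner_Integration.integral_cong) (auto simp: power2_eq_square algebra_simps)
    also have "\<dots> = q n - 2 * m n * m n + (m n)\<^sup>2 * 1"
      using iq[of n] im[of n] ii[of n] i1[of n] by (simp add: q_def m_def)
    finally show ?thesis by (simp add: power2_eq_square)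
  qed
  have "(\<lambda>n. (m n)\<^sup>2) \<longlonglongrightarrow> 0"
    by (rule tendsto_sandwich[OF _ _ tendsto_const q0]) (use mq in auto)
  then have "(\<lambda>n. sqrt ((m n)\<^sup>2)) \<longlonglongrightarrow> sqrt 0" by (intro tendsto_intros)
  then have "m \<longlonglongrightarrow> 0" by (simp add: tendsto_rabs_zero_iff)
  then show ?thesis unfolding m_def .
qed

text \<open>Integrating \<open>\<bar>u n\<bar> \<le> \<bar>u t\<bar> + \<integral>\<^sub>n\<^sup>t \<bar>u'\<bar>\<close> over \<open>t \<in> [n, n + 1]\<close>.\<close>

lemma primitive_tendsto_0:
  fixes f g :: "real \<Rightarrow> complex"
  assumes f[measurable]: "f \<in> borel_measurable borel" and f2: "integrable lborel (\<lambda>t. (cmod (f t))\<^sup>2)"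
    and g[measurable]: "g \<in> borel_measurable borel" and g2: "integrable lborel (\<lambda>t. (cmod (g t))\<^sup>2)"
    and fg: "AE t in lborel. 0 < t \<longrightarrow> f t = (LINT s:{0..t}|lborel. g s)"
  shows "(\<lambda>n::nat. LINT s:{0..real n}|lborel. g s) \<longlonglongrightarrow> 0"
proof (rule Lim_null_comparison)
  define u where "u t = (LINT s:{0..t}|lborel. g s)" for t
  let ?i = "\<lambda>n t. indicator {real n..real n + 1} t :: real"
  let ?m = "\<lambda>v n. \<integral>t. ?i n t * cmod (v t) \<partial>lborel"
  have gi: "set_integrable lborel {a..b} g" for a b
    unfolding set_integrable_def by (rule integrable_L2_interval[OF g g2])
  have im: "integrable lborel (\<lambda>t. ?i n t * cmod (v t))"
    if "v \<in> borel_measurable borel" "integrable lborel (\<lambda>t. (cmod (v t))\<^sup>2)" for n and v :: "real \<Rightarrow> complex"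
    using integrable_norm[OF integrable_L2_interval[OF that, of "real n" "real n + 1"]] by simp
  have ii: "integrable lborel (?i n)" and i1: "(\<integral>t. ?i n t \<partial>lborel) = 1" for n
    by (auto intro: integrable_real_indicator)
  have gi': "integrable lborel (\<lambda>t. indicator {a<..b} t *\<^sub>R g t)" for a b
  proof -
    have "set_integrable lborel {a<..b} g" by (rule set_integrable_subset[OF gi[of a b]]) auto
    then show ?thesis unfolding set_integrable_def .
  qed
  have le: "cmod (u (real n)) \<le> cmod (u t) + ?m g n" if t: "t \<in> {real n..real n + 1}" for n t
  proof -
    have "u t = (\<integral>s. indicator {0..real n} s *\<^sub>R g s + indicator {real n<..t} s *\<^sub>R g s \<partial>lborel)"
      unfolding u_def set_lebesgue_integral_def
      by (intro Bochner_Integration.integral_cong) (use t in \<open>auto simp: indicator_def\<close>)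
    also have "\<dots> = u (real n) + (LINT s:{real n<..t}|lborel. g s)"
      unfolding u_def set_lebesgue_integral_def
      by (rule Bochner_Integration.integral_add[OF gi[unfolded set_integrable_def] gi'])
    finally have e: "u (real n) = u t - (LINT s:{real n<..t}|lborel. g s)" by simp
    have "cmod (LINT s:{real n<..t}|lborel. g s) \<le> (\<integral>s. cmod (indicator {real n<..t} s *\<^sub>R g s) \<partial>lborel)"
      unfolding set_lebesgue_integral_def by (rule integral_norm_bound)
    also have "\<dots> \<le> ?m g n"
      using t by (intro integral_mono integrable_norm[OF gi'] im[OF g g2]) (auto simp: indicator_def)
    finally show ?thesis unfolding e using norm_triangle_ineq4[of "u t" "LINT s:{real n<..t}|lborel. g s"] by linarith
  qed
  have "cmod (u (real n)) \<le> ?m f n + ?m g n" for n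
  proof -
    have "cmod (u (real n)) = (\<integral>t. ?i n t * cmod (u (real n)) \<partial>lborel)" using i1 by simp
    also have "\<dots> \<le> (\<integral>t. ?i n t * cmod (f t) + ?i n t * ?m g n \<partial>lborel)"
    proof (rule integral_mono_AE)
      show "AE t in lborel. ?i n t * cmod (u (real n)) \<le> ?i n t * cmod (f t) + ?i n t * ?m g n"
        using fg AE_lborel_singleton[of 0]
      proof eventually_elim
        case (elim t)
        show ?case
        proof (cases "t \<in> {real n..real n + 1}")
          case True
          then have "f t = u t" using elim unfolding u_def by auto
          then show ?thesis using le[OF True] True by simp
        qed simp
      qed
    qed (use ii im[OF f f2] in auto)
    also have "\<dots> = ?m f n + ?m g n" using ii[of n] i1[of n] im[OF f f2, of n] by simp
    finally show ?thesis .
  qed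
  then show "\<forall>\<^sub>F n in sequentially. norm (LINT s:{0..real n}|lborel. g s) \<le> ?m f n + ?m g n"
    unfolding u_def by simp
  show "(\<lambda>n. ?m f n + ?m g n) \<longlonglongrightarrow> 0"
    using tendsto_add[OF integral_unit_interval_tendsto_0[OF f f2] integral_unit_interval_tendsto_0[OF g g2]] by simp
qed

text \<open>There is no boundary term at 0 because the primitive starts from 0. The term at n has a
  modulus that does not depend on \<omega>.\<close>

lemma truncated_fourier_of_primitive:
  fixes F g :: "real \<Rightarrow> complex"
  assumes g[measurable]: "g \<in> borel_measurable borel" and g2: "integrable lborel (\<lambda>t. (cmod (g t))\<^sup>2)"
    and F: "(\<lambda>t. zero_extension F t) \<in> borel_measurable borel"
    and Fg: "AE t in lborel. 0 < t \<longrightarrow> F t = (LINT s:{0..t}|lborel. g s)"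
  shows "\<i> * of_real \<omega> * (LINT t:{- real n..real n}|lborel. fourier_kernel \<omega> t * zero_extension F t)
    = fourier_L1 (\<lambda>t. indicator {0..real n} t *\<^sub>R g t) \<omega> - fourier_kernel \<omega> n * (LINT s:{0..real n}|lborel. g s)"
proof -
  let ?e = "\<lambda>t. fourier_kernel \<omega> t"
  let ?u = "\<lambda>t. LINT s:{0..t}|lborel. g s"
  have gi: "set_integrable lborel {a..b} g" for a b
    unfolding set_integrable_def by (rule integrable_L2_interval[OF g g2])
  have gi0: "integrable lborel (\<lambda>t. indicator {0..real n} t *\<^sub>R g t)"
    by (rule integrable_L2_interval[OF g g2])
  note [measurable] = F
  have um: "(\<lambda>t. indicator {0..real n} t *\<^sub>R (?e t * ?u t)) \<in> borel_measurable borel"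
    by (intro borel_measurable_continuous_on_indicator continuous_intros continuous_on_indefinite_integral gi) auto
  have "(\<integral>t. indicat_real {- real n..real n} t *\<^sub>R (?e t * zero_extension F t) \<partial>lborel)
      = (\<integral>t. indicat_real {0..real n} t *\<^sub>R (?e t * ?u t) \<partial>lborel)"
  proof (rule integral_cong_AE)
    show "AE t in lborel. indicat_real {- real n..real n} t *\<^sub>R (?e t * zero_extension F t) = indicat_real {0..real n} t *\<^sub>R (?e t * ?u t)"
      using Fg AE_lborel_singleton[of 0] by eventually_elim (auto simp: indicator_def zero_extension_def)
  qed (use um in auto)
  then have "(LINT t:{- real n..real n}|lborel. ?e t * zero_extension F t) = (LINT t:{0..real n}|lborel. ?e t * ?u t)"
    unfolding set_lebesgue_integral_def .
  also have "\<i> * of_real \<omega> * \<dots> = (LINT t:{0..real n}|lborel. (\<i> * of_real \<omega> * ?e t) * ?u t)"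
    by (simp add: mult.assoc)
  also have "\<dots> = (LINT s:{0..real n}|lborel. g s * (- ?e (real n) - - ?e s))"
  \<comment> \<open>The antiderivative of i\<omega> exp(-i\<omega>t) is -exp(-i\<omega>t), so K(n) -
    K(s) splits into the transform and the boundary term.\<close>
  proof (rule integral_mult_indefinite_integral[OF gi, where K="\<lambda>t. - ?e t" and k="\<lambda>t. \<i> * of_real \<omega> * ?e t"])
    show "continuous_on {0..real n} (\<lambda>t. \<i> * of_real \<omega> * ?e t)" by (intro continuous_intros)
    fix t
    have "((\<lambda>z. - exp (- (\<i> * of_real \<omega> * z))) has_field_derivative (\<i> * of_real \<omega> * ?e t)) (at (of_real t))"
      by (auto intro!: derivative_eq_intros)
    from has_vector_derivative_real_field[OF this]
    show "((\<lambda>t. - ?e t) has_vector_derivative \<i> * of_real \<omega> * ?e t) (at t within {0..real n})" .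
  qed simp
  also have "\<dots> = (\<integral>s. ?e s * (indicator {0..real n} s *\<^sub>R g s) - ?e (real n) * (indicator {0..real n} s *\<^sub>R g s) \<partial>lborel)"
    unfolding set_lebesgue_integral_def
    by (intro Bochner_Integration.integral_cong) (auto simp: algebra_simps)
  also have "\<dots> = fourier_L1 (\<lambda>t. indicator {0..real n} t *\<^sub>R g t) \<omega> - ?e (real n) * ?u (real n)"
    unfolding fourier_L1_def set_lebesgue_integral_def
    using Bochner_Integration.integral_diff[OF integrable_fourier_kernel[OF gi0, of \<omega>] integrable_mult_right[OF gi0, of "?e (real n)"]]
    by (simp only: Bochner_Integration.integral_mult_right_zero)
  finally show ?thesis .
qed

text \<open>The boundary term tends to 0 for each \<omega>, but, having constant modulus, it need
  not be square integrable over the line. It is therefore separated pointwise, at the cost of a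
  factor 2, and discarded in the limit before Fatou's lemma is applied. Together with Plancherel
  this gives 4 * pi.\<close>

lemma weighted_fourier_bound:
  fixes F g h :: "real \<Rightarrow> complex"
  assumes g[measurable]: "g \<in> borel_measurable borel" and g2: "integrable lborel (\<lambda>t. (cmod (g t))\<^sup>2)"
    and F: "(\<lambda>t. zero_extension F t) \<in> borel_measurable borel"
    and F2: "integrable lborel (\<lambda>t. (cmod (zero_extension F t))\<^sup>2)"
    and Fg: "AE t in lborel. 0 < t \<longrightarrow> F t = (LINT s:{0..t}|lborel. g s)"
    and h: "is_fourier_L2 (zero_extension F) h"
  shows "(\<integral>\<^sup>+\<omega>. ennreal (\<omega>\<^sup>2 * (cmod (h \<omega>))\<^sup>2) \<partial>lborel) \<le> ennreal (4 * pi) * L2_sq lborel g"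
proof -
  note [measurable] = F
  let ?T = "\<lambda>n \<omega>. LINT t:{- real n..real n}|lborel. fourier_kernel \<omega> t * zero_extension F t"
  let ?u = "\<lambda>n. LINT s:{0..real n}|lborel. g s"
  let ?G = "\<lambda>n. fourier_L1 (\<lambda>t. indicator {0..real n} t *\<^sub>R g t)"
  have hm[measurable]: "h \<in> borel_measurable borel" using h unfolding is_fourier_L2_def by auto
  have Tm: "?T n \<in> borel_measurable lborel" for n
    unfolding set_lebesgue_integral_def by measurable
  have gi: "integrable lborel (\<lambda>t. indicator {a..b} t *\<^sub>R g t)" for a b
    by (rule integrable_L2_interval[OF g g2])
  have Gm[measurable]: "?G n \<in> borel_measurable borel" for n by (rule fourier_L1_measurable) measurable
  \<comment> \<open>The truncated transforms converge to h in L2, so pointwise convergence is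
    available along a subsequence.\<close>
  have "\<exists>r::nat \<Rightarrow> nat. strict_mono r \<and> (AE \<omega> in lborel. (\<lambda>n. ?T (r n) \<omega>) \<longlonglongrightarrow> h \<omega>)"
    by (rule L2_convergent_AE_subseq[OF Tm]) (use h in \<open>auto simp: is_fourier_L2_def\<close>)
  then obtain r :: "nat \<Rightarrow> nat" where r: "strict_mono r" and ae: "AE \<omega> in lborel. (\<lambda>n. ?T (r n) \<omega>) \<longlonglongrightarrow> h \<omega>"
    by blast
  have u0: "?u \<longlonglongrightarrow> 0"
  proof (rule primitive_tendsto_0[OF F F2 g g2])
    show "AE t in lborel. 0 < t \<longrightarrow> zero_extension F t = (LINT s:{0..t}|lborel. g s)"
      using Fg by eventually_elim (auto simp: zero_extension_def)
  qed
  have ur: "(\<lambda>n. ?u (r n)) \<longlonglongrightarrow> 0" using LIMSEQ_subseq_LIMSEQ[OF u0 r] by (simp add: o_def)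
  have "(\<integral>\<^sup>+\<omega>. ennreal (\<omega>\<^sup>2 * (cmod (h \<omega>))\<^sup>2) \<partial>lborel) \<le> (\<integral>\<^sup>+\<omega>. liminf (\<lambda>n. ennreal (2 * (cmod (?G (r n) \<omega>))\<^sup>2)) \<partial>lborel)"
  proof (rule nn_integral_mono_AE)
    show "AE \<omega> in lborel. ennreal (\<omega>\<^sup>2 * (cmod (h \<omega>))\<^sup>2) \<le> liminf (\<lambda>n. ennreal (2 * (cmod (?G (r n) \<omega>))\<^sup>2))"
      using ae
    proof eventually_elim
      case (elim \<omega>)
      let ?x = "\<lambda>n. (cmod (\<i> * of_real \<omega> * ?T (r n) \<omega>))\<^sup>2 - 2 * (cmod (?u (r n)))\<^sup>2"
      have "(\<lambda>n. ennreal (?x n)) \<longlonglongrightarrow> ennreal ((cmod (\<i> * of_real \<omega> * h \<omega>))\<^sup>2 - 2 * (cmod 0)\<^sup>2)"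
        by (intro tendsto_intros elim ur)
      from lim_imp_Liminf[OF _ this] have "ennreal (\<omega>\<^sup>2 * (cmod (h \<omega>))\<^sup>2) = liminf (\<lambda>n. ennreal (?x n))"
        by (simp add: norm_mult power_mult_distrib)
      also have "\<dots> \<le> liminf (\<lambda>n. ennreal (2 * (cmod (?G (r n) \<omega>))\<^sup>2))"
      proof (intro Liminf_mono always_eventually allI ennreal_leI)
        fix n
        show "?x n \<le> 2 * (cmod (?G (r n) \<omega>))\<^sup>2"
          unfolding truncated_fourier_of_primitive[OF g g2 F Fg]
          using cmod_add_sq_le[of "?G (r n) \<omega>" "- (fourier_kernel \<omega> (r n) * ?u (r n))"]
          by (simp add: norm_mult)
      qed
      finally show ?case .
    qed
  qed
  also have "\<dots> \<le> liminf (\<lambda>n. \<integral>\<^sup>+\<omega>. ennreal (2 * (cmod (?G (r n) \<omega>))\<^sup>2) \<partial>lborel)"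
    by (rule nn_integral_liminf) measurable
  also have "\<dots> \<le> ennreal (4 * pi) * L2_sq lborel g"
  proof (intro Liminf_le always_eventually allI)
    fix n
    have "(\<integral>\<^sup>+\<omega>. ennreal (2 * (cmod (?G (r n) \<omega>))\<^sup>2) \<partial>lborel) = 2 * L2_sq lborel (\<lambda>\<omega>. ?G (r n) \<omega>)"
      by (simp add: ennreal_mult nn_integral_cmult)
    also have "\<dots> \<le> 2 * (ennreal (2 * pi) * L2_sq lborel (\<lambda>t. indicator {0..real (r n)} t *\<^sub>R g t))"
      by (intro mult_left_mono plancherel_le gi) auto
    also have "\<dots> \<le> 2 * (ennreal (2 * pi) * L2_sq lborel g)"
      by (intro mult_left_mono nn_integral_mono) (auto simp: indicator_def)
    also have "\<dots> = ennreal 2 * ennreal (2 * pi) * L2_sq lborel g"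
      by (simp add: mult.assoc)
    also have "ennreal 2 * ennreal (2 * pi) = ennreal (4 * pi)"
      by (subst ennreal_mult[symmetric]) auto
    finally show "(\<integral>\<^sup>+\<omega>. ennreal (2 * (cmod (?G (r n) \<omega>))\<^sup>2) \<partial>lborel) \<le> ennreal (4 * pi) * L2_sq lborel g" .
  qed auto
  finally show ?thesis .
qed

section \<open>Green functions\<close>

lemma smooth_DERIV_within:
  assumes "smooth \<phi>"
  shows "(\<phi> has_real_derivative deriv \<phi> x) (at x within A)"
  using smooth_DERIV[OF assms] by (rule has_field_derivative_at_within)

lemma LINT_test_function:
  fixes w :: "real \<Rightarrow> complex"
  assumes \<phi>: "test_function {0<..<1} \<phi>" and w: "continuous_on {0..1} w"
  shows "(LINT t:{0<..<1}|lborel. \<phi> t *\<^sub>R w t) = integral {0..1} (\<lambda>t. \<phi> t *\<^sub>R w t)"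
    and "(\<lambda>t. \<phi> t *\<^sub>R w t) integrable_on {0..1}"
proof -
  have c: "continuous_on {0..1} (\<lambda>t. \<phi> t *\<^sub>R w t)"
    by (intro continuous_intros smooth_continuous[OF test_function_smooth[OF \<phi>]] w)
  have "(LINT t:{0<..<1}|lborel. \<phi> t *\<^sub>R w t) = (LINT t:{0..1}|lborel. \<phi> t *\<^sub>R w t)"
    unfolding set_lebesgue_integral_def
  proof (rule Bochner_Integration.integral_cong)
    fix t show "indicat_real {0<..<1} t *\<^sub>R \<phi> t *\<^sub>R w t = indicat_real {0..1} t *\<^sub>R \<phi> t *\<^sub>R w t"
      using test_function_zero[OF \<phi>, of t] by (cases "t \<in> {0<..<1}") (auto simp: indicator_def)
  qed simp
  also have "\<dots> = integral {0..1} (\<lambda>t. \<phi> t *\<^sub>R w t)"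
    by (rule set_borel_integral_eq_integral(2)[OF borel_integrable_atLeastAtMost'[OF c]])
  finally show "(LINT t:{0<..<1}|lborel. \<phi> t *\<^sub>R w t) = integral {0..1} (\<lambda>t. \<phi> t *\<^sub>R w t)" .
  show "(\<lambda>t. \<phi> t *\<^sub>R w t) integrable_on {0..1}" by (rule integrable_continuous_real[OF c])
qed

lemma test_function_by_parts:
  fixes P p :: "real \<Rightarrow> complex"
  assumes \<phi>: "test_function {0<..<1} \<phi>"
    and P: "\<And>x. x \<in> {0..1} \<Longrightarrow> (P has_vector_derivative p x) (at x within {0..1})"
    and p: "continuous_on {0..1} p"
  shows "integral {0..1} (\<lambda>t. deriv \<phi> t *\<^sub>R P t) = - integral {0..1} (\<lambda>t. \<phi> t *\<^sub>R p t)"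
proof -
  note sm = test_function_smooth[OF \<phi>]
  have "((\<lambda>t. \<phi> t *\<^sub>R p t + deriv \<phi> t *\<^sub>R P t) has_integral (\<phi> 1 *\<^sub>R P 1 - \<phi> 0 *\<^sub>R P 0)) {0..1}"
    by (intro fundamental_theorem_of_calculus has_vector_derivative_scaleR P
        smooth_DERIV_within sm) auto
  then have "integral {0..1} (\<lambda>t. \<phi> t *\<^sub>R p t + deriv \<phi> t *\<^sub>R P t) = 0"
    using test_function_zero[OF \<phi>, of 0] test_function_zero[OF \<phi>, of 1] by (simp add: integral_unique)
  moreover have "continuous_on {0..1} P"
    using P has_vector_derivative_continuous by (metis continuous_on_eq_continuous_within)
  ultimately show ?thesis
    using LINT_test_function(2)[OF \<phi> p] LINT_test_function(2)[OF test_function_deriv[OF \<phi>], of P]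
    by (simp add: Henstock_Kurzweil_Integration.integral_add add_eq_0_iff)
qed

text \<open>If \<Phi> is the primitive of the mean-zero part of \<psi>, its second derivative is the
  derivative of \<psi> minus \<kappa> times that of \<open>\<psi>0\<close>. So e acts on derivatives
  of test functions like a linear function, and du Bois-Reymond applies once that function is
  removed.\<close>

lemma weak_second_derivative_zero:
  fixes e :: "real \<Rightarrow> complex"
  assumes e: "continuous_on {0..1} e"
    and weak: "\<And>\<phi>. test_function {0<..<1} \<phi> \<Longrightarrow> integral {0..1} (\<lambda>t. deriv (deriv \<phi>) t *\<^sub>R e t) = 0"
  shows "\<exists>c k. \<forall>x\<in>{0..1}. e x = c + k * of_real x"
proof -
  have S: "{x..y} \<subseteq> {0<..<1::real}" if "x \<in> {0<..<1}" "y \<in> {0<..<1}" for x y using that by auto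
  have S': "1 / 2 \<in> {0<..<1::real}" by simp
  define \<psi>0 where "\<psi>0 = bump (1/4) (3/4) 1"
  have t0: "test_function {0<..<1} \<psi>0"
    unfolding \<psi>0_def by (rule test_functionI[where c="1/4" and d="3/4", OF smooth_bump]) (auto simp: bump_simps)
  define I0 where "I0 = (\<integral>t. \<psi>0 t \<partial>lborel)"
  have I0: "I0 \<noteq> 0" unfolding I0_def \<psi>0_def by (rule bump_integral_nonzero) auto
  \<comment> \<open>By parts this is minus the slope of e weighted by \<open>\<psi>0\<close>; hence
    e(t) + k t is the combination that should be constant.\<close>
  define k where "k = integral {0..1} (\<lambda>t. deriv \<psi>0 t *\<^sub>R e t) / of_real I0"
  have key: "integral {0..1} (\<lambda>t. deriv \<psi> t *\<^sub>R (e t + k * of_real t)) = 0" if \<psi>: "test_function {0<..<1} \<psi>" for \<psi>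
  proof -
    note s = test_function_smooth[OF \<psi>]
    define \<kappa> where "\<kappa> = (\<integral>t. \<psi> t \<partial>lborel) / I0"
    obtain \<Phi> where \<Phi>: "test_function {0<..<1} \<Phi>" "deriv \<Phi> = (\<lambda>x. \<psi> x - \<kappa> * \<psi>0 x)"
      unfolding \<kappa>_def I0_def
      by (rule test_function_mean_zero_part[OF S S' \<psi> t0 I0[unfolded I0_def]])
    have d\<eta>: "deriv (\<lambda>x. \<psi> x - \<kappa> * \<psi>0 x) t = deriv \<psi> t - \<kappa> * deriv \<psi>0 t" for t
      by (intro DERIV_imp_deriv derivative_intros DERIV_cmult smooth_DERIV s test_function_smooth[OF t0])
    have i1: "(\<lambda>t. deriv \<psi> t *\<^sub>R e t) integrable_on {0..1}" "(\<lambda>t. deriv \<psi>0 t *\<^sub>R e t) integrable_on {0..1}"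
      using LINT_test_function(2)[OF test_function_deriv[OF \<psi>] e] LINT_test_function(2)[OF test_function_deriv[OF t0] e] by auto
    have "0 = integral {0..1} (\<lambda>t. deriv \<psi> t *\<^sub>R e t - \<kappa> *\<^sub>R (deriv \<psi>0 t *\<^sub>R e t))"
      using weak[OF \<Phi>(1)] unfolding \<Phi>(2) d\<eta> by (simp add: scaleR_diff_left)
    also have "\<dots> = integral {0..1} (\<lambda>t. deriv \<psi> t *\<^sub>R e t) - \<kappa> *\<^sub>R integral {0..1} (\<lambda>t. deriv \<psi>0 t *\<^sub>R e t)"
      using Henstock_Kurzweil_Integration.integral_diff[OF i1(1) integrable_cmul[OF i1(2), of \<kappa>]]
      by (simp only: Henstock_Kurzweil_Integration.integral_cmul)
    finally have 1: "integral {0..1} (\<lambda>t. deriv \<psi> t *\<^sub>R e t) = of_real (\<integral>t. \<psi> t \<partial>lborel) * k"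
      using I0 by (simp add: k_def \<kappa>_def scaleR_conv_of_real)
    have c1: "continuous_on {0..1} (\<lambda>t. k * complex_of_real t)" by (intro continuous_intros)
    have "integral {0..1} (\<lambda>t. deriv \<psi> t *\<^sub>R (k * of_real t)) = - integral {0..1} (\<lambda>t. \<psi> t *\<^sub>R k)"
      by (rule test_function_by_parts[OF \<psi>])
         (auto intro!: derivative_eq_intros has_vector_derivative_real_field)
    also have "integral {0..1} (\<lambda>t. \<psi> t *\<^sub>R k) = (LINT t:{0<..<1}|lborel. \<psi> t *\<^sub>R k)"
      by (rule LINT_test_function(1)[OF \<psi>, symmetric]) (intro continuous_intros)
    also have "\<dots> = of_real (\<integral>t. \<psi> t \<partial>lborel) * k" by (rule test_function_integral_const[OF S S' \<psi>])
    finally have 2: "integral {0..1} (\<lambda>t. deriv \<psi> t *\<^sub>R (k * of_real t)) = - (of_real (\<integral>t. \<psi> t \<partial>lborel) * k)" .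
    show ?thesis
      using Henstock_Kurzweil_Integration.integral_add[OF i1(1) LINT_test_function(2)[OF test_function_deriv[OF \<psi>] c1]] 1 2
      by (simp add: scaleR_add_right)
  qed
  have c2: "continuous_on {0..1} (\<lambda>t. e t + k * complex_of_real t)" by (intro continuous_intros e)
  have "\<exists>c. AE t in lborel. t \<in> {0<..<1} \<longrightarrow> e t + k * of_real t = c"
  proof (rule du_Bois_Reymond[of "{0<..<1}" "1/2"])
    show "set_integrable lborel {a..b} (\<lambda>t. e t + k * of_real t)" if ab: "{a..b} \<subseteq> {0<..<1}" for a b
    proof (rule borel_integrable_atLeastAtMost', rule continuous_on_subset[OF c2])
      show "{a..b} \<subseteq> {0..1}" using ab by (auto simp: subset_eq less_imp_le)
    qed
    show "(LINT t:{0<..<1}|lborel. deriv \<phi> t *\<^sub>R (e t + k * of_real t)) = 0" if "test_function {0<..<1} \<phi>" for \<phi>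
      using key[OF that] LINT_test_function(1)[OF test_function_deriv[OF that] c2] by simp
  qed auto
  then obtain c where c: "AE t in lborel. t \<in> {0<..<1} \<longrightarrow> e t + k * of_real t = c" by blast
  have "e x + k * of_real x = c" if "x \<in> {0..1}" for x
    by (rule continuous_AE_const[OF c2 _ _ _ c that]) auto
  then have "\<forall>x\<in>{0..1}. e x = c + (- k) * of_real x" by (simp add: eq_diff_eq)
  then show ?thesis by blast
qed

text \<open>Integrating \<mu> d twice gives a classical function with the same weak second
  derivative as d; the two then differ by an affine function.\<close>

lemma weak_ode_classical:
  fixes d :: "real \<Rightarrow> complex"
  assumes d: "continuous_on {0..1} d"
    and weak: "\<And>\<phi>. test_function {0<..<1} \<phi> \<Longrightarrow>
      integral {0..1} (\<lambda>t. deriv (deriv \<phi>) t *\<^sub>R d t) = \<mu> * integral {0..1} (\<lambda>t. \<phi> t *\<^sub>R d t)"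
  shows "\<exists>d1. (\<forall>x\<in>{0..1}. (d has_vector_derivative d1 x) (at x within {0..1})) \<and>
    (\<forall>x\<in>{0..1}. (d1 has_vector_derivative \<mu> * d x) (at x within {0..1}))"
proof -
  define D1 where "D1 x = integral {0..x} (\<lambda>t. \<mu> * d t)" for x
  have md: "continuous_on {0..1} (\<lambda>t. \<mu> * d t)" by (intro continuous_intros d)
  have D1: "(D1 has_vector_derivative \<mu> * d x) (at x within {0..1})" if "x \<in> {0..1}" for x
    unfolding D1_def by (rule integral_has_vector_derivative[OF md that])
  have cD1: "continuous_on {0..1} D1"
    using D1 has_vector_derivative_continuous by (metis continuous_on_eq_continuous_within)
  define D2 where "D2 x = integral {0..x} D1" for x
  have D2: "(D2 has_vector_derivative D1 x) (at x within {0..1})" if "x \<in> {0..1}" for x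
    unfolding D2_def by (rule integral_has_vector_derivative[OF cD1 that])
  have cD2: "continuous_on {0..1} D2"
    using D2 has_vector_derivative_continuous by (metis continuous_on_eq_continuous_within)
  have "\<exists>c k. \<forall>x\<in>{0..1}. d x - D2 x = c + k * of_real x"
  proof (rule weak_second_derivative_zero)
    show "continuous_on {0..1} (\<lambda>x. d x - D2 x)" by (intro continuous_intros d cD2)
    fix \<phi> assume \<phi>: "test_function {0<..<1} \<phi>"
    note \<phi>' = test_function_deriv[OF \<phi>] note \<phi>'' = test_function_deriv[OF \<phi>']
    have "integral {0..1} (\<lambda>t. deriv (deriv \<phi>) t *\<^sub>R d t) = integral {0..1} (\<lambda>t. \<phi> t *\<^sub>R (\<mu> * d t))"
      unfolding weak[OF \<phi>] by (simp flip: Henstock_Kurzweil_Integration.integral_mult_right)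
    also have "\<dots> = - integral {0..1} (\<lambda>t. deriv \<phi> t *\<^sub>R D1 t)"
      using test_function_by_parts[OF \<phi> D1 md] by simp
    also have "\<dots> = integral {0..1} (\<lambda>t. deriv (deriv \<phi>) t *\<^sub>R D2 t)"
      using test_function_by_parts[OF \<phi>' D2 cD1] by simp
    finally show "integral {0..1} (\<lambda>t. deriv (deriv \<phi>) t *\<^sub>R (d t - D2 t)) = 0"
      using Henstock_Kurzweil_Integration.integral_diff[OF LINT_test_function(2)[OF \<phi>'' d] LINT_test_function(2)[OF \<phi>'' cD2]]
      by (simp add: scaleR_diff_right)
  qed
  then obtain c k where ck: "\<And>x. x \<in> {0..1} \<Longrightarrow> d x = c + k * of_real x + D2 x"
    by (metis diff_eq_eq)
  have "(d has_vector_derivative k + D1 x) (at x within {0..1})" if x: "x \<in> {0..1}" for x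
  proof (rule has_vector_derivative_transform[OF x ck])
    have l: "((\<lambda>x. c + k * complex_of_real x) has_vector_derivative k) (at x within {0..1})"
      by (auto intro!: derivative_eq_intros has_vector_derivative_real_field)
    show "((\<lambda>x. c + k * complex_of_real x + D2 x) has_vector_derivative k + D1 x) (at x within {0..1})"
      by (rule has_vector_derivative_add[OF l D2[OF x]])
  qed
  moreover have "((\<lambda>x. k + D1 x) has_vector_derivative \<mu> * d x) (at x within {0..1})" if "x \<in> {0..1}" for x
    using has_vector_derivative_add[OF has_vector_derivative_const[of k] D1[OF that]] by simp
  ultimately show ?thesis by (intro exI[of _ "\<lambda>x. k + D1 x"]) blast
qed

text \<open>Energy: \<open>Re (cnj d * d')\<close> vanishes at both end points and has derivative
  \<open>\<bar>d'\<bar>\<^sup>2 + Re \<mu> \<bar>d\<bar>\<^sup>2 \<ge> 0\<close>.\<close>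

lemma homogeneous_bvp_zero:
  fixes d :: "real \<Rightarrow> complex"
  assumes d: "\<And>x. x \<in> {0..1} \<Longrightarrow> (d has_vector_derivative d1 x) (at x within {0..1})"
    and d1: "\<And>x. x \<in> {0..1} \<Longrightarrow> (d1 has_vector_derivative \<mu> * d x) (at x within {0..1})"
    and bc: "d1 0 = 0" "d 1 = 0" and \<mu>: "0 \<le> Re \<mu>" and x: "x \<in> {0..1}"
  shows "d x = 0"
proof -
  have cd: "continuous_on {0..1} d" "continuous_on {0..1} d1"
    using d d1 has_vector_derivative_continuous by (metis continuous_on_eq_continuous_within)+
  define q where "q x = Re \<mu> * (cmod (d x))\<^sup>2 + (cmod (d1 x))\<^sup>2" for x
  have "((\<lambda>x. Re (cnj (d x) * d1 x)) has_vector_derivative q x) (at x within {0..1})" if x: "x \<in> {0..1}" for x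
  proof -
    have "((\<lambda>x. cnj (d x) * d1 x) has_vector_derivative cnj (d x) * (\<mu> * d x) + cnj (d1 x) * d1 x) (at x within {0..1})"
      by (intro has_vector_derivative_mult d1[OF x] bounded_linear.has_vector_derivative[OF bounded_linear_cnj] d[OF x])
    from bounded_linear.has_vector_derivative[OF bounded_linear_Re this]
    show ?thesis
      by (rule back_subst[where P="\<lambda>z. (_ has_vector_derivative z) _"])
         (simp add: q_def cmod_power2, simp add: power2_eq_square algebra_simps)
  qed
  then have "(q has_integral (Re (cnj (d 1) * d1 1) - Re (cnj (d 0) * d1 0))) {0..1}"
    by (intro fundamental_theorem_of_calculus) auto
  then have "integral {0..1} q = 0" using bc by (simp add: integral_unique)
  moreover have "continuous_on {0..1} q" unfolding q_def by (intro continuous_intros cd)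
  moreover have q0: "0 \<le> q x" for x unfolding q_def using \<mu> by simp
  ultimately have "\<forall>x\<in>{0..1}. q x = 0" by (subst (asm) integral_eq_0_iff) auto
  \<comment> \<open>For \<omega> = 0 the coefficient Re \<mu> vanishes and q controls the derivative
    alone. The conclusion therefore goes through d' = 0 and the condition at 1.\<close>
  then have z: "d1 t = 0" if "t \<in> {0..1}" for t
    using that \<mu> unfolding q_def by (auto simp: add_nonneg_eq_0_iff)
  have "(d1 has_integral (d 1 - d x)) {x..1}"
    by (rule fundamental_theorem_of_calculus)
       (use x in \<open>auto intro!: has_vector_derivative_within_subset[OF d]\<close>)
  moreover have "(d1 has_integral 0) {x..1}"
    by (rule has_integral_eq[OF _ has_integral_0]) (use z x in auto)
  ultimately have "d 1 - d x = 0" by (rule has_integral_unique)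
  then show ?thesis using bc by simp
qed

text \<open>In the difference the point source cancels, leaving the homogeneous boundary value
  problem.\<close>

lemma green_function_unique:
  assumes g: "is_green_function \<mu> g" and h: "is_green_function \<mu> h" and \<mu>: "0 \<le> Re \<mu>"
    and y: "y \<in> {0<..<1}" and x: "x \<in> {0..1}"
  shows "g x y = h x y"
proof -
  define d where "d x = g x y - h x y" for x
  have G: "continuous_on {0..1} (\<lambda>x. g x y)" "((\<lambda>x. g x y) has_vector_derivative 0) (at 0 within {0..1})" "g 1 y = 0"
    and Gw: "\<And>\<phi>. test_function {0<..<1} \<phi> \<Longrightarrow> (LINT x:{0<..<1}|lborel. deriv (deriv \<phi>) x *\<^sub>R g x y)
             - \<mu> * (LINT x:{0<..<1}|lborel. \<phi> x *\<^sub>R g x y) = of_real (\<phi> y)"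
    using g y unfolding is_green_function_def by blast+
  have H: "continuous_on {0..1} (\<lambda>x. h x y)" "((\<lambda>x. h x y) has_vector_derivative 0) (at 0 within {0..1})" "h 1 y = 0"
    and Hw: "\<And>\<phi>. test_function {0<..<1} \<phi> \<Longrightarrow> (LINT x:{0<..<1}|lborel. deriv (deriv \<phi>) x *\<^sub>R h x y)
             - \<mu> * (LINT x:{0<..<1}|lborel. \<phi> x *\<^sub>R h x y) = of_real (\<phi> y)"
    using h y unfolding is_green_function_def by blast+
  have cd: "continuous_on {0..1} d" unfolding d_def by (intro continuous_intros G H)
  have "\<exists>d1. (\<forall>x\<in>{0..1}. (d has_vector_derivative d1 x) (at x within {0..1})) \<and>
    (\<forall>x\<in>{0..1}. (d1 has_vector_derivative \<mu> * d x) (at x within {0..1}))"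
  proof (rule weak_ode_classical[OF cd])
    fix \<phi> assume \<phi>: "test_function {0<..<1} \<phi>"
    note \<phi>'' = test_function_deriv[OF test_function_deriv[OF \<phi>]]
    have split: "integral {0..1} (\<lambda>t. \<rho> t *\<^sub>R d t) = (LINT x:{0<..<1}|lborel. \<rho> x *\<^sub>R g x y) - (LINT x:{0<..<1}|lborel. \<rho> x *\<^sub>R h x y)"
      if \<rho>: "test_function {0<..<1} \<rho>" for \<rho>
      unfolding d_def LINT_test_function(1)[OF \<rho> G(1)] LINT_test_function(1)[OF \<rho> H(1)]
      using Henstock_Kurzweil_Integration.integral_diff[OF LINT_test_function(2)[OF \<rho> G(1)] LINT_test_function(2)[OF \<rho> H(1)]]
      by (simp add: scaleR_diff_right)
    show "integral {0..1} (\<lambda>t. deriv (deriv \<phi>) t *\<^sub>R d t) = \<mu> * integral {0..1} (\<lambda>t. \<phi> t *\<^sub>R d t)"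
      unfolding split[OF \<phi>] split[OF \<phi>''] using Gw[OF \<phi>] Hw[OF \<phi>] by (simp add: algebra_simps)
  qed
  then obtain d1 where d: "\<And>x. x \<in> {0..1} \<Longrightarrow> (d has_vector_derivative d1 x) (at x within {0..1})"
    and d1: "\<And>x. x \<in> {0..1} \<Longrightarrow> (d1 has_vector_derivative \<mu> * d x) (at x within {0..1})" by blast
  have "(d has_vector_derivative 0 - 0) (at 0 within {0..1})"
    unfolding d_def by (intro has_vector_derivative_diff G H)
  moreover have "(d has_vector_derivative d1 0) (at 0 within {0..1})" using d[of 0] by simp
  ultimately have "d1 0 = 0"
    \<comment> \<open>The derivative obtained from the weak equation is matched with the prescribed
      one-sided derivative at 0.\<close>
    using vector_derivative_unique_within_closed_interval[of 0 1 0 d "d1 0" 0] by simp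
  then have "d x = 0" using homogeneous_bvp_zero[OF d d1 _ _ \<mu> x] G H by (simp add: d_def)
  then show ?thesis by (simp add: d_def)
qed

text \<open>A and B are the branches to the left and to the right of the source y. Matching values
  and a unit jump of the derivative on the diagonal produce the delta distribution.\<close>

lemma is_green_function_glue:
  fixes A A' B B' :: "real \<Rightarrow> real \<Rightarrow> complex"
  assumes A: "\<And>x y. (A y has_vector_derivative A' y x) (at x)" "\<And>x y. (A' y has_vector_derivative \<mu> * A y x) (at x)"
    and B: "\<And>x y. (B y has_vector_derivative B' y x) (at x)" "\<And>x y. (B' y has_vector_derivative \<mu> * B y x) (at x)"
    and bc: "\<And>y. A' y 0 = 0" "\<And>y. B y 1 = 0"
    and jump: "\<And>y. A y y = B y y" "\<And>y. B' y y - A' y y = 1"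
    and g: "\<And>x y. x \<in> {0..1} \<Longrightarrow> y \<in> {0<..<1} \<Longrightarrow> x \<le> y \<Longrightarrow> g x y = A y x"
      "\<And>x y. x \<in> {0..1} \<Longrightarrow> y \<in> {0<..<1} \<Longrightarrow> y \<le> x \<Longrightarrow> g x y = B y x"
  shows "is_green_function \<mu> g"
  unfolding is_green_function_def
proof (intro ballI conjI allI impI)
  fix y :: real assume y: "y \<in> {0<..<1}"
  have cA: "continuous_on S (A y)" and cB: "continuous_on S (B y)" for S
    using A(1) B(1) by (meson continuous_at_imp_continuous_on has_vector_derivative_continuous)+
  have "continuous_on ({0..y} \<union> {y..1}) (\<lambda>x. if x \<le> y then A y x else B y x)"
    by (rule continuous_on_cases) (auto intro: cA cB simp: jump dest: antisym)
  moreover have "{0..y} \<union> {y..1} = {0..1}" using y by auto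
  ultimately have "continuous_on {0..1} (\<lambda>x. if x \<le> y then A y x else B y x)" by simp
  then show cg: "continuous_on {0..1} (\<lambda>x. g x y)"
    by (rule continuous_on_eq) (use y g in auto)
  show "g 1 y = 0" using g(2)[of 1 y] y bc by simp
  show "((\<lambda>x. g x y) has_vector_derivative 0) (at 0 within {0..1})"
  proof (rule has_vector_derivative_transform_within[of _ _ _ _ y])
    show "(A y has_vector_derivative 0) (at 0 within {0..1})"
      using has_vector_derivative_at_within[OF A(1)[of y 0]] by (simp add: bc)
  qed (use y g in \<open>auto simp: dist_real_def\<close>)
  fix \<phi> assume \<phi>: "test_function {0<..<1} \<phi>"
  note \<phi>' = test_function_deriv[OF \<phi>] note \<phi>'' = test_function_deriv[OF \<phi>']
  \<comment> \<open>Lagrange's identity: the mixed expression is an antiderivative of the weak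
    integrand wherever P'' = \<mu> P.\<close>
  have vd: "((\<lambda>t. deriv \<phi> t *\<^sub>R P t - \<phi> t *\<^sub>R P' t) has_vector_derivative
      (deriv (deriv \<phi>) t *\<^sub>R P t - \<mu> * (\<phi> t *\<^sub>R P t))) (at t within S)"
    if P: "(P has_vector_derivative P' t) (at t)" "(P' has_vector_derivative \<mu> * P t) (at t)" for P P' :: "real \<Rightarrow> complex" and t S
  proof -
    have "((\<lambda>t. deriv \<phi> t *\<^sub>R P t - \<phi> t *\<^sub>R P' t) has_vector_derivative
       (deriv \<phi> t *\<^sub>R P' t + deriv (deriv \<phi>) t *\<^sub>R P t) - (\<phi> t *\<^sub>R (\<mu> * P t) + deriv \<phi> t *\<^sub>R P' t)) (at t within S)"
      by (intro has_vector_derivative_diff has_vector_derivative_scaleR has_vector_derivative_at_within[OF P(1)]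
          has_vector_derivative_at_within[OF P(2)] smooth_DERIV_within test_function_smooth[OF \<phi>] test_function_smooth[OF \<phi>'])
    then show ?thesis by (rule back_subst[where P="\<lambda>z. (_ has_vector_derivative z) _"]) simp
  qed
  let ?q = "\<lambda>t. deriv (deriv \<phi>) t *\<^sub>R g t y - \<mu> * (\<phi> t *\<^sub>R g t y)"
  have z: "\<phi> 0 = 0" "\<phi> 1 = 0" "deriv \<phi> 0 = 0" "deriv \<phi> 1 = 0"
    using test_function_zero[OF \<phi>] test_function_zero[OF \<phi>'] by auto
  have "((\<lambda>t. deriv (deriv \<phi>) t *\<^sub>R A y t - \<mu> * (\<phi> t *\<^sub>R A y t)) has_integral
     ((deriv \<phi> y *\<^sub>R A y y - \<phi> y *\<^sub>R A' y y) - (deriv \<phi> 0 *\<^sub>R A y 0 - \<phi> 0 *\<^sub>R A' y 0))) {0..y}"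
    by (intro fundamental_theorem_of_calculus vd A) (use y in auto)
  then have 1: "(?q has_integral (deriv \<phi> y *\<^sub>R A y y - \<phi> y *\<^sub>R A' y y)) {0..y}"
    unfolding z by simp (erule has_integral_eq[rotated], use y g in auto)
  have "((\<lambda>t. deriv (deriv \<phi>) t *\<^sub>R B y t - \<mu> * (\<phi> t *\<^sub>R B y t)) has_integral
     ((deriv \<phi> 1 *\<^sub>R B y 1 - \<phi> 1 *\<^sub>R B' y 1) - (deriv \<phi> y *\<^sub>R B y y - \<phi> y *\<^sub>R B' y y))) {y..1}"
    by (intro fundamental_theorem_of_calculus vd B) (use y in auto)
  then have 2: "(?q has_integral - (deriv \<phi> y *\<^sub>R B y y - \<phi> y *\<^sub>R B' y y)) {y..1}"
    unfolding z by simp (erule has_integral_eq[rotated], use y g in auto)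
  have "(?q has_integral ((deriv \<phi> y *\<^sub>R A y y - \<phi> y *\<^sub>R A' y y) + - (deriv \<phi> y *\<^sub>R B y y - \<phi> y *\<^sub>R B' y y))) {0..1}"
    by (rule has_integral_combine[OF _ _ 1 2]) (use y in auto)
  \<comment> \<open>At y the terms with the derivative of \<phi> cancel by continuity, and only
    \<phi>(y) times the jump survives.\<close>
  also have "(deriv \<phi> y *\<^sub>R A y y - \<phi> y *\<^sub>R A' y y) + - (deriv \<phi> y *\<^sub>R B y y - \<phi> y *\<^sub>R B' y y) = \<phi> y *\<^sub>R (B' y y - A' y y)"
    by (simp add: jump(1) scaleR_diff_right)
  also have "\<dots> = of_real (\<phi> y)" by (simp add: jump scaleR_conv_of_real)
  finally have q: "integral {0..1} ?q = of_real (\<phi> y)" by (rule integral_unique)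
  have "integral {0..1} ?q = integral {0..1} (\<lambda>t. deriv (deriv \<phi>) t *\<^sub>R g t y) - integral {0..1} (\<lambda>t. \<mu> * (\<phi> t *\<^sub>R g t y))"
    by (rule Henstock_Kurzweil_Integration.integral_diff[OF LINT_test_function(2)[OF \<phi>'' cg] integrable_on_mult_right[OF LINT_test_function(2)[OF \<phi> cg]]])
  then show "(LINT x:{0<..<1}|lborel. deriv (deriv \<phi>) x *\<^sub>R g x y) - \<mu> * (LINT x:{0<..<1}|lborel. \<phi> x *\<^sub>R g x y) = of_real (\<phi> y)"
    unfolding LINT_test_function(1)[OF \<phi> cg] LINT_test_function(1)[OF \<phi>'' cg] using q
    by (simp only: Henstock_Kurzweil_Integration.integral_mult_right)
qed

lemma ipow_half_props:
  assumes \<alpha>: "0 < \<alpha>" "\<alpha> < 1" and \<omega>: "\<omega> \<noteq> 0"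
  shows "ipow \<omega> (\<alpha> / 2) \<noteq> 0" "(ipow \<omega> (\<alpha> / 2))\<^sup>2 = ipow \<omega> \<alpha>"
    and "\<bar>Im (ipow \<omega> (\<alpha> / 2))\<bar> \<le> Re (ipow \<omega> (\<alpha> / 2))"
proof -
  show "ipow \<omega> (\<alpha> / 2) \<noteq> 0" using \<omega> by (simp add: ipow_def)
  have "(\<bar>\<omega>\<bar> powr (\<alpha> / 2))\<^sup>2 = \<bar>\<omega>\<bar> powr \<alpha>" by (simp add: power2_eq_square powr_add[symmetric])
  then show "(ipow \<omega> (\<alpha> / 2))\<^sup>2 = ipow \<omega> \<alpha>"
    using \<omega> by (simp add: ipow_def power_mult_distrib exp_double[symmetric] mult.assoc flip: of_real_power)
  \<comment> \<open>The argument of the root is \<theta> up to sign. It is below pi / 4, where the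
    sine does not exceed the cosine.\<close>
  define \<theta> where "\<theta> = pi * \<alpha> / 4"
  have \<theta>: "0 < \<theta>" "\<theta> < pi / 4" using \<alpha> by (auto simp: \<theta>_def)
  have re: "Re (ipow \<omega> (\<alpha> / 2)) = \<bar>\<omega>\<bar> powr (\<alpha> / 2) * cos \<theta>"
    and im: "\<bar>Im (ipow \<omega> (\<alpha> / 2))\<bar> = \<bar>\<omega>\<bar> powr (\<alpha> / 2) * sin \<theta>"
    using \<omega> \<theta> sin_gt_zero[of \<theta>] pi_gt_zero
    by (auto simp: ipow_def Re_exp Im_exp sgn_if \<theta>_def abs_mult)
  have "sin \<theta> \<le> sin (pi / 4)" using \<theta> by (intro sin_monotone_2pi_le) auto
  also have "\<dots> = cos (pi / 4)" by (simp add: sin_45 cos_45)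
  also have "\<dots> \<le> cos \<theta>" using \<theta> by (intro cos_monotone_0_pi_le) auto
  finally show "\<bar>Im (ipow \<omega> (\<alpha> / 2))\<bar> \<le> Re (ipow \<omega> (\<alpha> / 2))"
    unfolding re im by (intro mult_left_mono) auto
qed

lemma Re_ipow_nonneg:
  assumes "0 < \<alpha>" "\<alpha> < 1" shows "0 \<le> Re (ipow \<omega> \<alpha>)"
proof (cases "\<omega> = 0")
  case False
  have "pi * \<alpha> < pi" "0 \<le> pi * \<alpha>" using assms by simp_all
  then have "0 \<le> cos (pi * \<alpha> / 2)" using pi_gt_zero by (intro cos_ge_zero) linarith+
  then show ?thesis using False by (auto simp: ipow_def Re_exp sgn_if)
qed (simp add: ipow_def)

section \<open>Hyperbolic functions in the sector |Im r| \<le> Re r\<close>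

lemma cmod_cosh_le: "cmod (cosh z) \<le> cosh (Re z)"
proof -
  have "cmod (exp z + exp (- z)) \<le> exp (Re z) + exp (- Re z)"
    by (rule order_trans[OF norm_triangle_ineq]) simp
  then show ?thesis by (simp add: cosh_field_def norm_divide)
qed

text \<open>The mean value inequality along the segment from 0 to z. The factor |z| is kept because
  it cancels the 1/r of the Green function uniformly down to small frequencies.\<close>

lemma cmod_sinh_le:
  assumes "0 \<le> Re z"
  shows "cmod (sinh z) \<le> cmod z * cosh (Re z)"
proof -
  have "cmod (sinh z - sinh 0) \<le> cosh (Re z) * cmod (z - 0)"
  proof (rule field_differentiable_bound[where S="closed_segment 0 z" and f'=cosh])
    show "(sinh has_field_derivative cosh w) (at w within closed_segment 0 z)" for w
      by (auto intro!: derivative_eq_intros)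
    fix w assume "w \<in> closed_segment 0 z"
    then obtain u where u: "0 \<le> u" "u \<le> 1" "w = of_real u * z"
      by (auto simp: closed_segment_def scaleR_conv_of_real)
    have "cmod (cosh w) \<le> cosh (Re w)" by (rule cmod_cosh_le)
    also have "\<dots> \<le> cosh (Re z)"
      using u assms by (subst cosh_real_nonneg_le_iff) (auto simp: mult_left_le_one_le)
    finally show "cmod (cosh w) \<le> cosh (Re z)" .
  qed auto
  then show ?thesis by (simp add: mult.commute)
qed

text \<open>The squared modulus of cosh r is cosh(Re r)^2 - sin(Im r)^2. In the sector the sine term
  is bounded by 1 and by (Re r)^2, so twice it is at most 1 + (Re r)^2 \<le> cosh(Re r)^2.\<close>

lemma cmod_cosh_ge:
  assumes "\<bar>Im r\<bar> \<le> Re r"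
  shows "(cosh (Re r))\<^sup>2 \<le> 2 * (cmod (cosh r))\<^sup>2"
proof -
  have "Re (cosh r) = cosh (Re r) * cos (Im r)" "Im (cosh r) = sinh (Re r) * sin (Im r)"
    by (simp_all add: cosh_field_def sinh_field_def Re_exp Im_exp algebra_simps)
  then have "(cmod (cosh r))\<^sup>2 = (cosh (Re r))\<^sup>2 * (cos (Im r))\<^sup>2 + (sinh (Re r))\<^sup>2 * (sin (Im r))\<^sup>2"
    by (simp add: cmod_power2 power_mult_distrib)
  also have "\<dots> = (cosh (Re r))\<^sup>2 - (sin (Im r))\<^sup>2"
    unfolding cos_squared_eq sinh_square_eq by (simp add: algebra_simps)
  finally have e: "(cmod (cosh r))\<^sup>2 = (cosh (Re r))\<^sup>2 - (sin (Im r))\<^sup>2" .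
  have "\<bar>Re r\<bar> \<le> \<bar>sinh (Re r)\<bar>"
    using real_le_abs_sinh[of "Re r"] by (simp add: sinh_field_def exp_minus)
  then have "(Re r)\<^sup>2 \<le> (sinh (Re r))\<^sup>2" by (rule abs_le_square_iff[THEN iffD1])
  then have c: "1 + (Re r)\<^sup>2 \<le> (cosh (Re r))\<^sup>2" by (simp add: cosh_square_eq)
  have "\<bar>sin (Im r)\<bar> \<le> \<bar>Re r\<bar>" using abs_sin_x_le_abs_x[of "Im r"] assms by linarith
  then have "(sin (Im r))\<^sup>2 \<le> (Re r)\<^sup>2" by (rule abs_le_square_iff[THEN iffD1])
  moreover have "(sin (Im r))\<^sup>2 \<le> 1" by (simp add: abs_square_le_1)
  ultimately have "2 * (sin (Im r))\<^sup>2 \<le> (cosh (Re r))\<^sup>2" using c by linarith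
  then show ?thesis unfolding e by simp
qed

lemma cosh_nonzero:
  assumes "\<bar>Im r\<bar> \<le> Re r" shows "cosh r \<noteq> 0"
proof
  assume "cosh r = 0"
  then have "(cosh (Re r))\<^sup>2 \<le> 0" using cmod_cosh_ge[OF assms] by simp
  then show False using cosh_real_pos[of "Re r"] by simp
qed

text \<open>The product form separates the smaller from the larger variable; it exhibits the two
  branches to be glued and makes the size of the kernel visible.\<close>

lemma green_cosh_sinh:
  assumes \<alpha>: "0 < \<alpha>" "\<alpha> < 1" and \<omega>: "\<omega> \<noteq> 0"
  defines "r \<equiv> ipow \<omega> (\<alpha> / 2)"
  shows "green \<alpha> \<omega> x y = - (cosh (r * of_real (min x y)) * sinh (r * (1 - of_real (max x y)))) / (r * cosh r)"
proof -
  note r = ipow_half_props[OF \<alpha> \<omega>, folded r_def]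
  have *: "(exp (r * of_real (m + M)) + exp (r * of_real (M - m)) - exp (r * of_real (2 - m - M)) - exp (r * of_real (2 - (M - m))))
        / (2 * r * (1 + exp (2 * r))) = - (cosh (r * of_real m) * sinh (r * (1 - of_real M))) / (r * cosh r)" for m M :: real
  proof -
    \<comment> \<open>In these variables the claim is an identity of rational functions; the
      numerator factors as (a^2 + 1)(b^2 - e^2) / (ab).\<close>
    define a b e where "a = exp (r * of_real m)" and "b = exp (r * of_real M)" and "e = exp r"
    have nz: "a \<noteq> 0" "b \<noteq> 0" "e \<noteq> 0" by (auto simp: a_def b_def e_def)
    have e: "exp (r * of_real (m + M)) = a * b" "exp (r * of_real (M - m)) = b / a"
      "exp (r * of_real (2 - m - M)) = e\<^sup>2 / (a * b)" "exp (r * of_real (2 - (M - m))) = e\<^sup>2 * a / b"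
      "exp (2 * r) = e\<^sup>2"
      by (simp_all add: a_def b_def e_def distrib_left right_diff_distrib exp_add exp_diff
          mult.commute[of r 2] exp_double)
    have c: "cosh (r * of_real m) = (a\<^sup>2 + 1) / (2 * a)" "cosh r = (1 + e\<^sup>2) / (2 * e)"
      using nz by (simp_all add: a_def e_def cosh_field_def exp_minus field_simps power2_eq_square)
    have s: "sinh (r * (1 - of_real M)) = (e\<^sup>2 - b\<^sup>2) / (2 * b * e)"
      using nz by (simp add: b_def e_def sinh_field_def right_diff_distrib exp_diff field_simps power2_eq_square)
    obtain D where D: "D = 1 + e\<^sup>2" by simp
    have D0: "D \<noteq> 0" using cosh_nonzero[OF r(3)] unfolding c D by auto
    have num: "a * b + b / a - e\<^sup>2 / (a * b) - e\<^sup>2 * a / b = (a\<^sup>2 + 1) * (b\<^sup>2 - e\<^sup>2) / (a * b)"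
      using nz by (simp add: field_simps power2_eq_square)
    show ?thesis
      unfolding e c s D[symmetric] num using nz D0 r(1) by (simp add: field_simps)
  qed
  have g: "green \<alpha> \<omega> x y = (exp (r * of_real (x + y)) + exp (r * of_real \<bar>x - y\<bar>) - exp (r * of_real (2 - x - y)) - exp (r * of_real (2 - \<bar>x - y\<bar>)))
        / (2 * r * (1 + exp (2 * r)))"
    using \<omega> by (simp add: green_def r_def Let_def)
  show ?thesis
  proof (cases "x \<le> y")
    case True
    then show ?thesis unfolding g using *[of x y] by (simp add: min_def max_def)
  next
    case False
    then have e: "x + y = y + x" "2 - x - y = 2 - y - x" "\<bar>x - y\<bar> = x - y" "min x y = y" "max x y = x" by auto
    show ?thesis unfolding g e by (rule *)
  qed
qed

lemma is_green_function_green: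
  assumes \<alpha>: "0 < \<alpha>" "\<alpha> < 1"
  shows "is_green_function (ipow \<omega> \<alpha>) (green \<alpha> \<omega>)"
proof (cases "\<omega> = 0")
  case True
  show ?thesis
  proof (rule is_green_function_glue[where A="\<lambda>y x. of_real (y - 1)" and A'="\<lambda>y x. 0"
        and B="\<lambda>y x. of_real x - 1" and B'="\<lambda>y x. 1"])
    show "((\<lambda>x. complex_of_real x - 1) has_vector_derivative 1) (at x)" for x
      by (auto intro!: derivative_eq_intros has_vector_derivative_real_field)
  qed (use True in \<open>auto simp: green_def ipow_def max_def\<close>)
next
  case False
  define r where "r = ipow \<omega> (\<alpha> / 2)"
  note r = ipow_half_props[OF \<alpha> False, folded r_def]
  note ch = cosh_nonzero[OF r(3)]
  \<comment> \<open>The coefficient of each branch is the other branch at x = y, up to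
    normalisation, which makes the kernel continuous on the diagonal.\<close>
  define S where "S y = sinh (r * (1 - of_real y)) / cosh r" for y
  define C where "C y = cosh (r * of_real y) / cosh r" for y
  have r2: "ipow \<omega> \<alpha> = r * r" using r(2) by (simp add: power2_eq_square)
  show ?thesis
  proof (rule is_green_function_glue[where A="\<lambda>y x. - (cosh (r * of_real x) * S y / r)" and A'="\<lambda>y x. - (sinh (r * of_real x) * S y)"
        and B="\<lambda>y x. - (C y * sinh (r * (1 - of_real x)) / r)" and B'="\<lambda>y x. C y * cosh (r * (1 - of_real x))"])
    fix x y :: real
    have "((\<lambda>z. - (cosh (r * z) * S y / r)) has_field_derivative - (sinh (r * of_real x) * S y)) (at (of_real x))"
      using r(1) by (auto intro!: derivative_eq_intros)
    from has_vector_derivative_real_field[OF this]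
    show "((\<lambda>x. - (cosh (r * of_real x) * S y / r)) has_vector_derivative - (sinh (r * of_real x) * S y)) (at x)" .
    have "((\<lambda>z. - (sinh (r * z) * S y)) has_field_derivative ipow \<omega> \<alpha> * - (cosh (r * of_real x) * S y / r)) (at (of_real x))"
      unfolding r2 using r(1) by (auto intro!: derivative_eq_intros)
    from has_vector_derivative_real_field[OF this]
    show "((\<lambda>x. - (sinh (r * of_real x) * S y)) has_vector_derivative ipow \<omega> \<alpha> * - (cosh (r * of_real x) * S y / r)) (at x)" .
    have "((\<lambda>z. - (C y * sinh (r * (1 - z)) / r)) has_field_derivative C y * cosh (r * (1 - of_real x))) (at (of_real x))"
      using r(1) by (auto intro!: derivative_eq_intros)
    from has_vector_derivative_real_field[OF this]
    show "((\<lambda>x. - (C y * sinh (r * (1 - of_real x)) / r)) has_vector_derivative C y * cosh (r * (1 - of_real x))) (at x)" .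
    have "((\<lambda>z. C y * cosh (r * (1 - z))) has_field_derivative ipow \<omega> \<alpha> * - (C y * sinh (r * (1 - of_real x)) / r)) (at (of_real x))"
      unfolding r2 using r(1) by (auto intro!: derivative_eq_intros)
    from has_vector_derivative_real_field[OF this]
    show "((\<lambda>x. C y * cosh (r * (1 - of_real x))) has_vector_derivative ipow \<omega> \<alpha> * - (C y * sinh (r * (1 - of_real x)) / r)) (at x)" .
    show "- (cosh (r * of_real y) * S y / r) = - (C y * sinh (r * (1 - of_real y)) / r)"
      by (simp add: S_def C_def)
    \<comment> \<open>The unit jump is the addition theorem for cosh at r * y + r * (1 - y) =
      r.\<close>
    have "C y * cosh (r * (1 - of_real y)) - - (sinh (r * of_real y) * S y) =
      cosh (r * of_real y + r * (1 - of_real y)) / cosh r"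
      unfolding S_def C_def cosh_add by (simp add: add_divide_distrib)
    also have "r * of_real y + r * (1 - of_real y) = r" by (simp add: algebra_simps)
    finally show "C y * cosh (r * (1 - of_real y)) - - (sinh (r * of_real y) * S y) = 1" using ch by simp
    show "x \<le> y \<Longrightarrow> green \<alpha> \<omega> x y = - (cosh (r * of_real x) * S y / r)"
      unfolding green_cosh_sinh[OF \<alpha> False] r_def[symmetric] by (simp add: S_def min_def max_def mult.commute)
    show "y \<le> x \<Longrightarrow> green \<alpha> \<omega> x y = - (C y * sinh (r * (1 - of_real x)) / r)"
      unfolding green_cosh_sinh[OF \<alpha> False] r_def[symmetric] by (simp add: C_def min_def max_def mult.commute)
  qed auto
qed

text \<open>The factor r of the sinh estimate cancels the denominator. The product of the two real
  cosh factors is at most cosh (p * (m + 1 - M)) \<le> cosh p because m \<le> M, and the lower bound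
  for cosh r contributes the 2.\<close>

lemma green_bound:
  assumes \<alpha>: "0 < \<alpha>" "\<alpha> < 1" and x: "x \<in> {0<..<1}" and y: "y \<in> {0<..<1}"
  shows "(cmod (green \<alpha> \<omega> x y))\<^sup>2 \<le> 2"
proof (cases "\<omega> = 0")
  case True
  have "\<bar>max x y - 1\<bar> \<le> 1" using x y by (auto simp: max_def)
  then have "(max x y - 1)\<^sup>2 \<le> 1" by (simp add: abs_square_le_1)
  moreover have "green \<alpha> \<omega> x y = of_real (max x y - 1)" using True by (simp add: green_def)
  then have "cmod (green \<alpha> \<omega> x y) = \<bar>max x y - 1\<bar>" by (simp only: norm_of_real)
  ultimately show ?thesis by simp
next
  case False
  define r where "r = ipow \<omega> (\<alpha> / 2)"
  note r = ipow_half_props[OF \<alpha> False, folded r_def]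
  define m where "m = min x y" define M where "M = max x y"
  have mM: "0 \<le> m" "m \<le> M" "M \<le> 1" "0 < M" using x y by (auto simp: m_def M_def)
  define p where "p = Re r"
  have p: "0 \<le> p" using r(3) unfolding p_def by linarith
  have R: "Re (r * of_real m) = p * m" "Re (r * (1 - of_real M)) = p * (1 - M)" by (simp_all add: p_def)
  have sh: "cmod (sinh (r * (1 - of_real M))) \<le> cmod r * (1 - M) * cosh (p * (1 - M))"
  proof -
    have "0 \<le> Re (r * (1 - of_real M))" unfolding R using p mM by simp
    from cmod_sinh_le[OF this]
    have "cmod (sinh (r * (1 - of_real M))) \<le> cmod (r * (1 - of_real M)) * cosh (p * (1 - M))"
      unfolding R .
    moreover have "r * (1 - of_real M) = r * of_real (1 - M)" by simp
    then have "cmod (r * (1 - of_real M)) = cmod r * (1 - M)"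
      using mM by (simp only: norm_mult norm_of_real abs_of_nonneg diff_ge_0_iff_ge)
    ultimately show ?thesis by simp
  qed
  have "cosh (p * m) * cosh (p * (1 - M)) \<le> cosh (p * m + p * (1 - M))"
    unfolding cosh_add using p mM by simp
  also have "\<dots> \<le> cosh p"
  proof (subst cosh_real_nonneg_le_iff)
    have "p * (m + (1 - M)) \<le> p * 1" using p mM by (intro mult_left_mono) auto
    then show "p * m + p * (1 - M) \<le> p" by (simp add: algebra_simps)
  qed (use p mM in auto)
  finally have cc: "cosh (p * m) * cosh (p * (1 - M)) \<le> cosh p" .
  have "cmod (green \<alpha> \<omega> x y) * (cmod r * cmod (cosh r)) = cmod (cosh (r * of_real m)) * cmod (sinh (r * (1 - of_real M)))"
    unfolding green_cosh_sinh[OF \<alpha> False] r_def[symmetric] m_def[symmetric] M_def[symmetric]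
    using r(1) cosh_nonzero[OF r(3)] by (simp add: norm_divide norm_mult)
  also have "\<dots> \<le> cosh (p * m) * (cmod r * (1 - M) * cosh (p * (1 - M)))"
    using cmod_cosh_le[of "r * of_real m"] sh unfolding R by (intro mult_mono) auto
  also have "\<dots> = (1 - M) * (cmod r * (cosh (p * m) * cosh (p * (1 - M))))" by simp
  also have "\<dots> \<le> 1 * (cmod r * cosh p)"
    using mM cc by (intro mult_mono mult_left_mono) auto
  finally have "cmod r * (cmod (green \<alpha> \<omega> x y) * cmod (cosh r)) \<le> cmod r * cosh p" by (simp add: mult_ac)
  then have "cmod (green \<alpha> \<omega> x y) * cmod (cosh r) \<le> cosh p" using r(1) by simp
  then have "(cmod (green \<alpha> \<omega> x y) * cmod (cosh r))\<^sup>2 \<le> (cosh p)\<^sup>2" by (intro power_mono) auto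
  also have "\<dots> \<le> 2 * (cmod (cosh r))\<^sup>2" unfolding p_def by (rule cmod_cosh_ge[OF r(3)])
  finally show ?thesis using cosh_nonzero[OF r(3)] by (simp add: power_mult_distrib)
qed

text \<open>The constant may depend on \<omega>: the Riemann sums need a rate only for each fixed
  (x, \<omega>).\<close>

lemma green_lipschitz:
  assumes x: "x \<in> {0<..<1}"
  shows "\<exists>L. L-lipschitz_on {0..1} (green \<alpha> \<omega> x)"
proof (cases "\<omega> = 0")
  case True
  have "cmod (green \<alpha> \<omega> x y - green \<alpha> \<omega> x y') \<le> 1 * \<bar>y - y'\<bar>" for y y'
  proof -
    have "green \<alpha> \<omega> x y - green \<alpha> \<omega> x y' = of_real (max x y - max x y')" using True by (simp add: green_def)
    then show ?thesis by (simp only: norm_of_real) (auto simp: max_def)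
  qed
  then have "1-lipschitz_on {0..1} (green \<alpha> \<omega> x)" by (intro lipschitz_onI) (auto simp: dist_norm)
  then show ?thesis by blast
next
  case False
  define r where "r = ipow \<omega> (\<alpha> / 2)"
  define B where "B = exp (2 * cmod r)"
  have ex: "cmod (exp (r * of_real u) - exp (r * of_real v)) \<le> B * cmod r * \<bar>y - y'\<bar>"
    if "\<bar>u\<bar> \<le> 2" "\<bar>v\<bar> \<le> 2" "\<bar>u - v\<bar> \<le> \<bar>y - y'\<bar>" for u v y y' :: real
  proof -
    have cb: "r * of_real t \<in> cball 0 (2 * cmod r)" if "\<bar>t\<bar> \<le> 2" for t :: real
      using mult_right_mono[OF that norm_ge_zero[of r]] by (simp add: norm_mult mult.commute)
    have "cmod (exp (r * of_real u) - exp (r * of_real v)) \<le> B * cmod (r * of_real u - r * of_real v)"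
    proof (rule field_differentiable_bound[where S="cball 0 (2 * cmod r)" and f'=exp])
      show "(exp has_field_derivative exp z) (at z within cball 0 (2 * cmod r))" for z :: complex
        by (rule DERIV_exp[THEN has_field_derivative_at_within])
      show "cmod (exp z) \<le> B" if "z \<in> cball 0 (2 * cmod r)" for z
        using that norm_exp[of z] unfolding B_def by (auto intro: order_trans)
    qed (use cb that in auto)
    also have "r * of_real u - r * of_real v = r * of_real (u - v)" by (simp add: algebra_simps)
    also have "B * cmod (r * of_real (u - v)) = B * cmod r * \<bar>u - v\<bar>" by (simp add: norm_mult del: of_real_diff)
    also have "\<dots> \<le> B * cmod r * \<bar>y - y'\<bar>" using that by (intro mult_left_mono) (auto simp: B_def)
    finally show ?thesis .
  qed
  \<comment> \<open>\<open>Dn\<close> can vanish for some values of \<alpha>, which is arbitrary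
    here; then x / 0 = 0 makes both sides of the estimate 0. The factor 4 counts the exponentials,
    and B bounds exp since all real arguments lie in [-2, 2].\<close>
  define Dn where "Dn = 2 * r * (1 + exp (2 * r))"
  have "cmod (green \<alpha> \<omega> x y - green \<alpha> \<omega> x y') \<le> (4 * (B * cmod r) / cmod Dn) * \<bar>y - y'\<bar>"
    if y: "y \<in> {0..1}" "y' \<in> {0..1}" for y y'
  proof -
    define E where "E u = exp (r * of_real u)" for u
    define N where "N y = E (x + y) + E \<bar>x - y\<bar> - E (2 - x - y) - E (2 - \<bar>x - y\<bar>)" for y
    have g: "green \<alpha> \<omega> x y = N y / Dn" for y
      using False by (simp add: green_def r_def E_def N_def Dn_def Let_def)
    have "N y - N y' = (E (x + y) - E (x + y')) + (E \<bar>x - y\<bar> - E \<bar>x - y'\<bar>) - (E (2 - x - y) - E (2 - x - y')) - (E (2 - \<bar>x - y\<bar>) - E (2 - \<bar>x - y'\<bar>))"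
      by (simp add: N_def algebra_simps)
    also have "cmod \<dots> \<le> B * cmod r * \<bar>y - y'\<bar> + B * cmod r * \<bar>y - y'\<bar> + B * cmod r * \<bar>y - y'\<bar> + B * cmod r * \<bar>y - y'\<bar>"
      using x y by (intro order_trans[OF norm_triangle_ineq4] order_trans[OF norm_triangle_ineq] add_mono ex[folded E_def]) auto
    finally show ?thesis
      unfolding g diff_divide_distrib[symmetric] norm_divide by (simp add: divide_right_mono)
  qed
  then have "(4 * (B * cmod r) / cmod Dn)-lipschitz_on {0..1} (green \<alpha> \<omega> x)"
    by (intro lipschitz_onI) (auto simp: dist_norm B_def)
  then show ?thesis by blast
qed

text \<open>Measurability is taken for fixed y, since a Riemann sum samples the kernel at finitely
  many points.\<close>

lemma green_measurable:
  "(\<lambda>(x, \<omega>). green \<alpha> \<omega> x y) \<in> borel_measurable (borel \<Otimes>\<^sub>M borel)"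
proof -
  have [measurable]: "(\<lambda>\<omega>. ipow \<omega> (\<alpha> / 2)) \<in> borel_measurable borel"
    unfolding ipow_def sgn_if by measurable
  show ?thesis unfolding green_def Let_def by measurable
qed

section \<open>Mild solutions\<close>

text \<open>Each Riemann sum is a finite sum of products of a function of (x, \<omega>) and an
  increment depending on s, hence jointly measurable. So is the total function \<open>lim\<close>,
  including its default value where the sums diverge.\<close>

lemma mild_solution_exists:
  assumes bm: "brownian_motion_01 M W" and \<alpha>: "0 < \<alpha>" "\<alpha> < 1" and h[measurable]: "h \<in> borel_measurable borel"
  shows "\<exists>U. mild_solution M W \<alpha> h U"
proof -
  define f where "f x \<omega> y = green \<alpha> \<omega> x y * (- h \<omega>)" for x \<omega> y
  define U where "U x \<omega> s = lim (\<lambda>m. step_integral W (dyadic_step m (f x \<omega>)) s)" for x \<omega> s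
  let ?R = "restrict_space borel {0<..<1::real} \<Otimes>\<^sub>M (borel :: real measure) \<Otimes>\<^sub>M M"
  have [measurable]: "(\<lambda>p. fst p) \<in> ?R \<rightarrow>\<^sub>M borel"
    by (rule measurable_compose[OF measurable_fst]) (rule measurable_restrict_space1, simp)
  have gm: "(\<lambda>p. green \<alpha> (fst (snd p)) (fst p) y) \<in> borel_measurable ?R" for y
  proof -
    have "(\<lambda>p. (fst p, fst (snd p))) \<in> ?R \<rightarrow>\<^sub>M borel \<Otimes>\<^sub>M borel" by measurable
    from measurable_compose[OF this green_measurable[of \<alpha> y]] show ?thesis by (simp add: case_prod_unfold)
  qed
  have Wm: "(\<lambda>p. W t (snd (snd p))) \<in> borel_measurable ?R" if "0 \<le> t" "t \<le> 1" for t
  proof -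
    have "(\<lambda>p. snd (snd p)) \<in> ?R \<rightarrow>\<^sub>M M" by measurable
    from measurable_compose[OF this brownian_measurable[OF bm that]] show ?thesis .
  qed
  have "(\<lambda>p. step_integral W (dyadic_step m (f (fst p) (fst (snd p)))) (snd (snd p))) \<in> borel_measurable ?R" for m
    unfolding step_integral_dyadic
  proof (intro borel_measurable_sum borel_measurable_times)
    fix k :: nat assume k: "k \<in> {..<2 ^ m}"
    show "(\<lambda>p. f (fst p) (fst (snd p)) (real k / 2 ^ m)) \<in> borel_measurable ?R"
      unfolding f_def by (intro borel_measurable_times gm) measurable
    have "real (Suc k) \<le> real (2 ^ m)" using k by (intro of_nat_mono) simp
    then have [measurable]: "(\<lambda>p. W (real (Suc k) / 2 ^ m) (snd (snd p))) \<in> borel_measurable ?R"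
      by (intro Wm) simp_all
    have "real k \<le> real (2 ^ m)" using k by (intro of_nat_mono) simp
    then have [measurable]: "(\<lambda>p. W (real k / 2 ^ m) (snd (snd p))) \<in> borel_measurable ?R"
      by (intro Wm) simp_all
    show "(\<lambda>p. complex_of_real (W (real (Suc k) / 2 ^ m) (snd (snd p)) - W (real k / 2 ^ m) (snd (snd p)))) \<in> borel_measurable ?R"
      by measurable
  qed
  then have Um: "(\<lambda>(x, \<omega>, s). U x \<omega> s) \<in> borel_measurable ?R"
    unfolding U_def case_prod_unfold by (rule borel_measurable_lim_metric)
  have "is_wiener_integral M W (f x \<omega>) (U x \<omega>)" if x: "x \<in> {0<..<1}" for x \<omega>
  proof -
    obtain L where L: "L-lipschitz_on {0..1} (green \<alpha> \<omega> x)"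
      using green_lipschitz[OF x] by blast
    have "is_wiener_integral M W (f x \<omega>) (\<lambda>s. lim (\<lambda>m. step_integral W (dyadic_step m (f x \<omega>)) s))"
    proof (rule is_wiener_integral_dyadic_lim[OF bm], rule lipschitz_onI)
      fix y y' :: real assume "y \<in> {0..1}" "y' \<in> {0..1}"
      from mult_right_mono[OF lipschitz_onD[OF L this] norm_ge_zero[of "h \<omega>"]]
      show "dist (f x \<omega> y) (f x \<omega> y') \<le> L * cmod (h \<omega>) * dist y y'"
        unfolding f_def dist_norm left_diff_distrib[symmetric] norm_mult norm_minus_cancel by (simp only: mult_ac)
    qed (use lipschitz_on_nonneg[OF L] in simp)
    then show ?thesis unfolding U_def .
  qed
  then have "mild_solution M W \<alpha> h U"
    unfolding mild_solution_def using Um is_green_function_green[OF \<alpha>] unfolding f_def by blast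
  then show ?thesis by blast
qed

lemma wiener_integral_green:
  assumes bm: "brownian_motion_01 M W" and x: "x \<in> {0<..<1}"
  shows "is_wiener_integral M W (\<lambda>y. green \<alpha> \<omega> x y) (wiener_integral M W (\<lambda>y. green \<alpha> \<omega> x y))"
proof -
  obtain L where "L-lipschitz_on {0..1} (green \<alpha> \<omega> x)"
    using green_lipschitz[OF x] by blast
  from is_wiener_integral_dyadic_lim[OF bm this] show ?thesis unfolding wiener_integral_def 
    by (rule someI[where P="is_wiener_integral M W (green \<alpha> \<omega> x)"])
qed

text \<open>Uniqueness replaces whichever Green function the solution was built with by
  \<open>green\<close>, on the open square only; the integrand f stays unspecified
  elsewhere.\<close>

lemma mild_solution_wiener:
  assumes \<alpha>: "0 < \<alpha>" "\<alpha> < 1" and U: "mild_solution M W \<alpha> h U" and x: "x \<in> {0<..<1}"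
  obtains f where "is_wiener_integral M W f (U x \<omega>)" "\<And>y. y \<in> {0<..<1} \<Longrightarrow> f y = green \<alpha> \<omega> x y * (- h \<omega>)"
proof -
  obtain g where g: "is_green_function (ipow \<omega> \<alpha>) g" "is_wiener_integral M W (\<lambda>y. g x y * (- h \<omega>)) (U x \<omega>)"
    using U x unfolding mild_solution_def by blast
  show thesis
  proof (rule that[OF g(2)])
    fix y :: real assume "y \<in> {0<..<1}"
    then have "g x y = green \<alpha> \<omega> x y"
      using x by (intro green_function_unique[OF g(1) is_green_function_green[OF \<alpha>] Re_ipow_nonneg[OF \<alpha>]]) auto
    then show "g x y * (- h \<omega>) = green \<alpha> \<omega> x y * (- h \<omega>)" by simp
  qed
qed

lemma mild_solution_moment:
  assumes bm: "brownian_motion_01 M W" and \<alpha>: "0 < \<alpha>" "\<alpha> < 1" and U: "mild_solution M W \<alpha> h U" and x: "x \<in> {0<..<1}"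
  shows "L2_sq M (U x \<omega>) \<le> ennreal (18 * (cmod (h \<omega>))\<^sup>2)"
proof -
  obtain f where f: "is_wiener_integral M W f (U x \<omega>)" "\<And>y. y \<in> {0<..<1} \<Longrightarrow> f y = green \<alpha> \<omega> x y * (- h \<omega>)"
    by (rule mild_solution_wiener[where \<omega>=\<omega>, OF \<alpha> U x]) (rule that)
  have "L2_sq_01 f \<le> (\<integral>\<^sup>+y. ennreal (2 * (cmod (h \<omega>))\<^sup>2) * indicator {0<..<1} y \<partial>(lborel :: real measure))"
    using green_bound[OF \<alpha> x]
    by (intro nn_integral_mono) (auto simp: indicator_def f(2) norm_mult power_mult_distrib intro!: mult_right_mono)
  also have "\<dots> = ennreal (2 * (cmod (h \<omega>))\<^sup>2)" by (subst nn_integral_cmult_indicator) auto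
  \<comment> \<open>9 comes from the L2 estimate of the Wiener integral and 2 from the bound on the
    Green function.\<close>
  finally have "9 * L2_sq_01 f \<le> ennreal 9 * ennreal (2 * (cmod (h \<omega>))\<^sup>2)"
    by (intro mult_mono) auto
  also have "\<dots> = ennreal (18 * (cmod (h \<omega>))\<^sup>2)" by (subst ennreal_mult[symmetric]) auto
  finally show ?thesis using is_wiener_integral_bound[OF bm f(1)] by (rule order_trans[rotated])
qed

text \<open>Two applications of Tonelli's theorem move the expectation inside both other integrals,
  where the moment bound applies. Joint measurability of the solution is what permits the
  exchanges.\<close>

lemma mild_solution_energy:
  assumes bm: "brownian_motion_01 M W" and \<alpha>: "0 < \<alpha>" "\<alpha> < 1" and U: "mild_solution M W \<alpha> h U"
    and h[measurable]: "h \<in> borel_measurable borel"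
  shows "(\<integral>\<^sup>+s. L2_norm_sq (\<lambda>x \<omega>. \<i> * of_real \<omega> * U x \<omega> s) \<partial>M)
    \<le> 18 * (\<integral>\<^sup>+\<omega>. ennreal (\<omega>\<^sup>2 * (cmod (h \<omega>))\<^sup>2) \<partial>lborel)"
proof -
  interpret M: prob_space M by (rule brownian_prob_space[OF bm])
  let ?R = "restrict_space lborel {0<..<1::real}"
  interpret R: sigma_finite_measure ?R
    by (rule sigma_finite_measure_restrict_space[OF lborel.sigma_finite_measure_axioms]) auto
  interpret MB: pair_sigma_finite M "lborel :: real measure"
    by (intro pair_sigma_finite.intro M.sigma_finite_measure_axioms lborel.sigma_finite_measure_axioms)
  interpret MR: pair_sigma_finite M ?R
    by (intro pair_sigma_finite.intro M.sigma_finite_measure_axioms R.sigma_finite_measure_axioms)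
  define f where "f x \<omega> s = ennreal ((cmod (\<i> * of_real \<omega> * U x \<omega> s))\<^sup>2)" for x \<omega> s
  have Um: "(\<lambda>(x, \<omega>, s). U x \<omega> s) \<in> borel_measurable (restrict_space borel {0<..<1} \<Otimes>\<^sub>M borel \<Otimes>\<^sub>M M)"
    using U unfolding mild_solution_def by blast
  have s: "sets (restrict_space borel {0<..<1::real} \<Otimes>\<^sub>M borel \<Otimes>\<^sub>M M) = sets (?R \<Otimes>\<^sub>M lborel \<Otimes>\<^sub>M M)"
    by (intro sets_pair_measure_cong sets_restrict_space_cong) auto
  have Um': "(\<lambda>(x, \<omega>, s). U x \<omega> s) \<in> borel_measurable (?R \<Otimes>\<^sub>M lborel \<Otimes>\<^sub>M M)"
    using Um measurable_cong_sets[OF s refl] by blast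
  have f1: "(\<lambda>((s, \<omega>), x). f x \<omega> s) \<in> borel_measurable ((M \<Otimes>\<^sub>M lborel) \<Otimes>\<^sub>M ?R)"
  proof -
    have "(\<lambda>p. (snd p, snd (fst p), fst (fst p))) \<in> (M \<Otimes>\<^sub>M lborel) \<Otimes>\<^sub>M ?R \<rightarrow>\<^sub>M ?R \<Otimes>\<^sub>M lborel \<Otimes>\<^sub>M M" by measurable
    from measurable_compose[OF this Um']
    have [measurable]: "(\<lambda>p. U (snd p) (snd (fst p)) (fst (fst p))) \<in> borel_measurable ((M \<Otimes>\<^sub>M lborel) \<Otimes>\<^sub>M ?R)"
      by (simp add: case_prod_unfold)
    show ?thesis unfolding f_def case_prod_unfold by measurable
  qed
  have f2: "(\<lambda>(s, \<omega>). \<integral>\<^sup>+x. f x \<omega> s \<partial>?R) \<in> borel_measurable (M \<Otimes>\<^sub>M lborel)"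
    using R.borel_measurable_nn_integral_fst[OF f1] by (simp add: case_prod_unfold)
  have f3: "(\<lambda>(s, x). f x \<omega> s) \<in> borel_measurable (M \<Otimes>\<^sub>M ?R)" for \<omega>
  proof -
    have "(\<lambda>p. ((fst p, \<omega>), snd p)) \<in> M \<Otimes>\<^sub>M ?R \<rightarrow>\<^sub>M (M \<Otimes>\<^sub>M lborel) \<Otimes>\<^sub>M ?R" by measurable
    from measurable_compose[OF this f1] show ?thesis by (simp add: case_prod_unfold)
  qed
  have "(\<integral>\<^sup>+s. L2_norm_sq (\<lambda>x \<omega>. \<i> * of_real \<omega> * U x \<omega> s) \<partial>M) = (\<integral>\<^sup>+s. (\<integral>\<^sup>+\<omega>. (\<integral>\<^sup>+x. f x \<omega> s \<partial>?R) \<partial>lborel) \<partial>M)"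
    unfolding L2_norm_sq_def f_def by (simp add: set_nn_integral_restrict)
  also have "\<dots> = (\<integral>\<^sup>+\<omega>. (\<integral>\<^sup>+s. (\<integral>\<^sup>+x. f x \<omega> s \<partial>?R) \<partial>M) \<partial>lborel)"
    by (rule MB.Fubini'[OF f2, symmetric])
  also have "\<dots> = (\<integral>\<^sup>+\<omega>. (\<integral>\<^sup>+x. (\<integral>\<^sup>+s. f x \<omega> s \<partial>M) \<partial>?R) \<partial>lborel)"
    by (intro nn_integral_cong MR.Fubini'[OF f3, symmetric])
  also have "\<dots> \<le> (\<integral>\<^sup>+\<omega>. 18 * ennreal (\<omega>\<^sup>2 * (cmod (h \<omega>))\<^sup>2) \<partial>lborel)"
  proof (rule nn_integral_mono)
    fix \<omega> :: real
    have "(\<integral>\<^sup>+x. (\<integral>\<^sup>+s. f x \<omega> s \<partial>M) \<partial>?R) \<le> (\<integral>\<^sup>+x. 18 * ennreal (\<omega>\<^sup>2 * (cmod (h \<omega>))\<^sup>2) \<partial>?R)"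
    proof (rule nn_integral_mono)
      fix x assume "x \<in> space ?R"
      then have x: "x \<in> {0<..<1}" by (simp add: space_restrict_space)
      have [measurable]: "U x \<omega> \<in> borel_measurable M"
        using mild_solution_wiener[where \<omega>=\<omega>, OF \<alpha> U x] unfolding is_wiener_integral_def by metis
      have "(\<integral>\<^sup>+s. f x \<omega> s \<partial>M) = ennreal (\<omega>\<^sup>2) * L2_sq M (U x \<omega>)"
        unfolding f_def by (subst nn_integral_cmult[symmetric]) (auto simp: norm_mult power_mult_distrib ennreal_mult)
      also have "\<dots> \<le> ennreal (\<omega>\<^sup>2) * ennreal (18 * (cmod (h \<omega>))\<^sup>2)"
        by (intro mult_left_mono mild_solution_moment[OF bm \<alpha> U x]) auto
      also have "\<dots> = ennreal 18 * ennreal (\<omega>\<^sup>2 * (cmod (h \<omega>))\<^sup>2)"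
        by (simp only: ennreal_mult[symmetric] zero_le_power2 mult_nonneg_nonneg zero_le_numeral mult.left_commute)
      finally show "(\<integral>\<^sup>+s. f x \<omega> s \<partial>M) \<le> 18 * ennreal (\<omega>\<^sup>2 * (cmod (h \<omega>))\<^sup>2)" by simp
    qed
    also have "\<dots> = 18 * ennreal (\<omega>\<^sup>2 * (cmod (h \<omega>))\<^sup>2)"
      by (simp add: emeasure_restrict_space space_restrict_space)
    finally show "(\<integral>\<^sup>+x. (\<integral>\<^sup>+s. f x \<omega> s \<partial>M) \<partial>?R) \<le> 18 * ennreal (\<omega>\<^sup>2 * (cmod (h \<omega>))\<^sup>2)" .
  qed
  also have "\<dots> = 18 * (\<integral>\<^sup>+\<omega>. ennreal (\<omega>\<^sup>2 * (cmod (h \<omega>))\<^sup>2) \<partial>lborel)"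
    by (rule nn_integral_cmult) measurable
  finally show ?thesis .
qed

section \<open>From the half-line norm to the weighted transform\<close>

lemma zero_extension_L2:
  assumes "L2_on {0<..} F"
  shows "zero_extension F \<in> borel_measurable borel" "integrable lborel (\<lambda>t. (cmod (zero_extension F t))\<^sup>2)"
proof -
  let ?F = "\<lambda>t. indicator {0<..} t *\<^sub>R F t"
  have F[measurable]: "?F \<in> borel_measurable borel" and F2: "integrable lborel (\<lambda>t. (cmod (?F t))\<^sup>2)"
    using assms by (auto simp: L2_on_iff)
  \<comment> \<open>The extension keeps the value \<open>F 0\<close>, on which membership in L2 of
    the open half-line says nothing; one point is measurable and null.\<close>
  have e: "zero_extension F = (\<lambda>t. if t = 0 then F 0 else ?F t)"
    by (auto simp: zero_extension_def indicator_def fun_eq_iff)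
  show m[measurable]: "zero_extension F \<in> borel_measurable borel" unfolding e by measurable
  have "AE t in lborel. (cmod (?F t))\<^sup>2 = (cmod (zero_extension F t))\<^sup>2"
    using AE_lborel_singleton[of 0] by eventually_elim (simp add: e)
  then show "integrable lborel (\<lambda>t. (cmod (zero_extension F t))\<^sup>2)"
    using integrable_cong_AE[of "\<lambda>t. (cmod (?F t))\<^sup>2" lborel "\<lambda>t. (cmod (zero_extension F t))\<^sup>2"] F2 by simp
qed

lemma weighted_fourier_H1_bound:
  assumes F: "H1_half_line F" and v: "value_at_0 F = 0"
  shows "is_fourier_L2 (zero_extension F) (fourier_L2 (zero_extension F))"
    and "(\<integral>\<^sup>+\<omega>. ennreal (\<omega>\<^sup>2 * (cmod (fourier_L2 (zero_extension F) \<omega>))\<^sup>2) \<partial>lborel) \<le> ennreal (4 * pi * (H1_norm_half_line F)\<^sup>2)"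
proof -
  have LF: "L2_on {0<..} F" using F unfolding H1_half_line_def by blast
  note z = zero_extension_L2[OF LF]
  show h: "is_fourier_L2 (zero_extension F) (fourier_L2 (zero_extension F))"
    unfolding fourier_L2_def using is_fourier_L2_exists[OF z] by (rule someI_ex)
  let ?G = "weak_deriv_half_line F" let ?V = "\<lambda>t. indicator {0<..} t *\<^sub>R ?G t"
  note G = H1_value_0_primitive[OF F v]
  have G0: "?V \<in> borel_measurable borel" and G2: "integrable lborel (\<lambda>t. (cmod (?V t))\<^sup>2)"
    using G(1) by (auto simp: L2_on_iff)
  have "(\<integral>\<^sup>+\<omega>. ennreal (\<omega>\<^sup>2 * (cmod (fourier_L2 (zero_extension F) \<omega>))\<^sup>2) \<partial>lborel)
      \<le> ennreal (4 * pi) * L2_sq lborel (\<lambda>t. ?V t)"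
    by (rule weighted_fourier_bound[OF G0 G2 z G(2) h])
  also have "L2_sq lborel (\<lambda>t. ?V t) = ennreal (\<integral>t. (cmod (?V t))\<^sup>2 \<partial>lborel)"
    by (rule nn_integral_eq_integral[OF G2]) simp
  also have "(\<integral>t. (cmod (?V t))\<^sup>2 \<partial>lborel) = (LINT t:{0<..}|lborel. (cmod (?G t))\<^sup>2)"
    unfolding set_lebesgue_integral_def by (intro Bochner_Integration.integral_cong) (auto simp: indicator_def)
  also have "ennreal (4 * pi) * ennreal (LINT t:{0<..}|lborel. (cmod (?G t))\<^sup>2) = ennreal (4 * pi * (LINT t:{0<..}|lborel. (cmod (?G t))\<^sup>2))"
    by (rule ennreal_mult'[symmetric]) simp
  also have "\<dots> \<le> ennreal (4 * pi * (H1_norm_half_line F)\<^sup>2)"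
  proof (intro ennreal_leI mult_left_mono)
    have nn: "0 \<le> (LINT t:{0<..}|lborel. (cmod (f t))\<^sup>2)" for f :: "real \<Rightarrow> complex"
      unfolding set_lebesgue_integral_def by (intro Bochner_Integration.integral_nonneg) simp
    show "(LINT t:{0<..}|lborel. (cmod (?G t))\<^sup>2) \<le> (H1_norm_half_line F)\<^sup>2"
      unfolding H1_norm_half_line_def using nn[of F] nn[of ?G] by simp
  qed simp
  finally show "(\<integral>\<^sup>+\<omega>. ennreal (\<omega>\<^sup>2 * (cmod (fourier_L2 (zero_extension F) \<omega>))\<^sup>2) \<partial>lborel) \<le> ennreal (4 * pi * (H1_norm_half_line F)\<^sup>2)" .
qed

theorem theorem3p2:
  fixes M :: "'a measure" and W :: "real \<Rightarrow> 'a \<Rightarrow> real" and \<alpha> :: real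
  assumes "brownian_motion_01 M W" and "0 < \<alpha>" and "\<alpha> < 1"
  shows "\<exists>C::real. C > 0 \<and>
    (\<forall>F :: real \<Rightarrow> complex. H1_half_line F \<and> value_at_0 F = 0 \<longrightarrow>
      (let Fh = fourier_L2 (zero_extension F) in
        (\<exists>U. mild_solution M W \<alpha> Fh U) \<and>
        (\<forall>U V. mild_solution M W \<alpha> Fh U \<and> mild_solution M W \<alpha> Fh V \<longrightarrow>
           (\<forall>x\<in>{0<..<1}. \<forall>\<omega>. AE s in M. U x \<omega> s = V x \<omega> s)) \<and>
        (\<forall>U. mild_solution M W \<alpha> Fh U \<longrightarrow>
           (\<forall>x\<in>{0<..<1}. \<forall>\<omega>. AE s in M.
              U x \<omega> s = - Fh \<omega> * wiener_integral M W (\<lambda>y. green \<alpha> \<omega> x y) s) \<and>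
           (\<integral>\<^sup>+s. L2_norm_sq (\<lambda>x \<omega>. \<i> * of_real \<omega> * U x \<omega> s) \<partial>M)
             \<le> ennreal (C * (H1_norm_half_line F)\<^sup>2))))"
  unfolding Let_def
\<comment> \<open>72 * pi = 18 * (4 * pi): the second-moment constant of the solution times the
  constant of the weighted Fourier estimate.\<close>
proof (intro exI[of _ "72 * pi"] conjI allI impI ballI; (elim conjE)?)
  show "0 < 72 * pi" by simp
  note bm = assms(1) and \<alpha> = assms(2,3)
  fix F :: "real \<Rightarrow> complex"
  assume F: "H1_half_line F" "value_at_0 F = 0"
  let ?h = "fourier_L2 (zero_extension F)"
  have hm: "?h \<in> borel_measurable borel"
    using weighted_fourier_H1_bound(1)[OF F] unfolding is_fourier_L2_def by blast
  show "\<exists>U. mild_solution M W \<alpha> ?h U" by (rule mild_solution_exists[OF bm \<alpha> hm])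
  fix U assume U: "mild_solution M W \<alpha> ?h U"
  \<comment> \<open>Both the representation and uniqueness follow from this identity, since its
    right-hand side does not involve V.\<close>
  have formula: "AE s in M. V x \<omega> s = - ?h \<omega> * wiener_integral M W (\<lambda>y. green \<alpha> \<omega> x y) s"
    if V: "mild_solution M W \<alpha> ?h V" and x: "x \<in> {0<..<1}" for V x \<omega>
  proof -
    obtain f where f: "is_wiener_integral M W f (V x \<omega>)" "\<And>y. y \<in> {0<..<1} \<Longrightarrow> f y = green \<alpha> \<omega> x y * (- ?h \<omega>)"
      by (rule mild_solution_wiener[where \<omega>=\<omega>, OF \<alpha> V x]) (rule that)
    show ?thesis
      by (rule is_wiener_integral_unique[OF bm f(1) is_wiener_integral_scale[OF bm wiener_integral_green[OF bm x]] f(2)])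
  qed
  show "AE s in M. U x \<omega> s = - ?h \<omega> * wiener_integral M W (\<lambda>y. green \<alpha> \<omega> x y) s" if "x \<in> {0<..<1}" for x \<omega>
    by (rule formula[OF U that])
  show "AE s in M. U x \<omega> s = V x \<omega> s" if "mild_solution M W \<alpha> ?h V" "x \<in> {0<..<1}" for V x \<omega>
    using formula[OF U that(2), of \<omega>] formula[OF that, of \<omega>] by eventually_elim simp
  note mild_solution_energy[OF bm \<alpha> U hm]
  also have "18 * (\<integral>\<^sup>+\<omega>. ennreal (\<omega>\<^sup>2 * (cmod (?h \<omega>))\<^sup>2) \<partial>lborel) \<le> ennreal 18 * ennreal (4 * pi * (H1_norm_half_line F)\<^sup>2)"
    using mult_left_mono[OF weighted_fourier_H1_bound(2)[OF F], of 18] by simp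
  also have "\<dots> = ennreal (72 * pi * (H1_norm_half_line F)\<^sup>2)" by (subst ennreal_mult[symmetric]) auto
  finally show "(\<integral>\<^sup>+s. L2_norm_sq (\<lambda>x \<omega>. \<i> * of_real \<omega> * U x \<omega> s) \<partial>M) \<le> ennreal (72 * pi * (H1_norm_half_line F)\<^sup>2)" .
qed

end
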